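(* Let $\alpha\in(0,1)$, let $f_0$ be an initial density profile on $\mathbb R/2\pi\mathbb Z$ with $0\le f_0\le 1/(2\pi\alpha)$, and let $f(t,x)$ be the associated weak solution (see context) of $$\frac{\partial f}{\partial t}+\frac{1}{\alpha\sin(\pi\alpha)}\frac{\partial}{\partial x}\Big(\sin(2\pi^2\alpha f)\,\sinh(2\pi^2\alpha\,\mathcal Hf)\Big)=0.\qquad( * )$$ 1. Assume that there exists $\eta>0$ such that $\eta\le f_0(x)\le\frac1{2\pi\alpha}-\eta$ for all $x\in\mathbb R/2\pi\mathbb Z$. Then $(t,x)\mapsto f(t,x)$ is (real-)analytic on $(0,\infty)\times\mathbb R/2\pi\mathbb Z$ and satisfies $( * )$ in the strong sense on this domain. 2. For any initial density profile $f_0$ (with $0\le f_0\le 1/(2\pi\alpha)$), the following hold: (a) there exists $t^\ast>0$ such that $(t,x)\mapsto f(t,x)$ is analytic on $(t^\ast,\infty)\times\mathbb R/2\pi\mathbb Z$ and satisfies $( * )$ in the strong sense on this domain; (b) the solution relaxes exponentially fast to the uniform equilibrium: $$\limsup_{t\to\infty}\frac1t\log\left(\left\|f(t,\cdot)-\frac1{2\pi}\right\|_\infty\right)<0.$$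
   Context: $\mathbb D$ is the open unit disk. $\mathcal H$ is the spatial Hilbert transform on the circle: $\mathcal H\big(\sum_{n}c_ne^{inx}\big)=-i\sum_{n}\mathrm{sgn}(n)c_ne^{inx}$, $\mathrm{sgn}(0)=0$. A density profile is a measurable nonnegative function on $\mathbb R/2\pi\mathbb Z$ with integral $1$ with respect to $dx$; densities are identified when equal almost everywhere, so analyticity means having an analytic version. Weak solution. For a density profile $f_0$ with values in $[0,1/(2\pi\alpha)]$, let $g_0(z)=\sum_{n\ge1}z^n\int_0^{2\pi}e^{inx}f_0(x)\,dx$ for $z\in\mathbb D$, and let $\mathcal V_\alpha(z)=2\pi^2\sin(\pi\alpha(1+2z))/\sin(\pi\alpha)$. The equation $\partial_tg+z\,\mathcal V_\alpha(g)\,\partial_zg=0$ has a unique analytic solution $g(t,z)$ on $[0,\infty)\times\mathbb D$ with $g(0,\cdot)=g_0$, and for each $t\ge0$ there is a unique density profile $f(t,\cdot)$ with values in $[0,1/(2\pi\alpha)]$ such that $g(t,z)=\sum_{n\ge1}z^n\int_0^{2\pi}e^{inx}f(t,x)\,dx$. The family $(f(t,\cdot))_{t\ge0}$ is the weak solution of $( * )$ with initial datum $f_0$ (it is the hydrodynamic limit of the empirical measures of the maximal entropy symmetric exclusion process). *)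

theory Defs
  imports "HOL-Probability.Essential_Supremum"
begin

text \<open>
  Functions on the circle are \<open>2 * pi\<close>-periodic functions on the reals. Densities are identified
  when equal almost everywhere, so inequalities between densities are always meant almost
  everywhere.
\<close>

definition circle_fun :: "(real \<Rightarrow> 'a) \<Rightarrow> bool" where
  "circle_fun f \<longleftrightarrow> (\<forall>x. f (x + 2 * pi) = f x)"

definition density_profile :: "(real \<Rightarrow> real) \<Rightarrow> bool" where
  "density_profile f \<longleftrightarrow>
     circle_fun f \<and> f \<in> borel_measurable lebesgue \<and> (AE x in lebesgue. 0 \<le> f x) \<and>
     (LINT x:{0..2 * pi}|lebesgue. f x) = 1"

definition exclusion_profile :: "real \<Rightarrow> (real \<Rightarrow> real) \<Rightarrow> bool" where
  "exclusion_profile \<alpha> f \<longleftrightarrow>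
     density_profile f \<and> (AE x in lebesgue. f x \<le> 1 / (2 * pi * \<alpha>))"

definition circle_moment :: "(real \<Rightarrow> real) \<Rightarrow> int \<Rightarrow> complex" where
  "circle_moment f n = (LINT x:{0..2 * pi}|lebesgue. cis (of_int n * x) * of_real (f x))"

definition moment_series :: "(real \<Rightarrow> real) \<Rightarrow> complex \<Rightarrow> complex" where
  "moment_series f z = (\<Sum>n. z ^ Suc n * circle_moment f (int (Suc n)))"

definition velocity :: "real \<Rightarrow> complex \<Rightarrow> complex" where
  "velocity \<alpha> z =
     2 * of_real pi ^ 2 * sin (of_real (pi * \<alpha>) * (1 + 2 * z)) / of_real (sin (pi * \<alpha>))"

text \<open>
  Joint analyticity in a real time variable and a real or complex space variable. The domain
  \<open>S\<close> need not be open: at \<open>t = 0\<close> in \<open>[0, \<infinity>) \<times> \<D>\<close> this is analyticity up to the boundary.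
\<close>

definition jointly_analytic_on ::
    "(real \<Rightarrow> 'a \<Rightarrow> 'a) \<Rightarrow> (real \<times> 'a::real_normed_field) set \<Rightarrow> bool" where
  "jointly_analytic_on F S \<longleftrightarrow>
     (\<forall>(t0, z0) \<in> S. \<exists>(c :: nat \<Rightarrow> nat \<Rightarrow> 'a) r. r > 0 \<and>
        (\<forall>t z. (t, z) \<in> S \<and> \<bar>t - t0\<bar> < r \<and> norm (z - z0) < r \<longrightarrow>
          ((\<lambda>(m, n). c m n * of_real (t - t0) ^ m * (z - z0) ^ n) has_sum F t z) UNIV))"

definition disk_solution ::
    "real \<Rightarrow> (complex \<Rightarrow> complex) \<Rightarrow> (real \<Rightarrow> complex \<Rightarrow> complex) \<Rightarrow> bool" where
  "disk_solution \<alpha> g0 g \<longleftrightarrow>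
     jointly_analytic_on g ({0..} \<times> ball 0 1) \<and>
     (\<forall>z \<in> ball 0 1. g 0 z = g0 z) \<and>
     (\<forall>t \<ge> 0. \<forall>z \<in> ball 0 1.
        ((\<lambda>s. g s z) has_vector_derivative - (z * velocity \<alpha> (g t z) * deriv (g t) z))
          (at t within {0..}))"

definition weak_solution ::
    "real \<Rightarrow> (real \<Rightarrow> real) \<Rightarrow> (real \<Rightarrow> real \<Rightarrow> real) \<Rightarrow> bool" where
  "weak_solution \<alpha> f0 f \<longleftrightarrow>
     (\<exists>g. disk_solution \<alpha> (moment_series f0) g \<and>
        (\<forall>t \<ge> 0. exclusion_profile \<alpha> (f t) \<and> (\<forall>z \<in> ball 0 1. g t z = moment_series (f t) z)))"

text \<open>
  The \<open>n\<close>-th Fourier coefficient of \<open>f\<close> is \<open>circle_moment f (- n) / (2 * pi)\<close>. The Hilbert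
  transform is a relation, so that convergence of its defining series is part of the claim
  wherever it is used.
\<close>

definition has_hilbert_transform :: "(real \<Rightarrow> real) \<Rightarrow> (real \<Rightarrow> real) \<Rightarrow> bool" where
  "has_hilbert_transform f h \<longleftrightarrow>
     (\<forall>x. ((\<lambda>n::int. - \<i> * of_int (sgn n) * (circle_moment f (- n) / of_real (2 * pi))
              * cis (of_int n * x)) has_sum of_real (h x)) UNIV)"

definition strong_solution_after :: "real \<Rightarrow> real \<Rightarrow> (real \<Rightarrow> real \<Rightarrow> real) \<Rightarrow> bool" where
  "strong_solution_after \<alpha> T F \<longleftrightarrow>
     (\<exists>h. \<forall>t > T. has_hilbert_transform (F t) (h t) \<and>
        (\<forall>x. let flux = (\<lambda>y. sin (2 * pi\<^sup>2 * \<alpha> * F t y) * sinh (2 * pi\<^sup>2 * \<alpha> * h t y)) in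
           (\<lambda>s. F s x) field_differentiable (at t) \<and>
           flux field_differentiable (at x) \<and>
           deriv (\<lambda>s. F s x) t + 1 / (\<alpha> * sin (pi * \<alpha>)) * deriv flux x = 0))"

text \<open>\<open>F\<close> is the analytic version of the family of almost-everywhere classes \<open>f t\<close>.\<close>

definition analytic_strong_after :: "real \<Rightarrow> real \<Rightarrow> (real \<Rightarrow> real \<Rightarrow> real) \<Rightarrow> bool" where
  "analytic_strong_after \<alpha> T f \<longleftrightarrow>
     (\<exists>F. (\<forall>t > T. circle_fun (F t) \<and> (AE x in lebesgue. F t x = f t x)) \<and>
        jointly_analytic_on F ({T<..} \<times> UNIV) \<and>
        strong_solution_after \<alpha> T F)"

definition sup_norm :: "(real \<Rightarrow> real) \<Rightarrow> ereal" where
  "sup_norm u = esssup lebesgue (\<lambda>x. ereal \<bar>u x\<bar>)"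

text \<open>The convention \<open>ln 0 = 0\<close> on the reals would be wrong for the decay rate at equilibrium.\<close>

definition ereal_log :: "ereal \<Rightarrow> ereal" where
  "ereal_log y = (if y \<le> 0 then - \<infinity> else if y = \<infinity> then \<infinity> else ereal (ln (real_of_ereal y)))"

end

theory Submission
  imports Defs "HOL-Complex_Analysis.Complex_Analysis"
begin

text \<open>
  Let \<open>g(t, z)\<close> be the moment series of \<open>f(t)\<close>, with coefficients \<open>m\<^sub>n(t)\<close>, and let
  \<open>p(z) = V(g(0, z))\<close> be the initial velocity. The solution carries the value at \<open>z\<close> along
  \<open>z exp (t p(z))\<close>, and \<open>Re p > 0\<close> in the disk: the real part of \<open>1 + 2 g(0, z)\<close> is a Poisson integral of \<open>f0\<close>, so that
  \<open>pi \<alpha> (1 + 2 g(0, z))\<close> lies in the strip of real parts between \<open>0\<close> and \<open>pi\<close>, where the sine has a positive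
  real part. So values move outwards, and where \<open>Re p\<close> is bounded below by a positive constant they
  leave the unit disk in finite time: after that the series converges beyond the unit circle.

  To make this quantitative no flow has to be inverted. The transport equation makes
  \<open>\<partial>\<^sub>z g exp (- n (t - s) V(g)) / z\<^sup>n\<close> have an exact time derivative, so its integral over a circle
  of radius \<open>r < 1\<close> is the same at \<open>s = t\<close> and \<open>s = 0\<close> (\<open>conserved_circle_integral\<close>):
  \<open>n m\<^sub>n(t) = 1 / (2 pi i) \<integral> \<partial>\<^sub>z g(0, z) exp (- n t p(z)) / z\<^sup>n dz\<close>.
  If \<open>Re p \<ge> c\<close> on the disk of radius \<open>\<rho>\<close>, then \<open>\<bar>m\<^sub>n(t)\<bar> \<le> C (exp (- c t) / r)\<^sup>n\<close> for each
  \<open>r < \<rho>\<close>, and the formula continues \<open>m\<^sub>n\<close> holomorphically to complex times with almost the same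
  bound (\<open>moment_extension_geometric_decay\<close>).

  Everything follows from this once \<open>\<rho> exp (c t) > 1\<close>. The Fourier series of \<open>f(t)\<close> converges
  geometrically; its sum \<open>F(t, x) = Re K(t, cis (- x)) / pi\<close>, with \<open>K = 1 / 2 + g\<close> in the disk,
  is jointly real-analytic (\<open>fourier_sum_real_analytic\<close>) and equals \<open>f(t)\<close> almost everywhere by uniqueness of
  Fourier coefficients (\<open>AE_zero_if_moments_zero\<close>). Its Hilbert transform is \<open>- Im K / pi\<close>, so the flux is
  \<open>Im (cos (2 pi \<alpha> K))\<close>. The transport equation holds for \<open>K\<close> in the disk and, by analytic continuation,
  across the circle (\<open>equation_extends_across_circle\<close>), where its real part is the conservation law
  (\<open>conservation_law_on_circle\<close>). Summing the bounds on \<open>m\<^sub>n(t)\<close> gives the exponential relaxation.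
\<close>

section \<open>Holomorphic families that are Lipschitz in time\<close>

text \<open>
  The transport equation gives a time derivative at each fixed point of the disk, while
  differentiation under a circle integral needs continuity in time and space jointly. Being holomorphic in space, with a bound and a Lipschitz constant in time that are
  uniform on smaller disks, is a property that passes to space derivatives (by Cauchy's estimate),
  products and compositions with entire functions, and it implies joint continuity.
\<close>

definition time_lipschitz :: "(real \<Rightarrow> complex \<Rightarrow> complex) \<Rightarrow> bool" where
  "time_lipschitz u \<longleftrightarrow> (\<forall>s\<ge>0. u s holomorphic_on ball 0 1) \<and>
     (\<forall>r<1. \<exists>B. \<forall>s\<ge>0. \<forall>s'\<ge>0. \<forall>z\<in>cball 0 r.
        norm (u s z) \<le> B \<and> norm (u s z - u s' z) \<le> B * \<bar>s - s'\<bar>)"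

lemma time_lipschitz_holomorphic: "time_lipschitz u \<Longrightarrow> 0 \<le> s \<Longrightarrow> u s holomorphic_on ball 0 1"
  by (simp add: time_lipschitz_def)

lemma time_lipschitzE:
  assumes "time_lipschitz u" "r < 1"
  obtains B where "B \<ge> 0" "\<And>s z. 0 \<le> s \<Longrightarrow> norm z \<le> r \<Longrightarrow> norm (u s z) \<le> B"
    "\<And>s s' z. 0 \<le> s \<Longrightarrow> 0 \<le> s' \<Longrightarrow> norm z \<le> r \<Longrightarrow> norm (u s z - u s' z) \<le> B * \<bar>s - s'\<bar>"
proof -
  from assms obtain B where B: "\<forall>s\<ge>0. \<forall>s'\<ge>0. \<forall>z\<in>cball 0 r.
        norm (u s z) \<le> B \<and> norm (u s z - u s' z) \<le> B * \<bar>s - s'\<bar>"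
    unfolding time_lipschitz_def by blast
  have le: "B * x \<le> max B 0 * x" if "x \<ge> 0" for x :: real
    using that by (intro mult_right_mono) auto
  show ?thesis
  proof (rule that[of "max B 0"])
    show "norm (u s z - u s' z) \<le> max B 0 * \<bar>s - s'\<bar>" if "0 \<le> s" "0 \<le> s'" "norm z \<le> r" for s s' z
    proof -
      have "norm (u s z - u s' z) \<le> B * \<bar>s - s'\<bar>" using B that by simp
      also have "\<dots> \<le> max B 0 * \<bar>s - s'\<bar>" by (rule le) simp
      finally show ?thesis .
    qed
    show "norm (u s z) \<le> max B 0" if "0 \<le> s" "norm z \<le> r" for s z
    proof -
      have "norm (u s z) \<le> B" using B that by auto
      then show ?thesis by simp
    qed
  qed auto
qed

lemma time_lipschitzI:
  assumes "\<And>s. 0 \<le> s \<Longrightarrow> u s holomorphic_on ball 0 1"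
    and "\<And>r. 0 \<le> r \<Longrightarrow> r < 1 \<Longrightarrow> \<exists>B. \<forall>s\<ge>0. \<forall>z\<in>cball 0 r. norm (u s z) \<le> B"
    and "\<And>r. 0 \<le> r \<Longrightarrow> r < 1 \<Longrightarrow> \<exists>B. \<forall>s\<ge>0. \<forall>s'\<ge>0. \<forall>z\<in>cball 0 r. norm (u s z - u s' z) \<le> B * \<bar>s - s'\<bar>"
  shows "time_lipschitz u"
  unfolding time_lipschitz_def
proof (intro conjI allI impI)
  fix r :: real assume r: "r < 1"
  show "\<exists>B. \<forall>s\<ge>0. \<forall>s'\<ge>0. \<forall>z\<in>cball 0 r.
        norm (u s z) \<le> B \<and> norm (u s z - u s' z) \<le> B * \<bar>s - s'\<bar>"
  proof (cases "r \<ge> 0")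
    case True
    obtain B where B: "\<forall>s\<ge>0. \<forall>z\<in>cball 0 r. norm (u s z) \<le> B" using assms(2) r True by blast
    obtain C where C: "\<forall>s\<ge>0. \<forall>s'\<ge>0. \<forall>z\<in>cball 0 r. norm (u s z - u s' z) \<le> C * \<bar>s - s'\<bar>"
      using assms(3) r True by blast
    have le: "C * \<bar>s - s'\<bar> \<le> max B C * \<bar>s - s'\<bar>" for s s' :: real
      by (intro mult_right_mono) auto
    have "norm (u s z) \<le> max B C \<and> norm (u s z - u s' z) \<le> max B C * \<bar>s - s'\<bar>"
      if s: "0 \<le> s" "0 \<le> s'" "z \<in> cball 0 r" for s s' z
    proof
      show "norm (u s z) \<le> max B C" using B s by (meson max.coboundedI1)
      show "norm (u s z - u s' z) \<le> max B C * \<bar>s - s'\<bar>" using C s le order_trans by blast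
    qed
    then show ?thesis by blast
  qed auto
qed (use assms in auto)

text \<open>
  Cauchy's estimate on the disk of radius \<open>r' - r\<close> around the point.
\<close>

lemma deriv_bound_smaller_disc:
  assumes "f holomorphic_on ball 0 1" "norm z \<le> r" "r < r'" "r' < 1"
    and "\<And>w. norm w \<le> r' \<Longrightarrow> norm (f w) \<le> B"
  shows "norm (deriv f z) \<le> B / (r' - r)"
proof -
  have sub: "cball z (r' - r) \<subseteq> cball 0 r'"
    using assms(2) by (auto simp: dist_norm) (smt (verit) norm_minus_commute norm_triangle_sub)
  also have "\<dots> \<subseteq> ball 0 1" using assms(4) by auto
  finally have sub': "cball z (r' - r) \<subseteq> ball 0 1" .
  have "norm ((deriv ^^ 1) f z) \<le> fact 1 * B / (r' - r) ^ 1"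
  proof (rule Cauchy_inequality)
    show "f holomorphic_on ball z (r' - r)"
      by (rule holomorphic_on_subset[OF assms(1)]) (use sub' in auto)
    show "continuous_on (cball z (r' - r)) f"
      by (rule holomorphic_on_imp_continuous_on, rule holomorphic_on_subset[OF assms(1) sub'])
    show "norm (f x) \<le> B" if "norm (z - x) = r' - r" for x
    proof -
      have "x \<in> cball z (r' - r)" using that by (simp add: dist_norm)
      then show ?thesis using sub assms(5) by auto
    qed
  qed (use assms in auto)
  then show ?thesis by simp
qed

text \<open>
  The Lipschitz bound of the derivative is Cauchy's estimate for the difference of the functions at
  two times.
\<close>

lemma time_lipschitz_deriv:
  assumes u: "time_lipschitz u"
  shows "time_lipschitz (\<lambda>s. deriv (u s))"
proof (rule time_lipschitzI)
  show "deriv (u s) holomorphic_on ball 0 1" if "0 \<le> s" for s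
    using time_lipschitz_holomorphic[OF u that] by (intro holomorphic_deriv) auto
  fix r :: real assume r: "0 \<le> r" "r < 1"
  define r' where "r' = (1 + r) / 2"
  have r': "r < r'" "r' < 1" using r by (auto simp: r'_def)
  obtain B where B: "\<And>s z. 0 \<le> s \<Longrightarrow> norm z \<le> r' \<Longrightarrow> norm (u s z) \<le> B"
    "\<And>s s' z. 0 \<le> s \<Longrightarrow> 0 \<le> s' \<Longrightarrow> norm z \<le> r' \<Longrightarrow> norm (u s z - u s' z) \<le> B * \<bar>s - s'\<bar>"
    using time_lipschitzE[OF u r'(2)] by metis
  have "norm (deriv (u s) z) \<le> B / (r' - r)" if "0 \<le> s" "norm z \<le> r" for s z
    using deriv_bound_smaller_disc[OF time_lipschitz_holomorphic[OF u that(1)] that(2) r'] B(1) that by blast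
  then show "\<exists>B. \<forall>s\<ge>0. \<forall>z\<in>cball 0 r. norm (deriv (u s) z) \<le> B"
    by (intro exI[of _ "B / (r' - r)"] allI impI ballI) (metis mem_cball_0)
  have "norm (deriv (u s) z - deriv (u s') z) \<le> B / (r' - r) * \<bar>s - s'\<bar>"
    if s: "0 \<le> s" "0 \<le> s'" "norm z \<le> r" for s s' z
  proof -
    have hol: "u s holomorphic_on ball 0 1" "u s' holomorphic_on ball 0 1"
      using time_lipschitz_holomorphic[OF u] s by auto
    have "z \<in> ball 0 1" using s r by auto
    then have "deriv (\<lambda>z. u s z - u s' z) z = deriv (u s) z - deriv (u s') z"
      using hol by (intro deriv_diff) (auto simp: holomorphic_on_imp_differentiable_at)
    moreover have "norm (deriv (\<lambda>z. u s z - u s' z) z) \<le> (B * \<bar>s - s'\<bar>) / (r' - r)"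
      by (rule deriv_bound_smaller_disc[OF _ s(3) r'])
         (use hol B(2) s in \<open>auto intro: holomorphic_intros\<close>)
    ultimately show ?thesis by simp
  qed
  then show "\<exists>B. \<forall>s\<ge>0. \<forall>s'\<ge>0. \<forall>z\<in>cball 0 r. norm (deriv (u s) z - deriv (u s') z) \<le> B * \<bar>s - s'\<bar>"
    by (intro exI[of _ "B / (r' - r)"] allI impI ballI) (metis mem_cball_0)
qed

lemma time_lipschitz_mult:
  assumes u: "time_lipschitz u" and v: "time_lipschitz v"
  shows "time_lipschitz (\<lambda>s z. u s z * v s z)"
proof (rule time_lipschitzI)
  show "(\<lambda>z. u s z * v s z) holomorphic_on ball 0 1" if "0 \<le> s" for s
    using time_lipschitz_holomorphic[OF u that] time_lipschitz_holomorphic[OF v that]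
    by (intro holomorphic_intros)
  fix r :: real assume r: "0 \<le> r" "r < 1"
  obtain B where B: "B \<ge> 0" "\<And>s z. 0 \<le> s \<Longrightarrow> norm z \<le> r \<Longrightarrow> norm (u s z) \<le> B"
    "\<And>s s' z. 0 \<le> s \<Longrightarrow> 0 \<le> s' \<Longrightarrow> norm z \<le> r \<Longrightarrow> norm (u s z - u s' z) \<le> B * \<bar>s - s'\<bar>"
    using time_lipschitzE[OF u r(2)] by metis
  obtain C where C: "C \<ge> 0" "\<And>s z. 0 \<le> s \<Longrightarrow> norm z \<le> r \<Longrightarrow> norm (v s z) \<le> C"
    "\<And>s s' z. 0 \<le> s \<Longrightarrow> 0 \<le> s' \<Longrightarrow> norm z \<le> r \<Longrightarrow> norm (v s z - v s' z) \<le> C * \<bar>s - s'\<bar>"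
    using time_lipschitzE[OF v r(2)] by metis
  have "norm (u s z * v s z) \<le> B * C" if "0 \<le> s" "norm z \<le> r" for s z
    unfolding norm_mult using B C that by (intro mult_mono) auto
  then show "\<exists>B. \<forall>s\<ge>0. \<forall>z\<in>cball 0 r. norm (u s z * v s z) \<le> B"
    by (intro exI[of _ "B * C"] allI impI ballI) (metis mem_cball_0)
  have "norm (u s z * v s z - u s' z * v s' z) \<le> (2 * B * C) * \<bar>s - s'\<bar>"
    if s: "0 \<le> s" "0 \<le> s'" "norm z \<le> r" for s s' z
  proof -
    have "u s z * v s z - u s' z * v s' z = u s z * (v s z - v s' z) + (u s z - u s' z) * v s' z"
      by (simp add: algebra_simps)
    also have "norm \<dots> \<le> norm (u s z) * norm (v s z - v s' z) + norm (u s z - u s' z) * norm (v s' z)"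
      by (metis norm_mult norm_triangle_ineq)
    also have "\<dots> \<le> B * (C * \<bar>s - s'\<bar>) + (B * \<bar>s - s'\<bar>) * C"
      using B C s by (intro add_mono mult_mono) auto
    finally show ?thesis by (simp add: algebra_simps)
  qed
  then show "\<exists>B. \<forall>s\<ge>0. \<forall>s'\<ge>0. \<forall>z\<in>cball 0 r. norm (u s z * v s z - u s' z * v s' z) \<le> B * \<bar>s - s'\<bar>"
    by (intro exI[of _ "2 * B * C"] allI impI ballI) (metis mem_cball_0)
qed

lemma time_lipschitz_static:
  assumes "f holomorphic_on ball 0 1"
  shows "time_lipschitz (\<lambda>_. f)"
proof (rule time_lipschitzI)
  fix r :: real assume r: "0 \<le> r" "r < 1"
  have "continuous_on (cball 0 r) f"
    by (rule holomorphic_on_imp_continuous_on, rule holomorphic_on_subset[OF assms]) (use r in auto)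
  then have "bounded (f ` cball 0 r)" by (intro compact_imp_bounded compact_continuous_image) auto
  then show "\<exists>B. \<forall>s\<ge>(0::real). \<forall>z\<in>cball 0 r. norm (f z) \<le> B" by (auto simp: bounded_iff)
  show "\<exists>B. \<forall>s\<ge>(0::real). \<forall>s'\<ge>(0::real). \<forall>z\<in>cball 0 r. norm (f z - f z) \<le> B * \<bar>s - s'\<bar>"
    by (intro exI[of _ 0]) auto
qed (use assms in auto)

lemma time_lipschitz_compose:
  assumes u: "time_lipschitz u" and V: "V holomorphic_on UNIV"
  shows "time_lipschitz (\<lambda>s z. V (u s z))"
proof (rule time_lipschitzI)
  have hol: "V holomorphic_on S" for S using V holomorphic_on_subset by blast
  show "(\<lambda>z. V (u s z)) holomorphic_on ball 0 1" if "0 \<le> s" for s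
    using holomorphic_on_compose[OF time_lipschitz_holomorphic[OF u that] hol] by (simp add: o_def)
  fix r :: real assume r: "0 \<le> r" "r < 1"
  obtain B where B: "B \<ge> 0" "\<And>s z. 0 \<le> s \<Longrightarrow> norm z \<le> r \<Longrightarrow> norm (u s z) \<le> B"
    "\<And>s s' z. 0 \<le> s \<Longrightarrow> 0 \<le> s' \<Longrightarrow> norm z \<le> r \<Longrightarrow> norm (u s z - u s' z) \<le> B * \<bar>s - s'\<bar>"
    using time_lipschitzE[OF u r(2)] by metis
  have bdd: "\<exists>C. \<forall>w. norm w \<le> B \<longrightarrow> norm (h w) \<le> C" if "h holomorphic_on UNIV" for h :: "complex \<Rightarrow> complex"
  proof -
    have "continuous_on (cball 0 B) h"
      by (rule holomorphic_on_imp_continuous_on, rule holomorphic_on_subset[OF that]) auto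
    then have "bounded (h ` cball 0 B)" by (intro compact_imp_bounded compact_continuous_image) auto
    then obtain C where "\<forall>w\<in>cball 0 B. norm (h w) \<le> C" by (auto simp: bounded_iff)
    then show ?thesis by (intro exI[of _ C]) auto
  qed
  obtain C where C: "\<And>w. norm w \<le> B \<Longrightarrow> norm (V w) \<le> C" using bdd[OF V] by blast
  have dV: "deriv V holomorphic_on UNIV" using V by (intro holomorphic_deriv) auto
  obtain D where D: "\<And>w. norm w \<le> B \<Longrightarrow> norm (deriv V w) \<le> D" using bdd[OF dV] by blast
  have "D \<ge> 0" by (rule order_trans[OF norm_ge_zero D[of 0]]) (use B(1) in simp)
  show "\<exists>B. \<forall>s\<ge>0. \<forall>z\<in>cball 0 r. norm (V (u s z)) \<le> B"
    by (intro exI[of _ C] allI impI ballI C B(2)) auto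
  have "norm (V (u s z) - V (u s' z)) \<le> (D * B) * \<bar>s - s'\<bar>"
    if s: "0 \<le> s" "0 \<le> s'" "norm z \<le> r" for s s' z
  proof -
    have "norm (V (u s z) - V (u s' z)) \<le> D * norm (u s z - u s' z)"
    proof (rule field_differentiable_bound[of "cball 0 B"])
      show "(V has_field_derivative deriv V w) (at w within cball 0 B)" for w
        using V by (simp add: holomorphic_derivI)
    qed (use B s D in auto)
    also have "\<dots> \<le> D * (B * \<bar>s - s'\<bar>)" using B(3) s \<open>D \<ge> 0\<close> by (intro mult_left_mono) auto
    finally show ?thesis by (simp add: mult.assoc)
  qed
  then show "\<exists>B. \<forall>s\<ge>0. \<forall>s'\<ge>0. \<forall>z\<in>cball 0 r. norm (V (u s z) - V (u s' z)) \<le> B * \<bar>s - s'\<bar>"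
    by (intro exI[of _ "D * B"] allI impI ballI) (metis mem_cball_0)
qed

lemma time_lipschitz_continuous:
  assumes u: "time_lipschitz u"
  shows "continuous_on ({0..} \<times> ball 0 1) (\<lambda>(s, z). u s z)"
  unfolding continuous_on_def
proof safe
  fix s0 :: real and z0 :: complex assume s0: "0 \<le> s0" and z0: "z0 \<in> ball 0 1"
  let ?F = "at (s0, z0) within {0..} \<times> ball 0 1"
  define r where "r = (1 + norm z0) / 2"
  have r: "norm z0 < r" "r < 1" using z0 by (auto simp: r_def)
  obtain B where B: "\<And>s s' z. 0 \<le> s \<Longrightarrow> 0 \<le> s' \<Longrightarrow> norm z \<le> r \<Longrightarrow> norm (u s z - u s' z) \<le> B * \<bar>s - s'\<bar>"
    using time_lipschitzE[OF u r(2)] by metis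
  have contz: "isCont (u s0) z0"
    using time_lipschitz_holomorphic[OF u s0] z0
    by (metis centre_in_ball field_differentiable_imp_continuous_at holomorphic_on_imp_differentiable_at open_ball)
  have lims: "((\<lambda>p. fst p) \<longlongrightarrow> s0) ?F" "((\<lambda>p. snd p) \<longlongrightarrow> z0) ?F"
    by (auto intro!: tendsto_eq_intros)
  have "((\<lambda>p. B * \<bar>fst p - s0\<bar> + norm (u s0 (snd p) - u s0 z0)) \<longlongrightarrow> B * \<bar>s0 - s0\<bar> + norm (u s0 z0 - u s0 z0)) ?F"
    by (intro tendsto_intros lims isCont_tendsto_compose[OF contz])
  then have lim: "((\<lambda>p. B * \<bar>fst p - s0\<bar> + norm (u s0 (snd p) - u s0 z0)) \<longlongrightarrow> 0) ?F" by simp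
  have "eventually (\<lambda>p. norm (snd p) < r) ?F"
    using order_tendstoD(2)[OF tendsto_norm[OF lims(2)] r(1)] .
  moreover have "eventually (\<lambda>p. p \<in> {0..} \<times> ball 0 1) ?F"
    by (simp add: eventually_at_filter)
  ultimately have "eventually (\<lambda>p. norm ((\<lambda>(s, z). u s z) p - u s0 z0) \<le> B * \<bar>fst p - s0\<bar> + norm (u s0 (snd p) - u s0 z0)) ?F"
  proof eventually_elim
    case (elim p)
    obtain s z where p: "p = (s, z)" by force
    have "norm (u s z - u s0 z) \<le> B * \<bar>s - s0\<bar>" using elim s0 by (intro B) (auto simp: p)
    then show ?case using norm_triangle_ineq[of "u s z - u s0 z" "u s0 z - u s0 z0"] by (simp add: p)
  qed
  then have "((\<lambda>p. (\<lambda>(s, z). u s z) p - u s0 z0) \<longlongrightarrow> 0) ?F"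
    by (rule Lim_null_comparison[OF _ lim])
  then show "((\<lambda>(s, z). u s z) \<longlongrightarrow> u s0 z0) ?F"
    by (simp add: LIM_zero_iff case_prod_unfold)
qed

lemma has_vector_derivative_circle_integral:
  fixes \<Phi> \<Phi>' :: "real \<Rightarrow> complex \<Rightarrow> complex"
  assumes der: "\<And>s z. s \<in> U \<Longrightarrow> norm z = r \<Longrightarrow> ((\<lambda>s. \<Phi> s z) has_vector_derivative \<Phi>' s z) (at s within U)"
    and cont: "\<And>s. s \<in> U \<Longrightarrow> continuous_on (sphere 0 r) (\<Phi> s)"
    and cont': "continuous_on (U \<times> sphere 0 r) (\<lambda>(s, z). \<Phi>' s z)"
    and U: "s0 \<in> U" "convex U" and r: "0 \<le> r"
  shows "((\<lambda>s. contour_integral (circlepath 0 r) (\<Phi> s)) has_vector_derivative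
           contour_integral (circlepath 0 r) (\<Phi>' s0)) (at s0 within U)"
proof -
  let ?c = "circlepath 0 r"
  have nc: "norm (?c x) = r" for x using r by (simp add: circlepath norm_mult)
  have cc: "continuous_on S ?c" for S unfolding circlepath by (intro continuous_intros)
  have eq: "contour_integral ?c f = integral (cbox 0 1) (\<lambda>x. f (?c x) * (2 * pi * \<i> * r * exp (2 * of_real pi * \<i> * x)))" for f
    by (simp add: contour_integral_integral vector_derivative_circlepath)
  show ?thesis unfolding eq
  proof (rule leibniz_rule_vector_derivative[OF _ _ _ U])
    fix s x :: real assume s: "s \<in> U" "x \<in> cbox 0 1"
    show "((\<lambda>s. \<Phi> s (?c x) * (2 * pi * \<i> * r * exp (2 * of_real pi * \<i> * x))) has_vector_derivative
        \<Phi>' s (?c x) * (2 * pi * \<i> * r * exp (2 * of_real pi * \<i> * x))) (at s within U)"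
      by (intro has_vector_derivative_mult_left der s nc)
  next
    fix s :: real assume s: "s \<in> U"
    have "continuous_on (cbox 0 1) (\<lambda>x. \<Phi> s (?c x))"
      by (rule continuous_on_compose2[OF cont[OF s] cc]) (auto simp: nc)
    then show "(\<lambda>x. \<Phi> s (?c x) * (2 * pi * \<i> * r * exp (2 * of_real pi * \<i> * x))) integrable_on cbox 0 1"
      by (intro integrable_continuous continuous_intros)
  next
    have "continuous_on (U \<times> cbox 0 1) (\<lambda>p. (\<lambda>(s, z). \<Phi>' s z) (fst p, ?c (snd p)))"
      by (rule continuous_on_compose2[OF cont'])
         (auto intro!: continuous_intros continuous_on_compose2[OF cc[of UNIV]] simp: nc)
    then show "continuous_on (U \<times> cbox 0 1) (\<lambda>(s, x). \<Phi>' s (?c x) * (2 * pi * \<i> * r * exp (2 * of_real pi * \<i> * x)))"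
      unfolding case_prod_unfold by (intro continuous_intros) auto
  qed
qed

section \<open>A conserved circle integral for the transport equation\<close>

text \<open>
  Solutions of \<open>\<partial>\<^sub>t g + z V(g) \<partial>\<^sub>z g = 0\<close> on the unit disk. The time derivative at \<open>s = 0\<close> is
  one-sided.
\<close>

locale transport_solution =
  fixes V :: "complex \<Rightarrow> complex" and g :: "real \<Rightarrow> complex \<Rightarrow> complex"
  assumes V: "V holomorphic_on UNIV"
    and hol: "\<And>s. 0 \<le> s \<Longrightarrow> g s holomorphic_on ball 0 1"
    and bdd: "\<And>r. r < 1 \<Longrightarrow> \<exists>B. \<forall>s\<ge>0. \<forall>z\<in>cball 0 r. norm (g s z) \<le> B"
    and pde: "\<And>s z. 0 \<le> s \<Longrightarrow> z \<in> ball 0 1 \<Longrightarrow>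
      ((\<lambda>s. g s z) has_vector_derivative - (z * V (g s z) * deriv (g s) z)) (at s within {0..})"
begin

definition dt :: "real \<Rightarrow> complex \<Rightarrow> complex" where
  "dt s z = - (z * V (g s z) * deriv (g s) z)"

text \<open>
  The equation bounds the time derivative on smaller disks, because Cauchy's estimate bounds the
  space derivative there; the mean value theorem turns this into a Lipschitz bound.
\<close>

lemma time_lipschitz_g: "time_lipschitz g"
proof (rule time_lipschitzI)
  fix r :: real assume r: "0 \<le> r" "r < 1"
  show "\<exists>B. \<forall>s\<ge>0. \<forall>z\<in>cball 0 r. norm (g s z) \<le> B" using bdd r by blast
  define r' where "r' = (1 + r) / 2"
  have r': "r < r'" "r' < 1" using r by (auto simp: r'_def)
  obtain B where B: "\<And>s z. 0 \<le> s \<Longrightarrow> norm z \<le> r' \<Longrightarrow> norm (g s z) \<le> B"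
    using bdd[OF r'(2)] by (metis mem_cball_0)
  have dB: "norm (deriv (g s) z) \<le> B / (r' - r)" if "0 \<le> s" "norm z \<le> r" for s z
    using deriv_bound_smaller_disc[OF hol[OF that(1)] that(2) r'] B that by blast
  have "continuous_on (cball 0 B) V"
    by (rule holomorphic_on_imp_continuous_on, rule holomorphic_on_subset[OF V]) auto
  then have "bounded (V ` cball 0 B)" by (intro compact_imp_bounded compact_continuous_image) auto
  then obtain C where "\<forall>w\<in>cball 0 B. norm (V w) \<le> C" by (auto simp: bounded_iff)
  then have C: "norm (V w) \<le> C" if "norm w \<le> B" for w using that by auto
  have C0: "0 \<le> C" by (rule order_trans[OF norm_ge_zero C[OF B[of 0 0]]]) (use r r' in auto)
  have dtB: "norm (dt s z) \<le> 1 * C * (B / (r' - r))" if s: "0 \<le> s" "norm z \<le> r" for s z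
  proof -
    have "norm z \<le> 1" "norm (V (g s z)) \<le> C" "norm (deriv (g s) z) \<le> B / (r' - r)"
      using s r r' dB by (auto intro!: C B)
    then show ?thesis unfolding dt_def norm_minus_cancel norm_mult using C0
      by (intro mult_mono) auto
  qed
  have "norm (g s z - g s' z) \<le> (1 * C * (B / (r' - r))) * norm (s - s')"
    if s: "0 \<le> s" "0 \<le> s'" "norm z \<le> r" for s s' z
  proof (rule differentiable_bound[of "{0..}" _ "\<lambda>s x. x *\<^sub>R dt s z"])
    have z: "z \<in> ball 0 1" using s r by auto
    show "((\<lambda>s. g s z) has_derivative (\<lambda>x. x *\<^sub>R dt s z)) (at s within {0..})" if "s \<in> {0..}" for s
      using pde[OF _ z] that by (auto simp: has_vector_derivative_def dt_def)
    show "onorm (\<lambda>x. x *\<^sub>R dt s z) \<le> 1 * C * (B / (r' - r))" if "s \<in> {0..}" for s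
    proof (rule onorm_le)
      show "norm (x *\<^sub>R dt s z) \<le> 1 * C * (B / (r' - r)) * norm x" for x
        using mult_right_mono[OF dtB[of s z] norm_ge_zero[of x]] that \<open>norm z \<le> r\<close>
        by (simp add: mult.commute)
    qed
  qed (use s in auto)
  then show "\<exists>B. \<forall>s\<ge>0. \<forall>s'\<ge>0. \<forall>z\<in>cball 0 r. norm (g s z - g s' z) \<le> B * \<bar>s - s'\<bar>"
    by (intro exI[of _ "1 * C * (B / (r' - r))"]) auto
qed (use hol in auto)

lemma time_lipschitz_dt: "time_lipschitz dt"
proof -
  have "time_lipschitz (\<lambda>s z. (- z) * (V (g s z) * deriv (g s) z))"
    by (rule time_lipschitz_mult[OF time_lipschitz_static time_lipschitz_mult[OF
        time_lipschitz_compose[OF time_lipschitz_g V] time_lipschitz_deriv[OF time_lipschitz_g]]])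
       (intro holomorphic_intros)
  then show ?thesis by (simp add: dt_def[abs_def] mult.assoc)
qed

text \<open>
  The mixed derivatives agree: write the space derivative as a Cauchy integral over a circle and
  differentiate under the integral sign.
\<close>

lemma deriv_g_has_vector_derivative:
  assumes s: "0 \<le> s" and z: "z \<in> ball 0 1"
  shows "((\<lambda>s. deriv (g s) z) has_vector_derivative deriv (dt s) z) (at s within {0..})"
proof -
  define R where "R = (1 + norm z) / 2"
  have R: "norm z < R" "R < 1" "0 < R" using z by (auto simp: R_def add_pos_nonneg)
  have Cauchy: "deriv f z = contour_integral (circlepath 0 R) (\<lambda>u. f u / (u - z) ^ 2) / (2 * pi * \<i>)"
    if "f holomorphic_on ball 0 1" for f
  proof -
    have "((\<lambda>u. f u / (u - z) ^ Suc 1) has_contour_integral ((2 * pi * \<i>) / fact 1 * (deriv ^^ 1) f z)) (circlepath 0 R)"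
    proof (rule Cauchy_has_contour_integral_higher_derivative_circlepath)
      show "continuous_on (cball 0 R) f"
        by (rule holomorphic_on_imp_continuous_on, rule holomorphic_on_subset[OF that]) (use R in auto)
      show "f holomorphic_on ball 0 R" by (rule holomorphic_on_subset[OF that]) (use R in auto)
    qed (use R in auto)
    then show ?thesis by (simp add: contour_integral_unique power2_eq_square)
  qed
  have sph: "sphere 0 R \<subseteq> ball (0::complex) 1" using R by auto
  have ne: "u \<noteq> z" if "norm u = R" for u using that R by auto
  have "((\<lambda>s. contour_integral (circlepath 0 R) (\<lambda>u. g s u / (u - z) ^ 2)) has_vector_derivative
      contour_integral (circlepath 0 R) (\<lambda>u. dt s u / (u - z) ^ 2)) (at s within {0..})"
  proof (rule has_vector_derivative_circle_integral)
    fix s and u :: complex assume su: "s \<in> {0::real..}" "norm u = R"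
    have "((\<lambda>s. g s u) has_vector_derivative dt s u) (at s within {0..})"
      using pde[of s u] su R by (simp add: dt_def)
    then show "((\<lambda>s. g s u / (u - z)\<^sup>2) has_vector_derivative dt s u / (u - z)\<^sup>2) (at s within {0..})"
      by (rule has_vector_derivative_divide)
  next
    fix s assume "s \<in> {0::real..}"
    then have "continuous_on (sphere 0 R) (g s)"
      using continuous_on_subset[OF holomorphic_on_imp_continuous_on[OF hol] sph] by auto
    then show "continuous_on (sphere 0 R) (\<lambda>u. g s u / (u - z)\<^sup>2)"
      by (intro continuous_intros) (use R in auto)
  next
    have "continuous_on ({0..} \<times> sphere 0 R) (\<lambda>(s, u). dt s u)"
      by (rule continuous_on_subset[OF time_lipschitz_continuous[OF time_lipschitz_dt]]) (use sph in auto)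
    then show "continuous_on ({0..} \<times> sphere 0 R) (\<lambda>(s, u). dt s u / (u - z)\<^sup>2)"
      unfolding case_prod_unfold by (intro continuous_intros) (use R in auto)
  qed (use s R in auto)
  then have "((\<lambda>s. contour_integral (circlepath 0 R) (\<lambda>u. g s u / (u - z) ^ 2) / (2 * pi * \<i>)) has_vector_derivative
      contour_integral (circlepath 0 R) (\<lambda>u. dt s u / (u - z) ^ 2) / (2 * pi * \<i>)) (at s within {0..})"
    by (rule has_vector_derivative_divide)
  also have "contour_integral (circlepath 0 R) (\<lambda>u. dt s u / (u - z) ^ 2) / (2 * pi * \<i>) = deriv (dt s) z"
    using Cauchy[OF time_lipschitz_holomorphic[OF time_lipschitz_dt s]] by simp
  finally show ?thesis
    by (rule has_vector_derivative_transform[rotated 2]) (use s in \<open>auto simp: Cauchy[OF hol]\<close>)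
qed

text \<open>
  With \<open>E(s, z) = exp (- n (t - s) V(g(s, z))) / z\<^sup>n\<close> the equation gives
  \<open>\<partial>\<^sub>s (E \<partial>\<^sub>z g) = \<partial>\<^sub>z (E \<partial>\<^sub>s g)\<close>. So the integral of \<open>E \<partial>\<^sub>z g\<close> over a circle around the origin does
  not depend on \<open>s\<close>, and its values at \<open>s = t\<close> and \<open>s = 0\<close> are the two sides. This is the Lagrange
  inversion formula for the flow \<open>z \<mapsto> z exp (t V(g(0, z)))\<close>, obtained without inverting the flow.
\<close>

theorem conserved_circle_integral:
  assumes r: "0 < r" "r < 1" and t: "0 \<le> t"
  shows "contour_integral (circlepath 0 r) (\<lambda>z. deriv (g t) z / z ^ n) =
    contour_integral (circlepath 0 r) (\<lambda>z. deriv (g 0) z * (exp (- (of_nat n * of_real t * V (g 0 z))) / z ^ n))"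
proof -
  define E where "E s z = exp (- (of_nat n * of_real (t - s) * V (g s z))) / z ^ n" for s z
  define I where "I s = contour_integral (circlepath 0 r) (\<lambda>z. deriv (g s) z * E s z)" for s
  \<comment> \<open>the common value of the two derivatives, written as the \<open>z\<close>-derivative of \<open>\<partial>\<^sub>s g E\<close>\<close>
  define \<Phi>' where "\<Phi>' s z = deriv (dt s) z * E s z + dt s z *
     (E s z * (- (of_nat n * of_real (t - s) * (deriv V (g s z) * deriv (g s) z)) - of_nat n / z))" for s z
  have sph: "sphere 0 r \<subseteq> ball (0::complex) 1" using r by auto
  have V': "(V has_field_derivative deriv V w) (at w within S)" for w S
    using V by (simp add: holomorphic_derivI)
  have g': "(g s has_field_derivative deriv (g s) z) (at z)" if "0 \<le> s" "z \<in> ball 0 1" for s z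
    using hol that by (intro holomorphic_derivI[of _ "ball 0 1"]) auto
  have E_z: "(E s has_field_derivative
      E s z * (- (of_nat n * of_real (t - s) * (deriv V (g s z) * deriv (g s) z)) - of_nat n / z)) (at z)"
    if s: "0 \<le> s" "z \<in> ball 0 1" "z \<noteq> 0" for s z
  proof -
    have "((\<lambda>z. V (g s z)) has_field_derivative deriv V (g s z) * deriv (g s) z) (at z)"
      using DERIV_chain2[OF V' g'[OF s(1,2)]] .
    then have "(E s has_field_derivative
       (exp (- (of_nat n * of_real (t - s) * V (g s z))) * (- (of_nat n * of_real (t - s) * (deriv V (g s z) * deriv (g s) z))) * z ^ n
        - exp (- (of_nat n * of_real (t - s) * V (g s z))) * (of_nat n * z ^ (n - 1))) / (z ^ n * z ^ n)) (at z)"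
      unfolding E_def[abs_def] using s by (auto intro!: derivative_eq_intros)
    also have "(exp (- (of_nat n * of_real (t - s) * V (g s z))) * (- (of_nat n * of_real (t - s) * (deriv V (g s z) * deriv (g s) z))) * z ^ n
        - exp (- (of_nat n * of_real (t - s) * V (g s z))) * (of_nat n * z ^ (n - 1))) / (z ^ n * z ^ n) =
        E s z * (- (of_nat n * of_real (t - s) * (deriv V (g s z) * deriv (g s) z)) - of_nat n / z)"
      using s unfolding E_def by (cases n) (auto simp: field_simps)
    finally show ?thesis .
  qed
  have I': "(I has_vector_derivative 0) (at s within {0..})" if s: "0 \<le> s" for s
  proof -
    have "(I has_vector_derivative contour_integral (circlepath 0 r) (\<Phi>' s)) (at s within {0..})"
      unfolding I_def
    proof (rule has_vector_derivative_circle_integral)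
      fix s and z :: complex assume su: "s \<in> {0::real..}" "norm z = r"
      then have z: "0 \<le> s" "z \<in> ball 0 1" "z \<noteq> 0" using r by auto
      have "((\<lambda>s. g s z) has_vector_derivative dt s z) (at s within {0..})"
        using pde[of s z] z by (simp add: dt_def)
      from field_vector_diff_chain_within[OF this V']
      have "((\<lambda>s. V (g s z)) has_vector_derivative dt s z * deriv V (g s z)) (at s within {0..})"
        by (simp add: o_def)
      then have "((\<lambda>s. - (of_nat n * of_real (t - s) * V (g s z))) has_vector_derivative
          - (of_nat n * of_real (t - s) * (dt s z * deriv V (g s z)) + of_nat n * (- 1) * V (g s z))) (at s within {0..})"
        by (auto intro!: derivative_eq_intros simp: has_vector_derivative_def scaleR_conv_of_real algebra_simps)
      from field_vector_diff_chain_within[OF this DERIV_exp[THEN DERIV_subset[OF _ subset_UNIV]]]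
      have "((\<lambda>s. exp (- (of_nat n * of_real (t - s) * V (g s z)))) has_vector_derivative
          - (of_nat n * of_real (t - s) * (dt s z * deriv V (g s z)) + of_nat n * (- 1) * V (g s z)) *
          exp (- (of_nat n * of_real (t - s) * V (g s z)))) (at s within {0..})"
        by (simp add: o_def)
      from has_vector_derivative_divide[OF this, of "z ^ n"]
      have "((\<lambda>s. E s z) has_vector_derivative
         - (of_nat n * of_real (t - s) * (dt s z * deriv V (g s z)) + of_nat n * (- 1) * V (g s z)) * E s z) (at s within {0..})"
        by (simp add: E_def)
      from has_vector_derivative_mult[OF deriv_g_has_vector_derivative[OF z(1,2)] this]
      have "((\<lambda>s. deriv (g s) z * E s z) has_vector_derivative
        deriv (g s) z * (- (of_nat n * of_real (t - s) * (dt s z * deriv V (g s z)) + of_nat n * (- 1) * V (g s z)) * E s z)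
          + deriv (dt s) z * E s z) (at s within {0..})" .
      also have "deriv (g s) z * (- (of_nat n * of_real (t - s) * (dt s z * deriv V (g s z)) + of_nat n * (- 1) * V (g s z)) * E s z)
          + deriv (dt s) z * E s z = \<Phi>' s z"
      proof -
        have "dt s z * (of_nat n / z) = - (of_nat n * V (g s z) * deriv (g s) z)"
          using z by (simp add: dt_def field_simps)
        moreover have "\<Phi>' s z = deriv (dt s) z * E s z -
            E s z * (dt s z * (of_nat n * of_real (t - s) * (deriv V (g s z) * deriv (g s) z)))
            - E s z * (dt s z * (of_nat n / z))"
          unfolding \<Phi>'_def by (simp add: right_diff_distrib' distrib_left left_diff_distrib' mult.left_commute[of _ "E s z"] mult.assoc)
        ultimately show ?thesis by (simp add: algebra_simps)
      qed
      finally show "((\<lambda>s. deriv (g s) z * E s z) has_vector_derivative \<Phi>' s z) (at s within {0..})" .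
    next
      fix s assume s: "s \<in> {0::real..}"
      then have "continuous_on (sphere 0 r) (deriv (g s))"
        using continuous_on_subset[OF holomorphic_on_imp_continuous_on[OF time_lipschitz_holomorphic[OF time_lipschitz_deriv[OF time_lipschitz_g]]] sph] by auto
      moreover have "continuous_on (sphere 0 r) (E s)"
        using E_z s sph r by (intro continuous_at_imp_continuous_on ballI DERIV_isCont) fastforce
      ultimately show "continuous_on (sphere 0 r) (\<lambda>z. deriv (g s) z * E s z)"
        by (intro continuous_intros)
    next
      have sub: "continuous_on ({0..} \<times> sphere 0 r) (\<lambda>(s, u). v s u)" if "time_lipschitz v" for v
        by (rule continuous_on_subset[OF time_lipschitz_continuous[OF that]]) (use sph in auto)
      have V'': "deriv V holomorphic_on UNIV" using V by (intro holomorphic_deriv) auto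
      note conts = sub[OF time_lipschitz_dt, unfolded case_prod_unfold]
         sub[OF time_lipschitz_deriv[OF time_lipschitz_dt], unfolded case_prod_unfold]
         sub[OF time_lipschitz_deriv[OF time_lipschitz_g], unfolded case_prod_unfold]
         sub[OF time_lipschitz_compose[OF time_lipschitz_g V], unfolded case_prod_unfold]
         sub[OF time_lipschitz_compose[OF time_lipschitz_g V''], unfolded case_prod_unfold]
      show "continuous_on ({0..} \<times> sphere 0 r) (\<lambda>(s, z). \<Phi>' s z)"
        unfolding \<Phi>'_def E_def case_prod_unfold
        by (intro continuous_intros conts) (use r in auto)
    qed (use s r in auto)
    also have "contour_integral (circlepath 0 r) (\<Phi>' s) = 0"
    proof (rule contour_integral_unique, rule Cauchy_theorem_primitive)
      show "((\<lambda>z. dt s z * E s z) has_field_derivative \<Phi>' s z) (at z within ball 0 1 - {0})"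
        if z: "z \<in> ball 0 1 - {0}" for z :: complex
      proof -
        have "(dt s has_field_derivative deriv (dt s) z) (at z)"
          using time_lipschitz_holomorphic[OF time_lipschitz_dt s] z by (intro holomorphic_derivI[of _ "ball 0 1"]) auto
        from DERIV_mult'[OF this E_z[OF s]] z
        have "((\<lambda>z. dt s z * E s z) has_field_derivative \<Phi>' s z) (at z)"
          unfolding \<Phi>'_def by (subst add.commute) simp
        then show ?thesis by (rule has_field_derivative_at_within)
      qed
    qed (use r in auto)
    finally show ?thesis .
  qed
  have "I t = I 0"
    using has_vector_derivative_zero_constant[of "{0..}" I] I' t by force
  then show ?thesis by (simp add: I_def E_def)
qed

end

section \<open>Extension of the Taylor coefficients to complex times\<close>

context transport_solution
begin

text \<open>
  The \<open>n\<close>-th Taylor coefficient of the solution at time \<open>\<tau>\<close>, by the conserved integral; the right-hand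
  side makes sense for complex times.
\<close>

definition moment_extension :: "real \<Rightarrow> nat \<Rightarrow> complex \<Rightarrow> complex" where
  "moment_extension r n \<tau> = contour_integral (circlepath 0 r)
     (\<lambda>z. deriv (g 0) z * (exp (- (of_nat n * \<tau> * V (g 0 z))) / z ^ n)) / (2 * pi * \<i> * of_nat n)"

lemma moment_extension_of_real:
  assumes "0 < r" "r < 1" "0 \<le> t"
  shows "moment_extension r n (of_real t) =
    contour_integral (circlepath 0 r) (\<lambda>z. deriv (g t) z / z ^ n) / (2 * pi * \<i> * of_nat n)"
  unfolding moment_extension_def conserved_circle_integral[OF assms] ..

lemma continuous_on_circle:
  assumes "0 < r" "r < 1"
  shows "continuous_on (sphere 0 r) (deriv (g 0))" "continuous_on (sphere 0 r) (\<lambda>z. V (g 0 z))"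
proof -
  have sub: "sphere 0 r \<subseteq> ball (0::complex) 1" using assms by auto
  show "continuous_on (sphere 0 r) (deriv (g 0))"
    using time_lipschitz_holomorphic[OF time_lipschitz_deriv[OF time_lipschitz_g]]
    by (intro continuous_on_subset[OF holomorphic_on_imp_continuous_on sub]) auto
  show "continuous_on (sphere 0 r) (\<lambda>z. V (g 0 z))"
    using time_lipschitz_holomorphic[OF time_lipschitz_compose[OF time_lipschitz_g V]]
    by (intro continuous_on_subset[OF holomorphic_on_imp_continuous_on sub]) auto
qed

lemma moment_extension_holomorphic:
  assumes r: "0 < r" "r < 1"
  shows "moment_extension r n holomorphic_on UNIV"
proof -
  let ?c = "circlepath 0 r"
  let ?d = "\<lambda>x::real. 2 * pi * \<i> * r * exp (2 * of_real pi * \<i> * x)"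
  have cc: "continuous_on S ?c" for S unfolding circlepath by (intro continuous_intros)
  have nc: "norm (?c x) = r" for x using r by (simp add: circlepath norm_mult)
  have cne: "?c x \<noteq> 0" for x using nc[of x] r by auto
  note conts = continuous_on_compose2[OF continuous_on_circle(1)[OF r] cc]
    continuous_on_compose2[OF continuous_on_circle(2)[OF r] cc]
  have [continuous_intros]: "continuous_on (UNIV \<times> cbox 0 1) (\<lambda>p :: complex \<times> real. h (?c (snd p)))"
    if "continuous_on (sphere 0 r) h" for h :: "complex \<Rightarrow> complex"
    by (rule continuous_on_compose2[OF that])
       (auto intro!: continuous_intros continuous_on_compose2[OF cc[of UNIV]] simp: nc)
  let ?F = "\<lambda>\<tau> x. deriv (g 0) (?c x) * (exp (- (of_nat n * \<tau> * V (g 0 (?c x)))) / ?c x ^ n) * ?d x"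
  have "(\<lambda>\<tau>. integral (cbox 0 1) (?F \<tau>)) holomorphic_on UNIV"
  proof (rule leibniz_rule_holomorphic)
    fix \<tau> :: complex and x :: real
    show "((\<lambda>\<tau>. ?F \<tau> x) has_field_derivative
       deriv (g 0) (?c x) * (exp (- (of_nat n * \<tau> * V (g 0 (?c x)))) * (- (of_nat n * V (g 0 (?c x)))) / ?c x ^ n) * ?d x) (at \<tau> within UNIV)"
      by (auto intro!: derivative_eq_intros simp: cne)
  next
    fix \<tau> :: complex
    show "?F \<tau> integrable_on cbox 0 1"
      by (intro integrable_continuous continuous_intros conts cc) (auto simp: nc cne)
  next
    show "continuous_on (UNIV \<times> cbox 0 1) (\<lambda>(\<tau>, x).
       deriv (g 0) (?c x) * (exp (- (of_nat n * \<tau> * V (g 0 (?c x)))) * (- (of_nat n * V (g 0 (?c x)))) / ?c x ^ n) * ?d x)"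
      unfolding case_prod_unfold
      using continuous_on_circle[OF r]
      by (intro continuous_intros continuous_on_compose2[OF cc[of UNIV]]) (auto simp: cne)
  qed simp
  moreover have "moment_extension r n = (\<lambda>\<tau>. integral (cbox 0 1) (?F \<tau>) / (2 * pi * \<i> * of_nat n))"
    by (simp add: fun_eq_iff moment_extension_def contour_integral_integral vector_derivative_circlepath)
  ultimately show ?thesis by (simp only: divide_inverse) (intro holomorphic_intros)
qed

text \<open>
  Pointwise bound of the integrand:
  \<open>Re (\<tau> V) = Re \<tau> Re V - Im \<tau> Im V \<ge> c Re \<tau> - M \<bar>Im \<tau>\<bar>\<close>.
\<close>

lemma norm_moment_extension_le:
  assumes r: "0 < r" "r < 1" and n: "0 < n" and \<tau>: "0 \<le> Re \<tau>"
    and B: "\<And>z. norm z = r \<Longrightarrow> norm (deriv (g 0) z) \<le> B"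
    and c: "\<And>z. norm z = r \<Longrightarrow> c \<le> Re (V (g 0 z))"
    and M: "\<And>z. norm z = r \<Longrightarrow> norm (V (g 0 z)) \<le> M"
  shows "norm (moment_extension r n \<tau>) \<le> r * B * (exp (M * \<bar>Im \<tau>\<bar> - c * Re \<tau>) / r) ^ n"
proof -
  define q where "q = exp (M * \<bar>Im \<tau>\<bar> - c * Re \<tau>)"
  have B0: "0 \<le> B" by (rule order_trans[OF norm_ge_zero B[of "of_real r"]]) (use r in simp)
  have bound: "norm (deriv (g 0) z * (exp (- (of_nat n * \<tau> * V (g 0 z))) / z ^ n)) \<le> B * (q / r) ^ n"
    if z: "norm z = r" for z
  proof -
    have "- Re (\<tau> * V (g 0 z)) = Im \<tau> * Im (V (g 0 z)) - Re \<tau> * Re (V (g 0 z))" by simp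
    also have "\<dots> \<le> \<bar>Im \<tau>\<bar> * M - Re \<tau> * c"
    proof (intro diff_mono)
      have "Im \<tau> * Im (V (g 0 z)) \<le> \<bar>Im \<tau>\<bar> * \<bar>Im (V (g 0 z))\<bar>" by (metis abs_ge_self abs_mult)
      also have "\<dots> \<le> \<bar>Im \<tau>\<bar> * M"
        using order_trans[OF abs_Im_le_cmod M[OF z]] by (intro mult_left_mono) auto
      finally show "Im \<tau> * Im (V (g 0 z)) \<le> \<bar>Im \<tau>\<bar> * M" .
      show "Re \<tau> * c \<le> Re \<tau> * Re (V (g 0 z))" using c[OF z] \<tau> by (intro mult_left_mono)
    qed
    finally have le: "- Re (\<tau> * V (g 0 z)) \<le> M * \<bar>Im \<tau>\<bar> - c * Re \<tau>" by (simp add: mult.commute)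
    have "norm (exp (- (of_nat n * \<tau> * V (g 0 z)))) = exp (of_nat n * (- Re (\<tau> * V (g 0 z))))"
      by (simp add: norm_exp_eq_Re mult.assoc right_diff_distrib)
    also have "\<dots> \<le> exp (of_nat n * (M * \<bar>Im \<tau>\<bar> - c * Re \<tau>))"
      using mult_left_mono[OF le, of "of_nat n"] by (subst exp_le_cancel_iff) simp
    also have "\<dots> = q ^ n" unfolding q_def by (rule exp_of_nat_mult)
    finally have "norm (exp (- (of_nat n * \<tau> * V (g 0 z)))) / r ^ n \<le> q ^ n / r ^ n"
      using r by (intro divide_right_mono) auto
    then have "norm (exp (- (of_nat n * \<tau> * V (g 0 z))) / z ^ n) \<le> (q / r) ^ n"
      by (simp add: norm_divide norm_power z power_divide)
    then show ?thesis unfolding norm_mult using B[OF z] B0 by (intro mult_mono) auto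
  qed
  have "norm (contour_integral (circlepath 0 r) (\<lambda>z. deriv (g 0) z * (exp (- (of_nat n * \<tau> * V (g 0 z))) / z ^ n)))
     \<le> B * (q / r) ^ n * (2 * pi * r)"
  proof (rule has_contour_integral_bound_circlepath)
    have "continuous_on (sphere 0 r) (\<lambda>z. deriv (g 0) z * (exp (- (of_nat n * \<tau> * V (g 0 z))) / z ^ n))"
      using r by (intro continuous_intros continuous_on_circle[OF r]) auto
    then have "(\<lambda>z. deriv (g 0) z * (exp (- (of_nat n * \<tau> * V (g 0 z))) / z ^ n)) contour_integrable_on circlepath 0 r"
      using r by (intro contour_integrable_continuous_circlepath) auto
    then show "((\<lambda>z. deriv (g 0) z * (exp (- (of_nat n * \<tau> * V (g 0 z))) / z ^ n)) has_contour_integral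
      contour_integral (circlepath 0 r) (\<lambda>z. deriv (g 0) z * (exp (- (of_nat n * \<tau> * V (g 0 z))) / z ^ n))) (circlepath 0 r)"
      by (rule has_contour_integral_integral)
  qed (use bound r B0 in \<open>auto simp: q_def\<close>)
  then have "norm (moment_extension r n \<tau>) \<le> B * (q / r) ^ n * (2 * pi * r) / norm (2 * pi * \<i> * of_nat n)"
    unfolding moment_extension_def norm_divide by (rule divide_right_mono) simp
  also have "norm (2 * pi * \<i> * of_nat n) = 2 * pi * n" by (simp add: norm_mult)
  also have "B * (q / r) ^ n * (2 * pi * r) / (2 * pi * n) = r * B * (q / r) ^ n / n" by simp
  also have "\<dots> \<le> r * B * (q / r) ^ n / 1"
    using n r B0 by (intro divide_left_mono) (auto simp: q_def)
  finally show ?thesis by (simp add: q_def)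
qed

lemma obtain_circle_bounds:
  assumes r: "0 < r" "r < 1"
  obtains B M where "0 < B" "0 \<le> M" "\<And>z. norm z = r \<Longrightarrow> norm (deriv (g 0) z) \<le> B"
    "\<And>z. norm z = r \<Longrightarrow> norm (V (g 0 z)) \<le> M"
proof -
  have "bounded (deriv (g 0) ` sphere 0 r)" "bounded ((\<lambda>z. V (g 0 z)) ` sphere 0 r)"
    using continuous_on_circle[OF r] by (auto intro!: compact_imp_bounded compact_continuous_image)
  then obtain B M where BM: "\<forall>x\<in>deriv (g 0) ` sphere 0 r. norm x \<le> B" "\<forall>x\<in>(\<lambda>z. V (g 0 z)) ` sphere 0 r. norm x \<le> M"
    unfolding bounded_iff by blast
  show ?thesis
  proof (rule that[of "max B 1" "max M 0"])
    show "norm (deriv (g 0) z) \<le> max B 1" if "norm z = r" for z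
    proof -
      have "norm (deriv (g 0) z) \<le> B" using BM(1) that by simp
      then show ?thesis by simp
    qed
    show "norm (V (g 0 z)) \<le> max M 0" if "norm z = r" for z
    proof -
      have "norm (V (g 0 z)) \<le> M" using BM(2) that by simp
      then show ?thesis by simp
    qed
  qed auto
qed

text \<open>
  A circle of radius slightly below \<open>\<rho>\<close> still satisfies \<open>r exp (c t0) > 1\<close>, so the ratio
  \<open>exp (M \<bar>Im \<tau>\<bar> - c Re \<tau>) / r\<close> is below 1 at \<open>\<tau> = t0\<close>, hence on a small complex disk around \<open>t0\<close>. Then
  the Taylor series of the solution converges on a disk of radius larger than 1, uniformly for
  complex times near \<open>t0\<close>.
\<close>

lemma moment_extension_geometric_decay:
  assumes \<rho>: "0 < \<rho>" "\<rho> \<le> 1" and c: "0 < c" "\<And>z. norm z < \<rho> \<Longrightarrow> c \<le> Re (V (g 0 z))"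
    and t0: "0 < t0" "1 < \<rho> * exp (c * t0)"
  obtains r \<delta> C q where "0 < r" "r < 1" "0 < \<delta>" "\<delta> \<le> t0" "0 < C" "0 < q" "q < 1"
    "\<And>n \<tau>. 0 < n \<Longrightarrow> \<tau> \<in> ball (of_real t0) \<delta> \<Longrightarrow> norm (moment_extension r n \<tau>) \<le> C * q ^ n"
proof -
  define r where "r = (\<rho> + exp (- (c * t0))) / 2"
  have "exp (- (c * t0)) < \<rho>" using t0 by (simp add: exp_minus field_simps)
  then have r: "exp (- (c * t0)) < r" "r < \<rho>" by (auto simp: r_def)
  have r01: "0 < r" "r < 1" using r \<rho> exp_gt_zero[of "- (c * t0)"] by linarith+
  obtain B M where BM: "0 < B" "0 \<le> M" "\<And>z. norm z = r \<Longrightarrow> norm (deriv (g 0) z) \<le> B"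
    "\<And>z. norm z = r \<Longrightarrow> norm (V (g 0 z)) \<le> M" using obtain_circle_bounds[OF r01] by metis
  define \<kappa> where "\<kappa> = c * t0 + ln r"
  have "- (c * t0) < ln r" using r r01 ln_less_cancel_iff[of "exp (- (c * t0))" r] by simp
  then have \<kappa>: "0 < \<kappa>" by (simp add: \<kappa>_def)
  define \<delta> where "\<delta> = min t0 (\<kappa> / (2 * (M + c)))"
  have Mc: "0 < M + c" using BM c by simp
  have \<delta>: "0 < \<delta>" "\<delta> \<le> t0" using Mc \<kappa> t0 by (auto simp: \<delta>_def)
  have "\<delta> * (M + c) \<le> \<kappa> / (2 * (M + c)) * (M + c)" using Mc by (intro mult_right_mono) (auto simp: \<delta>_def)
  also have "\<dots> = \<kappa> / 2"
  proof -
    have "\<kappa> / (2 * d) * d = \<kappa> / 2" if "d > 0" for d using that by simp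
    then show ?thesis using Mc by blast
  qed
  finally have \<delta>\<kappa>: "\<delta> * (M + c) \<le> \<kappa> / 2" .
  show ?thesis
  proof (rule that[OF r01 \<delta>, of "r * B" "exp (- \<kappa> / 2)"])
    fix n :: nat and \<tau> assume n: "0 < n" and \<tau>: "\<tau> \<in> ball (complex_of_real t0) \<delta>"
    have d: "norm (\<tau> - of_real t0) < \<delta>" using \<tau> by (simp add: dist_norm norm_minus_commute)
    have "\<bar>Re \<tau> - t0\<bar> < \<delta>" "\<bar>Im \<tau>\<bar> < \<delta>"
      using abs_Re_le_cmod[of "\<tau> - of_real t0"] abs_Im_le_cmod[of "\<tau> - of_real t0"] d by auto
    then have R: "t0 - \<delta> \<le> Re \<tau>" "\<bar>Im \<tau>\<bar> \<le> \<delta>" by linarith+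
    have "M * \<bar>Im \<tau>\<bar> - c * Re \<tau> \<le> M * \<delta> - c * (t0 - \<delta>)"
      using R BM c by (intro diff_mono mult_left_mono) auto
    also have "\<dots> \<le> - \<kappa> / 2 + ln r"
    proof -
      have "M * \<delta> + c * \<delta> \<le> \<kappa> / 2" using \<delta>\<kappa> by (simp add: algebra_simps)
      moreover have "c * (t0 - \<delta>) = c * t0 - c * \<delta>" by (rule right_diff_distrib)
      moreover have "ln r = \<kappa> - c * t0" by (simp add: \<kappa>_def)
      ultimately show ?thesis by linarith
    qed
    finally have "exp (M * \<bar>Im \<tau>\<bar> - c * Re \<tau>) \<le> exp (- \<kappa> / 2 + ln r)" by simp
    also have "\<dots> = exp (- \<kappa> / 2) * r" by (simp only: exp_add exp_ln[OF r01(1)])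
    finally have "exp (M * \<bar>Im \<tau>\<bar> - c * Re \<tau>) / r \<le> exp (- \<kappa> / 2)" using r01 by (simp add: field_simps)
    then have pow: "(exp (M * \<bar>Im \<tau>\<bar> - c * Re \<tau>) / r) ^ n \<le> exp (- \<kappa> / 2) ^ n"
      using r01 by (intro power_mono) auto
    have "norm (moment_extension r n \<tau>) \<le> r * B * (exp (M * \<bar>Im \<tau>\<bar> - c * Re \<tau>) / r) ^ n"
      using R \<delta> by (intro norm_moment_extension_le r01 n BM c) (use r in auto)
    also have "\<dots> \<le> r * B * exp (- \<kappa> / 2) ^ n" using r01 BM pow by (intro mult_left_mono) auto
    finally show "norm (moment_extension r n \<tau>) \<le> r * B * exp (- \<kappa> / 2) ^ n" .
  qed (use r01 BM \<kappa> in auto)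
qed

end

section \<open>Uniqueness of Fourier coefficients\<close>

abbreviation circle_measure :: "real measure" where
  "circle_measure \<equiv> lebesgue_on {0..2 * pi}"

lemma finite_circle_measure: "finite_measure circle_measure"
  by (rule finite_measure_lebesgue_on) auto

lemma measurable_circle: "f \<in> borel_measurable lebesgue \<Longrightarrow> f \<in> borel_measurable circle_measure"
  by (rule measurable_restrict_space1)

lemma continuous_measurable_circle:
  fixes f :: "real \<Rightarrow> 'a::euclidean_space"
  assumes "continuous_on UNIV f" shows "f \<in> borel_measurable circle_measure"
  using borel_measurable_continuous_onI[OF assms] by (simp add: measurable_completion measurable_restrict_space1)

lemma cis_measurable_circle [measurable]: "(\<lambda>x. cis (c * x)) \<in> borel_measurable circle_measure"
  by (intro continuous_measurable_circle continuous_intros)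

lemma circle_moment_alt:
  "circle_moment f n = (LINT x|circle_measure. cis (of_int n * x) * of_real (f x))"
  unfolding circle_moment_def set_lebesgue_integral_def by (subst integral_restrict_space) auto

lemma integrable_cis_mult:
  fixes H :: "real \<Rightarrow> complex"
  assumes "integrable circle_measure H"
  shows "integrable circle_measure (\<lambda>x. cis (c * x) * H x)"
  using assms by (rule Bochner_Integration.integrable_bound) (use assms in \<open>auto simp: norm_mult\<close>)

text \<open>
  Stated for complex functions so that the class is closed under multiplication by characters,
  which is what makes the induction over polynomials below work.
\<close>

definition orthogonal_to_characters :: "(real \<Rightarrow> complex) \<Rightarrow> bool" where
  "orthogonal_to_characters H \<longleftrightarrow> integrable circle_measure H \<and>
     (\<forall>n::int. (LINT x|circle_measure. cis (of_int n * x) * H x) = 0)"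

lemma orthogonal_to_characters_add:
  assumes "orthogonal_to_characters H" "orthogonal_to_characters K"
  shows "orthogonal_to_characters (\<lambda>x. H x + K x)"
  using assms unfolding orthogonal_to_characters_def
  by (simp add: distrib_left integrable_cis_mult)

lemma orthogonal_to_characters_cmult:
  assumes "orthogonal_to_characters H"
  shows "orthogonal_to_characters (\<lambda>x. c * H x)"
proof -
  have "(\<lambda>x. cis (of_int n * x) * (c * H x)) = (\<lambda>x. c * (cis (of_int n * x) * H x))" for n
    by (simp add: mult.left_commute)
  then show ?thesis using assms unfolding orthogonal_to_characters_def by simp
qed

lemma orthogonal_to_characters_cis:
  assumes "orthogonal_to_characters H"
  shows "orthogonal_to_characters (\<lambda>x. cis (of_int k * x) * H x)"
proof -
  have "cis (of_int n * x) * (cis (of_int k * x) * H x) = cis (of_int (n + k) * x) * H x" for n x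
    by (simp only: mult.assoc[symmetric] cis_mult of_int_add distrib_right)
  then show ?thesis using assms unfolding orthogonal_to_characters_def
    by (simp only: integrable_cis_mult) simp
qed

text \<open>
  On the circle a real linear form is a combination of \<open>cis x\<close> and \<open>cis (- x)\<close>. The quantification over
  \<open>H\<close> handles products of polynomials: multiply by one factor after the other.
\<close>

lemma orthogonal_to_characters_polynomial:
  assumes "real_polynomial_function p" and "orthogonal_to_characters H"
  shows "orthogonal_to_characters (\<lambda>x. of_real (p (cis x)) * H x)"
  using assms
proof (induction arbitrary: H rule: real_polynomial_function.induct)
  case (linear f)
  interpret bounded_linear f by fact
  define a where "a = (of_real (f 1) - \<i> * of_real (f \<i>)) / 2"
  define b where "b = (of_real (f 1) + \<i> * of_real (f \<i>)) / 2"
  have "f (cis x) = cos x * f 1 + sin x * f \<i>" for x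
  proof -
    have "cis x = cos x *\<^sub>R 1 + sin x *\<^sub>R \<i>" by (simp add: complex_eq_iff)
    then show ?thesis by (simp add: add scaleR)
  qed
  then have "of_real (f (cis x)) = a * cis (of_int 1 * x) + b * cis (of_int (-1) * x)" for x
    by (simp add: a_def b_def complex_eq_iff field_simps)
  then have "(\<lambda>x. of_real (f (cis x)) * H x) = (\<lambda>x. a * (cis (of_int 1 * x) * H x) + b * (cis (of_int (-1) * x) * H x))"
    by (simp add: algebra_simps)
  moreover have "orthogonal_to_characters \<dots>"
    by (intro orthogonal_to_characters_add orthogonal_to_characters_cmult orthogonal_to_characters_cis linear.prems)
  ultimately show ?case by simp
next
  case (const c)
  then show ?case by (rule orthogonal_to_characters_cmult)
next
  case (add f g)
  then show ?case by (simp add: distrib_right orthogonal_to_characters_add)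
next
  case (mult f g)
  then show ?case by (simp add: mult.assoc)
qed

text \<open>
  By the Stone--Weierstrass theorem for the compact unit circle in the plane.
\<close>

lemma orthogonal_to_continuous:
  fixes h :: "real \<Rightarrow> real" and \<phi> :: "complex \<Rightarrow> real"
  assumes h: "integrable circle_measure h" and orth: "\<And>n::int. circle_moment h n = 0"
    and \<phi>: "continuous_on UNIV \<phi>"
  shows "(LINT x|circle_measure. \<phi> (cis x) * h x) = 0"
proof -
  have H: "orthogonal_to_characters (\<lambda>x. of_real (h x))"
    unfolding orthogonal_to_characters_def using h orth by (simp add: circle_moment_alt)
  have int: "integrable circle_measure (\<lambda>x. \<psi> (cis x) * h x)" if "continuous_on UNIV \<psi>" for \<psi> :: "complex \<Rightarrow> real"
  proof -
    have "bounded (\<psi> ` sphere 0 1)"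
      by (intro compact_imp_bounded compact_continuous_image continuous_on_subset[OF that]) auto
    then obtain B where B: "\<forall>z\<in>sphere 0 1. norm (\<psi> z) \<le> B" by (auto simp: bounded_iff)
    have m: "(\<lambda>x. \<psi> (cis x)) \<in> borel_measurable circle_measure"
      by (intro continuous_measurable_circle continuous_on_compose2[OF that] continuous_intros) auto
    show ?thesis
    proof (rule Bochner_Integration.integrable_bound)
      show "integrable circle_measure (\<lambda>x. B * h x)" using h by simp
      show "(\<lambda>x. \<psi> (cis x) * h x) \<in> borel_measurable circle_measure"
        using m h by (intro borel_measurable_times) auto
      have "norm (\<psi> (cis x) * h x) \<le> norm (B * h x)" for x
      proof -
        have "\<bar>\<psi> (cis x)\<bar> \<le> \<bar>B\<bar>" using B[rule_format, of "cis x"] by simp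
        then show ?thesis by (simp add: abs_mult mult_right_mono)
      qed
      then show "AE x in circle_measure. norm (\<psi> (cis x) * h x) \<le> norm (B * h x)" by simp
    qed
  qed
  define C where "C = (LINT x|circle_measure. \<bar>h x\<bar>)"
  have "C \<ge> 0" unfolding C_def by simp
  have bound: "\<bar>LINT x|circle_measure. \<phi> (cis x) * h x\<bar> \<le> e * C" if "e > 0" for e
  proof -
    obtain p where p: "real_polynomial_function p" "\<And>z. z \<in> sphere 0 1 \<Longrightarrow> \<bar>\<phi> z - p z\<bar> < e"
      using Stone_Weierstrass_real_polynomial_function[of "sphere 0 1" \<phi> e]
        continuous_on_subset[OF \<phi>] \<open>e > 0\<close> by (metis compact_sphere subset_UNIV)
    have contp: "continuous_on UNIV p"
      using p(1) by (simp add: continuous_at_imp_continuous_on continuous_real_polymonial_function)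
    have "(LINT x|circle_measure. of_real (p (cis x)) * of_real (h x)) = (0::complex)"
      using orthogonal_to_characters_polynomial[OF p(1) H]
      unfolding orthogonal_to_characters_def by (elim conjE allE[of _ 0]) simp
    then have "(LINT x|circle_measure. complex_of_real (p (cis x) * h x)) = 0" by simp
    then have p0: "(LINT x|circle_measure. p (cis x) * h x) = 0"
      by (simp only: integral_complex_of_real of_real_eq_0_iff)
    have "(LINT x|circle_measure. \<phi> (cis x) * h x) = (LINT x|circle_measure. (\<phi> (cis x) - p (cis x)) * h x)"
      using int[OF \<phi>] int[OF contp] p0 by (simp add: left_diff_distrib)
    also have "\<bar>\<dots>\<bar> \<le> (LINT x|circle_measure. \<bar>(\<phi> (cis x) - p (cis x)) * h x\<bar>)"
      by (rule integral_abs_bound)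
    also have "\<dots> \<le> (LINT x|circle_measure. e * \<bar>h x\<bar>)"
    proof (rule integral_mono)
      show "integrable circle_measure (\<lambda>x. \<bar>(\<phi> (cis x) - p (cis x)) * h x\<bar>)"
        using int[of "\<lambda>z. \<phi> z - p z"] \<phi> contp by (intro integrable_abs) (auto intro: continuous_intros)
      show "\<bar>(\<phi> (cis x) - p (cis x)) * h x\<bar> \<le> e * \<bar>h x\<bar>" for x
        unfolding abs_mult using p(2)[of "cis x"] by (intro mult_right_mono) auto
    qed (use h in auto)
    finally show ?thesis by (simp add: C_def)
  qed
  show ?thesis
  proof (rule ccontr)
    let ?I = "LINT x|circle_measure. \<phi> (cis x) * h x"
    assume "?I \<noteq> 0"
    then have "\<bar>?I\<bar> / (2 * (C + 1)) > 0" using \<open>C \<ge> 0\<close> by simp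
    from bound[OF this] have "\<bar>?I\<bar> * (C + 2) \<le> 0" using \<open>C \<ge> 0\<close> by (simp add: field_simps)
    then show False using \<open>?I \<noteq> 0\<close> \<open>C \<ge> 0\<close> by (simp add: mult_le_0_iff)
  qed
qed

text \<open>
  The measures whose densities are the positive and the negative part of \<open>k\<close> agree on all half-lines.
\<close>

lemma AE_zero_if_half_line_integrals_zero:
  fixes k :: "real \<Rightarrow> real"
  assumes k: "integrable lborel k"
    and zero: "\<And>a. (LINT x|lborel. indicator {a<..} x * k x) = 0"
  shows "AE x in lborel. k x = 0"
proof -
  have [measurable]: "k \<in> borel_measurable borel" using k by auto
  define p m where "p x = max 0 (k x)" and "m x = max 0 (- k x)" for x
  have [measurable]: "p \<in> borel_measurable borel" "m \<in> borel_measurable borel"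
    unfolding p_def m_def by measurable
  have int: "integrable lborel p" "integrable lborel m"
    unfolding p_def m_def using k by (auto intro!: integrable_max)
  have em: "emeasure (density lborel (\<lambda>x. ennreal (q x))) {a<..} = ennreal (LINT x|lborel. indicator {a<..} x * q x)"
    if "integrable lborel q" "\<And>x. 0 \<le> q x" "q \<in> borel_measurable borel" for q :: "real \<Rightarrow> real" and a
  proof -
    have "emeasure (density lborel (\<lambda>x. ennreal (q x))) {a<..} = (\<integral>\<^sup>+x. ennreal (q x) * indicator {a<..} x \<partial>lborel)"
      using that by (subst emeasure_density) auto
    also have "\<dots> = (\<integral>\<^sup>+x. ennreal (indicator {a<..} x * q x) \<partial>lborel)"
      by (intro nn_integral_cong) (auto simp: indicator_def)
    also have "\<dots> = ennreal (LINT x|lborel. indicator {a<..} x * q x)"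
      using that integrable_mult_indicator[of "{a<..}" lborel q]
      by (intro nn_integral_eq_integral) auto
    finally show ?thesis .
  qed
  have "density lborel (\<lambda>x. ennreal (p x)) = density lborel (\<lambda>x. ennreal (m x))"
  proof (rule measure_eqI_lessThan)
    fix a
    have "(LINT x|lborel. indicator {a<..} x * p x) - (LINT x|lborel. indicator {a<..} x * m x)
       = (LINT x|lborel. indicator {a<..} x * p x - indicator {a<..} x * m x)"
      using int integrable_mult_indicator[of "{a<..}" lborel p] integrable_mult_indicator[of "{a<..}" lborel m]
      by (subst Bochner_Integration.integral_diff) auto
    also have "\<dots> = (LINT x|lborel. indicator {a<..} x * k x)"
      by (intro Bochner_Integration.integral_cong) (auto simp: p_def m_def max_def indicator_def)
    finally have "(LINT x|lborel. indicator {a<..} x * p x) = (LINT x|lborel. indicator {a<..} x * m x)"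
      using zero by simp
    then show "emeasure (density lborel (\<lambda>x. ennreal (p x))) {a<..} = emeasure (density lborel (\<lambda>x. ennreal (m x))) {a<..}"
      using int by (subst (1 2) em) (auto simp: p_def m_def)
    show "emeasure (density lborel (\<lambda>x. ennreal (p x))) {a<..} < \<infinity>"
      using int by (subst em) (auto simp: p_def)
  qed auto
  then have "AE x in lborel. ennreal (p x) = ennreal (m x)"
    by (intro sigma_finite_measure.density_unique sigma_finite_lborel) auto
  then show ?thesis
    by eventually_elim (auto simp: p_def m_def max_def split: if_splits)
qed

text \<open>
  Uniqueness for Fourier coefficients of integrable functions. Continuous functions on the circle
  that vanish exactly on a closed arc approximate the indicator of the complementary open arc, so
  the integrals over all arcs that end at \<open>2 * pi\<close> vanish, and these are the integrals over half-lines.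
\<close>

lemma AE_zero_if_moments_zero:
  fixes h :: "real \<Rightarrow> real"
  assumes h: "integrable circle_measure h" and orth: "\<And>n::int. circle_moment h n = 0"
  shows "AE x in lebesgue. x \<in> {0..2 * pi} \<longrightarrow> h x = 0"
proof -
  have inter: "(LINT x|circle_measure. indicator {a<..<2 * pi} x * h x) = 0" if a: "0 \<le> a" for a
  proof -
    \<comment> \<open>on \<open>[0, 2 * pi]\<close> the arc \<open>K\<close> is the complement of the open interval from \<open>a\<close> to \<open>2 * pi\<close>\<close>
    define K where "K = cis ` ({0..a} \<union> {2 * pi})"
    have K: "closed K" "K \<noteq> {}"
      unfolding K_def using a by (auto intro!: compact_imp_closed compact_continuous_image continuous_intros)
    have inK: "cis x \<in> K \<longleftrightarrow> x \<notin> {a<..<2 * pi}" if x: "x \<in> {0..2 * pi}" for x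
    proof
      assume "cis x \<in> K"
      then obtain y where y: "cis x = cis y" "y \<in> {0..a} \<union> {2 * pi}" unfolding K_def by blast
      show "x \<notin> {a<..<2 * pi}"
      proof
        assume xa: "x \<in> {a<..<2 * pi}"
        have "exp (\<i> * of_real x) = exp (\<i> * of_real y)" using y(1) by (simp only: cis_conv_exp)
        then obtain n :: int where "\<i> * of_real x = \<i> * of_real y + (of_int (2 * n) * pi) * \<i>"
          unfolding exp_eq by blast
        then have n: "x = y + 2 * pi * n" by (simp add: complex_eq_iff algebra_simps)
        show False
        proof (cases "y = 2 * pi")
          case True
          then have "0 < 2 * pi * (1 + of_int n)" "2 * pi * (1 + of_int n) < 2 * pi * 1"
            using n xa a by (auto simp: algebra_simps)
          then have "0 < 1 + real_of_int n" "1 + real_of_int n < 1"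
            by (simp_all add: zero_less_mult_iff)
          then have "real_of_int (- 1) < real_of_int n" "real_of_int n < real_of_int 0" by simp_all
          then have "- 1 < n" "n < 0" by (simp_all only: of_int_less_iff)
          then show False by linarith
        next
          case False
          then have "0 < x - y" "x - y < 2 * pi" using y xa a by auto
          then have "0 < 2 * pi * of_int n" "2 * pi * of_int n < 2 * pi * 1" using n by auto
          then have "0 < real_of_int n" "real_of_int n < 1"
            by (simp_all add: zero_less_mult_iff)
          then have "real_of_int 0 < real_of_int n" "real_of_int n < real_of_int 1" by simp_all
          then have "0 < n" "n < 1" by (simp_all only: of_int_less_iff)
          then show False by linarith
        qed
      qed
    next
      assume "x \<notin> {a<..<2 * pi}"
      then show "cis x \<in> K" using x unfolding K_def by auto
    qed
    have "(\<lambda>k. LINT x|circle_measure. min 1 (real k * infdist (cis x) K) * h x) \<longlonglongrightarrow>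
      (LINT x|circle_measure. indicator {a<..<2 * pi} x * h x)"
    proof (rule integral_dominated_convergence[where w="\<lambda>x. \<bar>h x\<bar>"])
      have m: "(\<lambda>x. min 1 (real k * infdist (cis x) K)) \<in> borel_measurable circle_measure" for k
        by (intro continuous_measurable_circle continuous_intros)
      show "(\<lambda>x. min 1 (real k * infdist (cis x) K) * h x) \<in> borel_measurable circle_measure" for k
        using m h by (intro borel_measurable_times) auto
      show "(\<lambda>x. indicator {a<..<2 * pi} x * h x) \<in> borel_measurable circle_measure"
        using h a by (intro borel_measurable_times borel_measurable_indicator) (auto simp: sets_restrict_space_iff)
      show "AE x in circle_measure. (\<lambda>k. min 1 (real k * infdist (cis x) K) * h x) \<longlonglongrightarrow> indicator {a<..<2 * pi} x * h x"
      proof (rule AE_I2)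
        fix x assume "x \<in> space circle_measure"
        then have x: "x \<in> {0..2 * pi}" by simp
        have "(\<lambda>k. min 1 (real k * infdist (cis x) K)) \<longlonglongrightarrow> indicator {a<..<2 * pi} x"
        proof (cases "x \<in> {a<..<2 * pi}")
          case True
          then have "infdist (cis x) K > 0"
            using inK[OF x] K in_closed_iff_infdist_zero[of K "cis x"] infdist_nonneg[of "cis x" K] by fastforce
          then have "filterlim (\<lambda>k. real k * infdist (cis x) K) at_top sequentially"
            by (intro filterlim_at_top_mult_tendsto_pos[OF tendsto_const] filterlim_real_sequentially)
          then have "eventually (\<lambda>k. 1 \<le> real k * infdist (cis x) K) sequentially"
            by (simp add: filterlim_at_top)
          then have "eventually (\<lambda>k. min 1 (real k * infdist (cis x) K) = 1) sequentially"
            by eventually_elim auto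
          then show ?thesis using True by (simp add: tendsto_eventually)
        next
          case False
          then have "infdist (cis x) K = 0" using inK[OF x] by simp
          then show ?thesis using False by simp
        qed
        then show "(\<lambda>k. min 1 (real k * infdist (cis x) K) * h x) \<longlonglongrightarrow> indicator {a<..<2 * pi} x * h x"
          by (intro tendsto_mult tendsto_const)
      qed
      show "AE x in circle_measure. norm (min 1 (real k * infdist (cis x) K) * h x) \<le> \<bar>h x\<bar>" for k
        by (rule AE_I2) (auto simp: abs_mult infdist_nonneg intro!: mult_left_le_one_le)
    qed (use h a in auto)
    moreover have "(LINT x|circle_measure. min 1 (real k * infdist (cis x) K) * h x) = 0" for k
      by (rule orthogonal_to_continuous[OF h orth, of "\<lambda>z. min 1 (real k * infdist z K)"]) (intro continuous_intros)
    ultimately show ?thesis by (simp add: LIMSEQ_const_iff)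
  qed
  define H where "H x = indicator {0<..<2 * pi} x * h x" for x
  have Hint: "integrable lebesgue H"
  proof -
    have "integrable circle_measure (\<lambda>x. indicator {0<..<2 * pi} x *\<^sub>R h x)"
      using h by (intro integrable_mult_indicator) (auto simp: sets_restrict_space_iff)
    then have "integrable lebesgue (\<lambda>x. indicator {0..2 * pi} x *\<^sub>R (indicator {0<..<2 * pi} x *\<^sub>R h x))"
      by (subst (asm) integrable_restrict_space) auto
    then show ?thesis
      by (rule Bochner_Integration.integrable_cong[THEN iffD1, rotated -1]) (auto simp: H_def indicator_def)
  qed
  obtain k where k: "k \<in> borel_measurable lborel" "AE x in lborel. H x = k x"
    using completion_ex_borel_measurable_real[of H lborel] Hint by auto
  have kb: "k \<in> borel_measurable borel" using k(1) by simp
  have k': "AE x in lebesgue. H x = k x" using k(2) by (rule AE_completion)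
  have kl: "k \<in> borel_measurable lebesgue" using k(1) by (simp add: measurable_completion)
  have "integrable lebesgue k"
    using integrable_cong_AE_imp[OF Hint kl] k' by (simp add: eq_commute)
  then have kint: "integrable lborel k" using k(1) by (simp add: integrable_completion)
  have "AE x in lborel. k x = 0"
  proof (rule AE_zero_if_half_line_integrals_zero[OF kint])
    fix a
    have "(LINT x|lborel. indicator {a<..} x * k x) = (LINT x|lebesgue. indicator {a<..} x * k x)"
      using kb by (intro integral_completion[symmetric]) measurable
    also have "\<dots> = (LINT x|lebesgue. indicator {a<..} x * H x)"
      using k' by (intro integral_cong_AE borel_measurable_times borel_measurable_indicator kl borel_measurable_integrable[OF Hint]) auto
    also have "\<dots> = (LINT x|lebesgue. indicator {0..2 * pi} x *\<^sub>R (indicator {max a 0<..<2 * pi} x * h x))"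
      by (intro Bochner_Integration.integral_cong) (auto simp: H_def indicator_def)
    also have "\<dots> = (LINT x|circle_measure. indicator {max a 0<..<2 * pi} x * h x)"
      by (subst integral_restrict_space) auto
    also have "\<dots> = 0" by (rule inter) simp
    finally show "(LINT x|lborel. indicator {a<..} x * k x) = 0" .
  qed
  then have "AE x in lebesgue. k x = 0" by (rule AE_completion)
  moreover have "AE x in lebesgue. x \<noteq> 0 \<and> x \<noteq> 2 * pi"
    by (rule AE_completion) (auto intro!: AE_conjI AE_lborel_singleton)
  ultimately show ?thesis using k'
    by eventually_elim (auto simp: H_def indicator_def split: if_splits)
qed

text \<open>
  Countably many translates of a null set cover the exceptional set.
\<close>

lemma AE_zero_if_AE_zero_on_period:
  assumes per: "circle_fun h" and h: "AE x in lebesgue. x \<in> {0..2 * pi} \<longrightarrow> h x = (0::real)"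
  shows "AE x in lebesgue. h x = 0"
proof -
  have shift: "h (x + 2 * pi * of_int n) = h x" for x n
  proof (induction n rule: int_induct[where k = 0])
    case (step1 n)
    have "h (x + 2 * pi * of_int (n + 1)) = h (x + 2 * pi * of_int n + 2 * pi)" by (simp add: algebra_simps)
    also have "\<dots> = h (x + 2 * pi * of_int n)" using per by (simp only: circle_fun_def)
    finally show ?case using step1 by simp
  next
    case (step2 n)
    have "h (x + 2 * pi * of_int (n - 1)) = h (x + 2 * pi * of_int (n - 1) + 2 * pi)"
      using per by (simp add: circle_fun_def)
    also have "\<dots> = h (x + 2 * pi * of_int n)" by (simp add: algebra_simps)
    finally show ?case using step2 by simp
  qed simp
  obtain N where N: "N \<in> null_sets lebesgue" "{x. \<not> (x \<in> {0..2 * pi} \<longrightarrow> h x = 0)} \<subseteq> N"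
    using h by (auto simp: eventually_ae_filter)
  have "negligible (\<Union>n::int. (+) (2 * pi * of_int n) ` N)"
  proof (rule negligible_countable_Union)
    have "negligible N" using N(1) by (simp add: negligible_iff_null_sets)
    then show "negligible S" if "S \<in> range (\<lambda>n::int. (+) (2 * pi * of_int n) ` N)" for S
      using that negligible_translation by auto
  qed auto
  moreover have "{x \<in> space lebesgue. h x \<noteq> 0} \<subseteq> (\<Union>n::int. (+) (2 * pi * of_int n) ` N)"
  proof
    fix x assume x: "x \<in> {x \<in> space lebesgue. h x \<noteq> 0}"
    define n where "n = \<lfloor>x / (2 * pi)\<rfloor>"
    define y where "y = x - 2 * pi * of_int n"
    have "of_int n \<le> x / (2 * pi)" "x / (2 * pi) < of_int n + 1" unfolding n_def by linarith+
    then have "0 \<le> y" "y \<le> 2 * pi" by (simp_all add: y_def field_simps)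
    moreover have "h y \<noteq> 0" using x shift[of y n] by (simp add: y_def)
    ultimately have "y \<in> N" using N(2) by auto
    then show "x \<in> (\<Union>n::int. (+) (2 * pi * of_int n) ` N)"
      by (intro UN_I[of n] image_eqI[of _ _ y]) (auto simp: y_def)
  qed
  ultimately show ?thesis by (intro AE_I') (auto simp: negligible_iff_null_sets)
qed

section \<open>Poisson integrals and the sign of the velocity\<close>

lemma AE_circleI: "AE x in lebesgue. P x \<Longrightarrow> AE x in circle_measure. P x"
  by (subst AE_restrict_space_iff) auto

lemma integrable_circle_if_bounded:
  fixes f :: "real \<Rightarrow> real"
  assumes f: "f \<in> borel_measurable lebesgue" and ab: "AE x in lebesgue. a \<le> f x \<and> f x \<le> b"
  shows "integrable circle_measure f"
proof (rule finite_measure.integrable_const_bound[OF finite_circle_measure])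
  show "AE x in circle_measure. norm (f x) \<le> max \<bar>a\<bar> \<bar>b\<bar>"
    using AE_circleI[OF ab] by eventually_elim auto
qed (rule measurable_circle[OF f])

lemma circle_moment_zero: "circle_moment f 0 = of_real (LINT x|circle_measure. f x)"
  by (simp add: circle_moment_alt)

lemma norm_circle_moment_le:
  assumes "integrable circle_measure f"
  shows "norm (circle_moment f n) \<le> (LINT x|circle_measure. \<bar>f x\<bar>)"
proof -
  have "norm (circle_moment f n) \<le> (LINT x|circle_measure. norm (cis (of_int n * x) * of_real (f x)))"
    unfolding circle_moment_alt by (rule integral_norm_bound)
  then show ?thesis by (simp add: norm_mult)
qed

lemma circle_moment_cnj: "circle_moment f (- n) = cnj (circle_moment f n)"
proof -
  have "cnj (circle_moment f n) = (LINT x|circle_measure. cnj (cis (of_int n * x) * of_real (f x)))"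
    unfolding circle_moment_alt by (rule Bochner_Integration.integral_cnj[symmetric])
  also have "\<dots> = circle_moment f (- n)" by (simp add: circle_moment_alt cis_cnj)
  finally show ?thesis by simp
qed

lemma circle_moment_diff:
  assumes "integrable circle_measure f" "integrable circle_measure g"
  shows "circle_moment (\<lambda>x. f x - g x) n = circle_moment f n - circle_moment g n"
  unfolding circle_moment_alt using assms
  by (simp add: right_diff_distrib integrable_cis_mult)

lemma integral_cis_circle: "(LINT x|circle_measure. cis (of_int n * x)) = (if n = 0 then 2 * of_real pi else 0)"
proof (cases "n = 0")
  case True
  then show ?thesis by (simp add: measure_restrict_space scaleR_conv_of_real)
next
  case False
  have "integrable circle_measure (\<lambda>x. cis (of_int n * x))"
    by (rule finite_measure.integrable_const_bound[OF finite_circle_measure, of _ 1])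
       (auto intro: cis_measurable_circle)
  then have "(LINT x|circle_measure. cis (of_int n * x)) = integral {0..2 * pi} (\<lambda>x. cis (of_int n * x))"
    by (intro lebesgue_integral_eq_integral) auto
  also have "((\<lambda>x. cis (of_int n * x)) has_integral
      (cis (of_int n * (2 * pi)) / (\<i> * of_int n) - cis (of_int n * 0) / (\<i> * of_int n))) {0..2 * pi}"
  proof (rule fundamental_theorem_of_calculus)
    fix x assume "x \<in> {0..2 * pi}"
    have "((\<lambda>z. exp (\<i> * of_int n * z) / (\<i> * of_int n)) has_field_derivative exp (\<i> * of_int n * of_real x)) (at (of_real x))"
      using False by (auto intro!: derivative_eq_intros)
    from has_vector_derivative_real_field[OF this]
    show "((\<lambda>x. cis (of_int n * x) / (\<i> * of_int n)) has_vector_derivative cis (of_int n * x)) (at x within {0..2 * pi})"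
      by (simp add: cis_conv_exp mult.assoc)
  qed auto
  then have "integral {0..2 * pi} (\<lambda>x. cis (of_int n * x)) =
      (cis (of_int n * (2 * pi)) / (\<i> * of_int n) - cis (of_int n * 0) / (\<i> * of_int n))"
    by (rule integral_unique)
  also have "cis (of_int n * (2 * pi)) = 1"
    by (metis cis_multiple_2pi Ints_of_int mult.commute)
  finally show ?thesis using False by simp
qed

lemma circle_moment_const: "circle_moment (\<lambda>_. c) n = (if n = 0 then 2 * of_real pi * of_real c else 0)"
  by (simp add: circle_moment_alt integral_cis_circle)

lemma moment_series_summable:
  assumes f: "integrable circle_measure f" and z: "norm z < 1"
  shows "summable (\<lambda>n. norm (z ^ Suc n * circle_moment f (int (Suc n))))"
proof (rule summable_comparison_test')
  let ?B = "LINT x|circle_measure. \<bar>f x\<bar>"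
  show "summable (\<lambda>n. norm z ^ Suc n * ?B)"
    using z by (intro summable_mult2 summable_Suc_iff[THEN iffD2] summable_geometric) auto
  show "norm (norm (z ^ Suc n * circle_moment f (int (Suc n)))) \<le> norm z ^ Suc n * ?B" for n
    using norm_circle_moment_le[OF f, of "int (Suc n)"]
    by (simp add: norm_mult norm_power mult_left_mono del: power_Suc of_nat_Suc)
qed

lemma moment_series_sums:
  assumes f: "integrable circle_measure f" and z: "norm z < 1"
  shows "(\<lambda>n. z ^ Suc n * circle_moment f (int (Suc n))) sums moment_series f z"
  unfolding moment_series_def
  by (rule summable_sums, rule summable_norm_cancel, rule moment_series_summable[OF assms])

text \<open>
  Summing the geometric series under the integral gives the kernel
  \<open>1 + 2 \<Sum> (z cis x)\<^sup>n = (1 + z cis x) / (1 - z cis x)\<close>, whose real part is the Poisson kernel.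
\<close>

lemma herglotz_representation:
  assumes f: "integrable circle_measure f" and z: "norm z < 1"
  shows "integrable circle_measure (\<lambda>x. (1 + z * cis x) / (1 - z * cis x) * of_real (f x))" (is ?int)
    and "circle_moment f 0 + 2 * moment_series f z =
      (LINT x|circle_measure. (1 + z * cis x) / (1 - z * cis x) * of_real (f x))" (is ?eq)
proof -
  let ?F = "\<lambda>n x. z ^ Suc n * (cis (of_int (int (Suc n)) * x) * complex_of_real (f x))"
  have geo: "(\<lambda>n. z ^ Suc n * cis (of_int (int (Suc n)) * x)) sums (z * cis x / (1 - z * cis x))" for x
  proof -
    have "(\<lambda>n. (z * cis x) * (z * cis x) ^ n) sums ((z * cis x) * (1 / (1 - z * cis x)))"
      using z by (intro sums_mult geometric_sums) (simp add: norm_mult)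
    moreover have "(z * cis x) * (z * cis x) ^ n = z ^ Suc n * cis (of_int (int (Suc n)) * x)" for n
    proof -
      have "(z * cis x) * (z * cis x) ^ n = (z * cis x) ^ Suc n" by simp
      also have "\<dots> = z ^ Suc n * cis (of_int (int (Suc n)) * x)"
        by (simp only: power_mult_distrib Complex.DeMoivre of_int_of_nat_eq)
      finally show ?thesis .
    qed
    ultimately show ?thesis by simp
  qed
  have Fs: "(\<lambda>n. ?F n x) sums (z * cis x / (1 - z * cis x) * of_real (f x))" for x
    using sums_mult2[OF geo, of x "of_real (f x)"] by (simp only: mult.assoc)
  have Fint: "integrable circle_measure (?F n)" for n
    using f by (intro integrable_mult_right integrable_cis_mult) simp
  have nF: "norm (?F n x) = norm z ^ Suc n * \<bar>f x\<bar>" for n x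
    by (simp add: norm_mult norm_power)
  have sF: "summable (\<lambda>n. norm z ^ Suc n * c)" for c
    using z by (intro summable_mult2 summable_Suc_iff[THEN iffD2] summable_geometric) auto
  have s1: "AE x in circle_measure. summable (\<lambda>n. norm (?F n x))" by (simp only: nF sF) simp
  have s2: "summable (\<lambda>n. LINT x|circle_measure. norm (?F n x))"
    using f sF by (simp only: nF integral_mult_right_zero)
  have suminf: "(\<Sum>n. ?F n x) = z * cis x / (1 - z * cis x) * of_real (f x)" for x
    using sums_unique[OF Fs] by simp
  have int: "integrable circle_measure (\<lambda>x. z * cis x / (1 - z * cis x) * of_real (f x))"
    using integrable_suminf[OF Fint s1 s2] by (simp only: suminf)
  have "(\<lambda>n. LINT x|circle_measure. ?F n x) sums (LINT x|circle_measure. z * cis x / (1 - z * cis x) * of_real (f x))"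
    using sums_integral[OF Fint s1 s2] by (simp only: suminf)
  moreover have "(LINT x|circle_measure. ?F n x) = z ^ Suc n * circle_moment f (int (Suc n))" for n
    unfolding circle_moment_alt by (rule integral_mult_right_zero)
  ultimately have ms: "moment_series f z = (LINT x|circle_measure. z * cis x / (1 - z * cis x) * of_real (f x))"
    using moment_series_sums[OF f z] sums_unique2 by (metis (mono_tags, lifting) sums_cong)
  have eq: "(1 + z * cis x) / (1 - z * cis x) * of_real (f x) = of_real (f x) + 2 * (z * cis x / (1 - z * cis x) * of_real (f x))" for x
  proof -
    have "1 - z * cis x \<noteq> 0" using z by (metis eq_iff_diff_eq_0 less_irrefl mult.right_neutral norm_cis norm_mult norm_one)
    then show ?thesis by (simp add: field_simps)
  qed
  show ?int unfolding eq using f int by (intro Bochner_Integration.integrable_add integrable_mult_right) auto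
  have "(LINT x|circle_measure. of_real (f x) + 2 * (z * cis x / (1 - z * cis x) * of_real (f x))) =
      (LINT x|circle_measure. of_real (f x)) + (LINT x|circle_measure. 2 * (z * cis x / (1 - z * cis x) * of_real (f x)))"
    using f by (intro Bochner_Integration.integral_add integrable_mult_right[OF int]) simp
  then show ?eq unfolding eq ms circle_moment_zero
    by (simp only: integral_mult_right_zero integral_complex_of_real)
qed

text \<open>
  The Poisson kernel \<open>(1 - \<bar>z\<bar>\<^sup>2) / \<bar>1 - z cis x\<bar>\<^sup>2\<close> is at least \<open>(1 - \<bar>z\<bar>) / (1 + \<bar>z\<bar>)\<close>.
\<close>

lemma Re_herglotz_lower_bound:
  assumes f: "integrable circle_measure f" "AE x in circle_measure. 0 \<le> f x" and z: "norm z < 1"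
  shows "(1 - norm z) / (1 + norm z) * (LINT x|circle_measure. f x) \<le> Re (circle_moment f 0 + 2 * moment_series f z)"
proof -
  have ker: "(1 - norm z) / (1 + norm z) \<le> Re ((1 + z * cis x) / (1 - z * cis x))" for x
  proof -
    define w where "w = z * cis x"
    have nw: "norm w = norm z" by (simp add: w_def norm_mult)
    have pos: "0 < norm (1 - w)" using z nw norm_triangle_ineq2[of 1 w] unfolding norm_one by linarith
    have le: "norm (1 - w) \<le> 1 + norm z" using norm_triangle_ineq4[of 1 w] nw by simp
    have "Re ((1 + w) / (1 - w)) = (1 - norm w ^ 2) / norm (1 - w) ^ 2"
      unfolding cmod_power2 by (simp add: Re_divide power2_eq_square algebra_simps)
    also have "\<dots> \<ge> (1 - norm w ^ 2) / (1 + norm z) ^ 2"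
      using pos le z nw by (intro divide_left_mono power_mono mult_pos_pos) (auto simp: power_le_one)
    also have "(1 - norm w ^ 2) / (1 + norm z) ^ 2 = (1 - norm z) / (1 + norm z)"
    proof -
      have "1 + norm z \<noteq> 0" using norm_ge_zero[of z] by linarith
      moreover have "1 - norm w ^ 2 = (1 - norm z) * (1 + norm z)" by (simp add: nw power2_eq_square algebra_simps)
      ultimately show ?thesis by (simp add: power2_eq_square)
    qed
    finally show ?thesis by (simp add: w_def)
  qed
  have "(1 - norm z) / (1 + norm z) * (LINT x|circle_measure. f x) = (LINT x|circle_measure. (1 - norm z) / (1 + norm z) * f x)"
    by (rule integral_mult_right_zero[symmetric])
  also have "\<dots> \<le> (LINT x|circle_measure. Re ((1 + z * cis x) / (1 - z * cis x) * of_real (f x)))"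
  proof (rule integral_mono_AE)
    show "AE x in circle_measure. (1 - norm z) / (1 + norm z) * f x \<le> Re ((1 + z * cis x) / (1 - z * cis x) * of_real (f x))"
      using f(2)
    proof eventually_elim
      case (elim x)
      have "Re ((1 + z * cis x) / (1 - z * cis x) * of_real (f x)) = Re ((1 + z * cis x) / (1 - z * cis x)) * f x"
        by (simp only: times_complex.sel Re_complex_of_real Im_complex_of_real mult_zero_right diff_zero)
      then show ?case using mult_right_mono[OF ker elim] by simp
    qed
  qed (use f integrable_Re[OF herglotz_representation(1)[OF f(1) z]] in auto)
  also have "\<dots> = Re (circle_moment f 0 + 2 * moment_series f z)"
    using herglotz_representation[OF f(1) z] by (simp add: integral_Re)
  finally show ?thesis .
qed

text \<open>
  To be applied to \<open>f - a\<close> and \<open>b - f\<close>: constants have no moments of positive index.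
\<close>

lemma moment_series_cong:
  assumes "\<And>n. circle_moment f (int (Suc n)) = c * circle_moment g (int (Suc n))"
    and "integrable circle_measure g" "norm z < 1"
  shows "moment_series f z = c * moment_series g z"
proof -
  have "moment_series f z = (\<Sum>n. c * (z ^ Suc n * circle_moment g (int (Suc n))))"
    unfolding moment_series_def assms(1) by (simp only: mult.left_commute)
  also have "\<dots> = c * moment_series g z"
    using moment_series_sums[OF assms(2,3)] by (intro sums_unique[symmetric] sums_mult)
  finally show ?thesis .
qed

lemma density_profile_mass: "density_profile f \<Longrightarrow> (LINT x|circle_measure. f x) = 1"
  unfolding density_profile_def set_lebesgue_integral_def by (subst integral_restrict_space) auto

text \<open>
  The lower bound applied to the nonnegative functions \<open>f - a\<close> and \<open>b - f\<close>.
\<close>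

lemma Re_herglotz_bounds:
  assumes f: "density_profile f" and ab: "AE x in lebesgue. a \<le> f x \<and> f x \<le> b" and z: "norm z < 1"
  shows "2 * pi * a + (1 - norm z) / (1 + norm z) * (1 - 2 * pi * a) \<le> Re (1 + 2 * moment_series f z)"
    and "Re (1 + 2 * moment_series f z) \<le> 2 * pi * b - (1 - norm z) / (1 + norm z) * (2 * pi * b - 1)"
    and "2 * pi * a \<le> 1" and "1 \<le> 2 * pi * b"
proof -
  have fint: "integrable circle_measure f"
    using f ab by (intro integrable_circle_if_bounded) (auto simp: density_profile_def)
  have cint: "integrable circle_measure (\<lambda>_. c)" for c :: real
    by (rule finite_measure.integrable_const[OF finite_circle_measure])
  have meas: "measure circle_measure {0..2 * pi} = 2 * pi" by (simp add: measure_restrict_space)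
  note mass = density_profile_mass[OF f]
  have ae: "AE x in circle_measure. a \<le> f x \<and> f x \<le> b" by (rule AE_circleI[OF ab])
  have m1: "moment_series (\<lambda>x. f x - a) z = 1 * moment_series f z"
    by (rule moment_series_cong[OF _ fint z]) (simp add: circle_moment_diff[OF fint cint] circle_moment_const del: of_nat_Suc)
  have m2: "moment_series (\<lambda>x. b - f x) z = (-1) * moment_series f z"
    by (rule moment_series_cong[OF _ fint z]) (simp add: circle_moment_diff[OF cint fint] circle_moment_const del: of_nat_Suc)
  have "(1 - norm z) / (1 + norm z) * (LINT x|circle_measure. f x - a) \<le> Re (circle_moment (\<lambda>x. f x - a) 0 + 2 * moment_series (\<lambda>x. f x - a) z)"
    by (rule Re_herglotz_lower_bound) (use fint cint ae z in auto)
  then show "2 * pi * a + (1 - norm z) / (1 + norm z) * (1 - 2 * pi * a) \<le> Re (1 + 2 * moment_series f z)"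
    unfolding m1 circle_moment_zero using fint cint by (simp add: mass meas)
  have "(1 - norm z) / (1 + norm z) * (LINT x|circle_measure. b - f x) \<le> Re (circle_moment (\<lambda>x. b - f x) 0 + 2 * moment_series (\<lambda>x. b - f x) z)"
    by (rule Re_herglotz_lower_bound) (use fint cint ae z in auto)
  then show "Re (1 + 2 * moment_series f z) \<le> 2 * pi * b - (1 - norm z) / (1 + norm z) * (2 * pi * b - 1)"
    unfolding m2 circle_moment_zero using fint cint by (simp add: mass meas)
  have "0 \<le> (LINT x|circle_measure. f x - a)" using ae by (intro integral_nonneg_AE) auto
  then show "2 * pi * a \<le> 1" using fint cint by (simp add: mass meas)
  have "0 \<le> (LINT x|circle_measure. b - f x)" using ae by (intro integral_nonneg_AE) auto
  then show "1 \<le> 2 * pi * b" using fint cint by (simp add: mass meas)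
qed

text \<open>
  \<open>Re (sin (u + i v)) = sin u cosh v\<close> with \<open>cosh v \<ge> 1\<close>, so the velocity has a positive real part as long
  as its argument stays in a strip strictly inside \<open>0 < u < pi\<close>.
\<close>

lemma Re_velocity_lower_bound:
  assumes \<alpha>: "0 < \<alpha>" "\<alpha> < 1" and \<delta>: "0 < \<delta>"
    and w: "\<delta> \<le> pi * \<alpha> * Re (1 + 2 * z)" "pi * \<alpha> * Re (1 + 2 * z) \<le> pi - \<delta>"
  shows "2 * pi ^ 2 * sin \<delta> / sin (pi * \<alpha>) \<le> Re (velocity \<alpha> z)" and "0 < 2 * pi ^ 2 * sin \<delta> / sin (pi * \<alpha>)"
proof -
  define u where "u = pi * \<alpha> * Re (1 + 2 * z)"
  have s: "0 < sin (pi * \<alpha>)" using \<alpha> by (intro sin_gt_zero) auto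
  have \<delta>2: "\<delta> \<le> pi / 2" using w by linarith
  have sd: "0 < sin \<delta>" using \<delta> \<delta>2 by (intro sin_gt_zero) auto
  have "sin \<delta> \<le> sin u"
  proof (cases "u \<le> pi / 2")
    case True
    then show ?thesis using \<delta> w by (intro sin_monotone_2pi_le) (auto simp: u_def)
  next
    case False
    then have "sin \<delta> \<le> sin (pi - u)" using \<delta> w by (intro sin_monotone_2pi_le) (auto simp: u_def)
    then show ?thesis by simp
  qed
  moreover have "2 \<le> exp v + exp (- v)" for v :: real
    using cosh_real_ge_1[of v] by (simp add: cosh_def)
  ultimately have "sin \<delta> * 2 \<le> sin u * (exp v + exp (- v))" for v :: real
    using sd by (intro mult_mono) auto
  then have "sin \<delta> \<le> sin u * (exp v + exp (- v)) / 2" for v :: real by simp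
  then have "sin \<delta> \<le> Re (sin (of_real (pi * \<alpha>) * (1 + 2 * z)))"
    unfolding Re_sin u_def by simp
  then have "2 * pi ^ 2 / sin (pi * \<alpha>) * sin \<delta> \<le> 2 * pi ^ 2 / sin (pi * \<alpha>) * Re (sin (of_real (pi * \<alpha>) * (1 + 2 * z)))"
    using s by (intro mult_left_mono) auto
  also have "\<dots> = Re (velocity \<alpha> z)"
  proof -
    have "velocity \<alpha> z = of_real (2 * pi ^ 2 / sin (pi * \<alpha>)) * sin (of_real (pi * \<alpha>) * (1 + 2 * z))"
      by (simp add: velocity_def)
    then show ?thesis by (simp only: times_complex.sel Re_complex_of_real Im_complex_of_real mult_zero_left diff_zero)
  qed
  finally show "2 * pi ^ 2 * sin \<delta> / sin (pi * \<alpha>) \<le> Re (velocity \<alpha> z)" by simp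
  show "0 < 2 * pi ^ 2 * sin \<delta> / sin (pi * \<alpha>)" using s sd by simp
qed

lemma velocity_holomorphic: "velocity \<alpha> holomorphic_on UNIV"
  unfolding velocity_def[abs_def] divide_inverse by (intro holomorphic_intros)

section \<open>Joint analyticity of Fourier series with analytic coefficients\<close>

text \<open>
  Summing over \<open>k\<close> and \<open>m\<close> turns the bound into a geometric series in \<open>n\<close> with ratio \<open>q exp y\<close>.
\<close>

lemma summable_on_product_bound:
  fixes f :: "nat \<Rightarrow> nat \<Rightarrow> nat \<Rightarrow> complex"
  assumes bound: "\<And>n m k. norm (f n m k) \<le> C * q ^ n * s ^ m * ((real n * y) ^ k / fact k)"
    and s: "0 \<le> s" "s < 1" and q: "0 \<le> q" "q * exp y < 1" and y: "0 \<le> y" and C: "0 \<le> C"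
  shows "(\<lambda>(n, m, k). norm (f n m k)) summable_on UNIV"
proof -
  have s1: "((\<lambda>k. C * q ^ n * s ^ m * ((real n * y) ^ k / fact k)) has_sum (C * q ^ n * s ^ m * exp (real n * y))) UNIV" for n m
  proof -
    have "(\<lambda>k. (real n * y) ^ k / fact k) sums exp (real n * y)"
      using exp_converges[of "real n * y"] by (simp add: field_simps)
    then have "(\<lambda>k. C * q ^ n * s ^ m * ((real n * y) ^ k / fact k)) sums (C * q ^ n * s ^ m * exp (real n * y))"
      by (rule sums_mult)
    then show ?thesis
      using C q s y by (intro sums_nonneg_imp_has_sum) auto
  qed
  have s2: "((\<lambda>m. C * q ^ n * s ^ m * exp (real n * y)) has_sum (C * (q * exp y) ^ n * (1 / (1 - s)))) UNIV" for n
  proof -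
    have "(\<lambda>m. C * (q * exp y) ^ n * s ^ m) sums (C * (q * exp y) ^ n * (1 / (1 - s)))"
      using s by (intro sums_mult geometric_sums) auto
    moreover have "C * (q * exp y) ^ n * s ^ m = C * q ^ n * s ^ m * exp (real n * y)" for m
      by (simp add: exp_of_nat_mult power_mult_distrib)
    ultimately have "(\<lambda>m. C * q ^ n * s ^ m * exp (real n * y)) sums (C * (q * exp y) ^ n * (1 / (1 - s)))"
      by (simp only:)
    then show ?thesis using C q s y by (intro sums_nonneg_imp_has_sum) auto
  qed
  have s3: "(\<lambda>n. C * (q * exp y) ^ n * (1 / (1 - s))) summable_on UNIV"
  proof -
    have "summable (\<lambda>n. C * (q * exp y) ^ n * (1 / (1 - s)))"
      using q by (intro summable_mult2 summable_mult summable_geometric) auto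
    then show ?thesis using C q s by (subst summable_on_UNIV_nonneg_real_iff) auto
  qed
  have nn: "0 \<le> C * q ^ n * s ^ m * ((real n * y) ^ k / fact k)" for n m k using C q s y by simp
  have "(\<lambda>(m, k). C * q ^ n * s ^ m * ((real n * y) ^ k / fact k)) summable_on (UNIV \<times> UNIV)" for n
    by (rule summable_on_SigmaI[where g="\<lambda>m. C * q ^ n * s ^ m * exp (real n * y)"])
       (use s1 s2 nn in \<open>auto simp: summable_on_def\<close>)
  then have s12: "((\<lambda>(m, k). C * q ^ n * s ^ m * ((real n * y) ^ k / fact k)) has_sum (C * (q * exp y) ^ n * (1 / (1 - s)))) (UNIV \<times> UNIV)" for n
    by (intro has_sum_SigmaI[where g="\<lambda>m. C * q ^ n * s ^ m * exp (real n * y)"]) (use s1 s2 in auto)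
  have "(\<lambda>(n, m, k). C * q ^ n * s ^ m * ((real n * y) ^ k / fact k)) summable_on (UNIV \<times> (UNIV \<times> UNIV))"
    by (rule summable_on_SigmaI[where g="\<lambda>n. C * (q * exp y) ^ n * (1 / (1 - s))"])
       (use s12 s3 nn in \<open>auto simp: case_prod_unfold\<close>)
  then have "(\<lambda>(n, m, k). C * q ^ n * s ^ m * ((real n * y) ^ k / fact k)) summable_on UNIV" by simp
  then show ?thesis
    by (rule summable_on_comparison_test) (use bound in auto)
qed

text \<open>
  Expand each coefficient in powers of \<open>t - t0\<close> (the Cauchy estimates keep the geometric decay in \<open>n\<close>)
  and each character in powers of \<open>x - x0\<close>. The resulting triple series converges absolutely for small
  \<open>t - t0\<close> and \<open>x - x0\<close>, so it can be summed over \<open>n\<close> first.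
\<close>

lemma fourier_sum_real_analytic:
  fixes A :: "nat \<Rightarrow> complex \<Rightarrow> complex"
  assumes hol: "\<And>n. A n holomorphic_on ball (of_real t0) \<delta>" and \<delta>: "0 < \<delta>"
    and bound: "\<And>n \<tau>. \<tau> \<in> ball (of_real t0) \<delta> \<Longrightarrow> norm (A n \<tau>) \<le> C * q ^ n"
    and q: "0 < q" "q < 1" and C: "0 \<le> C"
  shows "\<exists>c r. 0 < r \<and> (\<forall>t x. \<bar>t - t0\<bar> < r \<and> \<bar>x - x0\<bar> < r \<longrightarrow>
    ((\<lambda>(m, k). c m k * (t - t0) ^ m * (x - x0) ^ k) has_sum (\<Sum>n. Re (A n (of_real t) * cis (- (real n * x))))) UNIV)"
proof -
  define R where "R = \<delta> / 2"
  have R: "0 < R" "R < \<delta>" using \<delta> by (auto simp: R_def)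
  define a where "a n m = (deriv ^^ m) (A n) (of_real t0) / fact m" for n m
  define b where "b n k = cis (- (real n * x0)) * ((- \<i> * of_nat n) ^ k / fact k)" for n k
  define c where "c m k = (\<Sum>\<^sub>\<infinity>n. Re (a n m * b n k))" for m k
  have na: "norm (a n m) \<le> C * q ^ n / R ^ m" for n m
  proof -
    have "norm ((deriv ^^ m) (A n) (of_real t0)) \<le> fact m * (C * q ^ n) / R ^ m"
    proof (rule Cauchy_inequality)
      show "A n holomorphic_on ball (of_real t0) R" by (rule holomorphic_on_subset[OF hol]) (use R in auto)
      show "continuous_on (cball (of_real t0) R) (A n)"
        by (rule holomorphic_on_imp_continuous_on, rule holomorphic_on_subset[OF hol]) (use R in auto)
      show "norm (A n x) \<le> C * q ^ n" if "norm (of_real t0 - x) = R" for x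
        using that R by (intro bound) (auto simp: dist_norm)
    qed (rule R)
    then show ?thesis by (simp add: a_def norm_divide field_simps)
  qed
  have nb: "norm (b n k) = real n ^ k / fact k" for n k
    by (simp add: b_def norm_mult norm_divide norm_power)
  have sa: "(\<lambda>m. a n m * of_real (t - t0) ^ m) sums A n (of_real t)" if "\<bar>t - t0\<bar> < R" for n t
  proof -
    have "of_real t \<in> ball (complex_of_real t0) R"
      using that by (simp add: dist_real_def abs_minus_commute flip: of_real_diff)
    then show ?thesis
      using holomorphic_power_series[OF holomorphic_on_subset[OF hol[of n]], of "of_real t0" R "of_real t"] R
      unfolding a_def by (simp add: subset_ball)
  qed
  have sb: "(\<lambda>k. b n k * of_real (x - x0) ^ k) sums cis (- (real n * x))" for n x
  proof -
    have "(\<lambda>k. cis (- (real n * x0)) * ((- \<i> * of_nat n * of_real (x - x0)) ^ k /\<^sub>R fact k)) sums (cis (- (real n * x0)) * exp (- \<i> * of_nat n * of_real (x - x0)))"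
      by (intro sums_mult exp_converges)
    moreover have "cis (- (real n * x0)) * ((- \<i> * of_nat n * of_real (x - x0)) ^ k /\<^sub>R fact k) = b n k * of_real (x - x0) ^ k" for k
      by (simp only: b_def power_mult_distrib scaleR_conv_of_real of_real_inverse of_real_fact divide_inverse mult_ac)
    moreover have "cis (- (real n * x0)) * exp (- \<i> * of_nat n * of_real (x - x0)) = cis (- (real n * x))"
      by (simp add: cis_conv_exp algebra_simps flip: exp_add)
    ultimately show ?thesis by simp
  qed
  \<comment> \<open>the second bound keeps \<open>q * exp \<bar>x - x0\<bar>\<close> below 1\<close>
  define r where "r = min (R / 2) (- ln q / 2)"
  have r: "0 < r" using R q by (simp add: r_def)
  show ?thesis
  proof (intro exI[of _ c] exI[of _ r] conjI allI impI)
    fix t x assume tx: "\<bar>t - t0\<bar> < r \<and> \<bar>x - x0\<bar> < r"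
    define s y where "s = \<bar>t - t0\<bar> / R" and "y = \<bar>x - x0\<bar>"
    define f where "f n m k = a n m * of_real (t - t0) ^ m * (b n k * of_real (x - x0) ^ k)" for n m k
    have tR: "\<bar>t - t0\<bar> < R" using tx R by (auto simp: r_def)
    have s: "0 \<le> s" "s < 1" using tR R by (auto simp: s_def)
    have "y < - ln q" using tx q by (auto simp: y_def r_def)
    then have "exp y < exp (- ln q)" by simp
    then have qy: "q * exp y < 1" using q by (simp add: exp_minus field_simps)
    have nf: "norm (f n m k) \<le> C * q ^ n * s ^ m * ((real n * y) ^ k / fact k)" for n m k
    proof -
      have "norm (f n m k) = norm (a n m) * \<bar>t - t0\<bar> ^ m * (norm (b n k) * y ^ k)"
        by (simp add: f_def norm_mult norm_power y_def flip: of_real_diff)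
      also have "\<dots> \<le> (C * q ^ n / R ^ m) * \<bar>t - t0\<bar> ^ m * (norm (b n k) * y ^ k)"
        using na by (intro mult_right_mono) (auto simp: y_def)
      also have "\<dots> = C * q ^ n * s ^ m * ((real n * y) ^ k / fact k)"
        by (simp add: nb s_def power_divide power_mult_distrib)
      finally show ?thesis .
    qed
    have abs: "(\<lambda>(n, m, k). norm (f n m k)) summable_on UNIV"
      using summable_on_product_bound[OF nf s _ qy _ C] q by (simp add: y_def)
    then have "(\<lambda>p. norm ((\<lambda>(n, m, k). f n m k) p)) summable_on UNIV" by (simp add: case_prod_unfold)
    from abs_summable_summable[OF this]
    obtain S where S: "((\<lambda>(n, m, k). f n m k) has_sum S) UNIV"
      unfolding summable_on_def by blast
    have abs_n: "(\<lambda>(m, k). f n m k) summable_on UNIV" for n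
    proof -
      have "(\<lambda>(n, m, k). f n m k) summable_on (UNIV \<times> UNIV)" using S by (auto simp: summable_on_def)
      from summable_on_SigmaD1[OF this, of n] show ?thesis by (simp add: case_prod_unfold)
    qed
    have sum_n: "((\<lambda>(m, k). f n m k) has_sum (A n (of_real t) * cis (- (real n * x)))) UNIV" for n
    proof -
      have hk: "((\<lambda>k. f n m k) has_sum (a n m * of_real (t - t0) ^ m * cis (- (real n * x)))) UNIV" for m
      proof -
        have "(\<lambda>k. f n m k) summable_on UNIV"
          using summable_on_SigmaD1[of "\<lambda>m k. f n m k" UNIV "\<lambda>_. UNIV" m] abs_n[of n] by simp
        moreover have "(\<lambda>k. f n m k) sums (a n m * of_real (t - t0) ^ m * cis (- (real n * x)))"
          unfolding f_def by (intro sums_mult sb)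
        ultimately show ?thesis using has_sum_imp_sums sums_unique2 summable_on_def by blast
      qed
      obtain S' where S': "((\<lambda>(m, k). f n m k) has_sum S') (UNIV \<times> UNIV)"
        using abs_n[of n] by (auto simp: summable_on_def)
      have "((\<lambda>m. a n m * of_real (t - t0) ^ m * cis (- (real n * x))) has_sum S') UNIV"
        by (rule has_sum_SigmaD[OF S']) (use hk in simp)
      then have "(\<lambda>m. a n m * of_real (t - t0) ^ m * cis (- (real n * x))) sums S'"
        by (rule has_sum_imp_sums)
      moreover have "(\<lambda>m. a n m * of_real (t - t0) ^ m * cis (- (real n * x))) sums (A n (of_real t) * cis (- (real n * x)))"
        by (intro sums_mult2 sa tR)
      ultimately show ?thesis using S' sums_unique2 by fastforce
    qed
    have "((\<lambda>n. A n (of_real t) * cis (- (real n * x))) has_sum S) UNIV"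
    proof (rule has_sum_SigmaD)
      show "((\<lambda>(n, m, k). f n m k) has_sum S) (UNIV \<times> UNIV)" using S by simp
      show "((\<lambda>p. (\<lambda>(n, m, k). f n m k) (n, p)) has_sum A n (of_real t) * cis (- (real n * x))) UNIV" for n
        using sum_n[of n] by simp
    qed
    then have "((\<lambda>n. Re (A n (of_real t) * cis (- (real n * x)))) has_sum Re S) UNIV"
      by (rule has_sum_bounded_linear[OF bounded_linear_Re])
    then have ReS: "Re S = (\<Sum>n. Re (A n (of_real t) * cis (- (real n * x))))"
      by (simp add: has_sum_imp_sums sums_unique)
    have swap: "((\<lambda>(p, n). f n (fst p) (snd p)) has_sum S) (UNIV \<times> UNIV)"
      using S by (subst has_sum_swap) (simp add: case_prod_unfold)
    have swapRe: "((\<lambda>(p, n). Re (f n (fst p) (snd p))) has_sum Re S) (UNIV \<times> UNIV)"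
      using has_sum_bounded_linear[OF bounded_linear_Re swap] by (simp add: case_prod_unfold)
    have "((\<lambda>p. \<Sum>\<^sub>\<infinity>n. Re (f n (fst p) (snd p))) has_sum Re S) UNIV"
    proof (rule has_sum_SigmaD[OF swapRe])
      fix p :: "nat \<times> nat"
      have "(\<lambda>n. Re (f n (fst p) (snd p))) summable_on UNIV"
        using summable_on_SigmaD1[of "\<lambda>p n. Re (f n (fst p) (snd p))" UNIV "\<lambda>_. UNIV" p] swapRe
        by (auto simp: summable_on_def)
      then show "((\<lambda>n. (\<lambda>(p, n). Re (f n (fst p) (snd p))) (p, n)) has_sum (\<Sum>\<^sub>\<infinity>n. Re (f n (fst p) (snd p)))) UNIV"
        by simp
    qed
    moreover have "(\<Sum>\<^sub>\<infinity>n. Re (f n m k)) = c m k * (t - t0) ^ m * (x - x0) ^ k" for m k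
    proof -
      have "Re (f n m k) = Re (a n m * b n k) * ((t - t0) ^ m * (x - x0) ^ k)" for n
      proof -
        have "f n m k = of_real ((t - t0) ^ m * (x - x0) ^ k) * (a n m * b n k)"
          by (simp add: f_def mult_ac)
        then show ?thesis by (simp only: times_complex.sel Re_complex_of_real Im_complex_of_real mult_zero_left diff_zero mult.commute)
      qed
      then show ?thesis by (simp add: infsum_cmult_left' c_def mult.assoc)
    qed
    ultimately show "((\<lambda>(m, k). c m k * (t - t0) ^ m * (x - x0) ^ k) has_sum (\<Sum>n. Re (A n (of_real t) * cis (- (real n * x))))) UNIV"
      by (simp add: case_prod_unfold ReS)
  qed (rule r)
qed

section \<open>The transport equation on the unit circle\<close>

text \<open>
  Near \<open>t0\<close> the coefficients extend to complex times, holomorphically and with a common geometric bound.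
\<close>

definition analytic_coefficients_at :: "real \<Rightarrow> (real \<Rightarrow> nat \<Rightarrow> complex) \<Rightarrow> bool" where
  "analytic_coefficients_at t0 a \<longleftrightarrow> (\<exists>A \<delta> C q. 0 < \<delta> \<and> 0 < C \<and> 0 < q \<and> q < 1 \<and>
     (\<forall>n. A n holomorphic_on ball (of_real t0) \<delta>) \<and>
     (\<forall>n. \<forall>\<tau>\<in>ball (of_real t0) \<delta>. norm (A n \<tau>) \<le> C * q ^ n) \<and>
     (\<forall>n t. \<bar>t - t0\<bar> < \<delta> \<longrightarrow> A n (of_real t) = a t n))"

lemma analytic_coefficients_at_decay:
  assumes "analytic_coefficients_at t0 a"
  obtains C q where "0 < C" "0 < q" "q < 1" "\<And>n. norm (a t0 n) \<le> C * q ^ n"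
proof -
  from assms obtain A \<delta> C q where A: "0 < \<delta>" "0 < C" "0 < q" "q < 1"
    "\<forall>n. \<forall>\<tau>\<in>ball (of_real t0) \<delta>. norm (A n \<tau>) \<le> C * q ^ n"
    "\<forall>n t. \<bar>t - t0\<bar> < \<delta> \<longrightarrow> A n (complex_of_real t) = a t n"
    unfolding analytic_coefficients_at_def by blast
  have "norm (a t0 n) \<le> C * q ^ n" for n
    using A(1,5) A(6)[rule_format, of t0 n] by (metis abs_zero centre_in_ball diff_self)
  then show ?thesis using that A by blast
qed

lemma summable_geometric_bound:
  fixes b :: "nat \<Rightarrow> complex"
  assumes "\<And>n. norm (b n) \<le> C * q ^ n" "0 \<le> q" "q * norm z < 1"
  shows "summable (\<lambda>n. norm (b n * z ^ n))"
proof (rule summable_comparison_test')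
  show "summable (\<lambda>n. C * (q * norm z) ^ n)"
    using assms by (intro summable_mult summable_geometric) (auto simp: abs_mult)
  show "norm (norm (b n * z ^ n)) \<le> C * (q * norm z) ^ n" for n
    using mult_right_mono[OF assms(1)[of n], of "norm z ^ n"]
    by (simp add: norm_mult norm_power power_mult_distrib mult.assoc)
qed

lemma power_series_holomorphic_geometric:
  fixes b :: "nat \<Rightarrow> complex"
  assumes b: "\<And>n. norm (b n) \<le> C * q ^ n" and q: "0 < q"
  shows "(\<lambda>z. \<Sum>n. b n * z ^ n) holomorphic_on ball 0 (1 / q)"
proof (rule power_series_holomorphic)
  fix w :: complex assume "w \<in> ball 0 (1 / q)"
  then have "norm w < 1 / q" by simp
  then have "q * norm w < 1" using q by (simp add: pos_less_divide_eq mult.commute)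
  then have "summable (\<lambda>n. b n * w ^ n)"
    using summable_norm_cancel[OF summable_geometric_bound[of b C q w, OF b]] q by simp
  then show "(\<lambda>n. b n * (w - 0) ^ n) sums (\<Sum>n. b n * w ^ n)" by (simp add: summable_sums)
qed

text \<open>
  The power series can be differentiated termwise in complex time, so for \<open>\<bar>z\<bar> < 1 / q\<close> its time
  derivative exists and is holomorphic in \<open>z\<close>. The same holds for the right-hand side of the equation,
  and both agree on the unit disk, hence on the larger disk by analytic continuation.
\<close>

theorem equation_extends_across_circle:
  fixes a :: "real \<Rightarrow> nat \<Rightarrow> complex" and W :: "complex \<Rightarrow> complex"
  defines "K \<equiv> \<lambda>t z. \<Sum>n. a t n * z ^ n"
  assumes coeff: "analytic_coefficients_at t0 a" and W: "W holomorphic_on UNIV"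
    and pde: "\<And>z. norm z < 1 \<Longrightarrow> ((\<lambda>s. K s z) has_vector_derivative - (z * W (K t0 z) * deriv (K t0) z)) (at t0)"
  obtains R where "1 < R" "K t0 holomorphic_on ball 0 R"
    "\<And>z. norm z < R \<Longrightarrow> ((\<lambda>s. K s z) has_vector_derivative - (z * W (K t0 z) * deriv (K t0) z)) (at t0)"
proof -
  from coeff obtain A \<delta> C q where A: "0 < \<delta>" "0 < C" "0 < q" "q < 1"
    "\<And>n. A n holomorphic_on ball (of_real t0) \<delta>"
    "\<And>n \<tau>. \<tau>\<in>ball (of_real t0) \<delta> \<Longrightarrow> norm (A n \<tau>) \<le> C * q ^ n"
    "\<And>n t. \<bar>t - t0\<bar> < \<delta> \<Longrightarrow> A n (complex_of_real t) = a t n"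
    unfolding analytic_coefficients_at_def by blast
  define R where "R = 1 / q"
  have R: "1 < R" using A by (simp add: R_def)
  have qz: "q * norm z < 1" if "norm z < R" for z :: complex
    using that A by (simp add: R_def pos_less_divide_eq mult.commute)
  have dA: "norm (deriv (A n) \<tau>) \<le> 2 * C / \<delta> * q ^ n" if \<tau>: "\<tau> \<in> ball (of_real t0) (\<delta> / 2)" for n \<tau>
  proof -
    have sub: "cball \<tau> (\<delta> / 2) \<subseteq> ball (of_real t0) \<delta>"
    proof
      fix w assume "w \<in> cball \<tau> (\<delta> / 2)"
      then show "w \<in> ball (of_real t0) \<delta>"
        using \<tau> dist_triangle[of "of_real t0" w \<tau>] by simp
    qed
    have "norm ((deriv ^^ 1) (A n) \<tau>) \<le> fact 1 * (C * q ^ n) / (\<delta> / 2) ^ 1"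
    proof (rule Cauchy_inequality)
      show "A n holomorphic_on ball \<tau> (\<delta> / 2)" by (rule holomorphic_on_subset[OF A(5)]) (use sub in auto)
      show "continuous_on (cball \<tau> (\<delta> / 2)) (A n)"
        by (rule holomorphic_on_imp_continuous_on, rule holomorphic_on_subset[OF A(5) sub])
      show "norm (A n x) \<le> C * q ^ n" if "norm (\<tau> - x) = \<delta> / 2" for x
      proof (rule A(6))
        have "x \<in> cball \<tau> (\<delta> / 2)" using that by (simp add: dist_norm)
        then show "x \<in> ball (of_real t0) \<delta>" using sub by blast
      qed
    qed (use A in auto)
    then show ?thesis by (simp add: field_simps)
  qed
  define D where "D z = (\<Sum>n. deriv (A n) (of_real t0) * z ^ n)" for z
  have Dt: "((\<lambda>s. K s z) has_vector_derivative D z) (at t0)" if z: "norm z < R" for z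
  proof -
    have "((\<lambda>\<tau>. \<Sum>n. A n \<tau> * z ^ n) has_field_derivative (\<Sum>n. deriv (A n) (of_real t0) * z ^ n)) (at (of_real t0))"
    proof (rule has_field_derivative_series'(2)[where S="ball (of_real t0) (\<delta> / 2)" and x0="of_real t0"])
      fix n \<tau> assume \<tau>: "\<tau> \<in> ball (complex_of_real t0) (\<delta> / 2)"
      then have "\<tau> \<in> ball (of_real t0) \<delta>" using A(1) by simp
      then have "(A n has_field_derivative deriv (A n) \<tau>) (at \<tau>)"
        by (rule holomorphic_derivI[OF A(5) open_ball])
      then show "((\<lambda>\<tau>. A n \<tau> * z ^ n) has_field_derivative deriv (A n) \<tau> * z ^ n) (at \<tau> within ball (of_real t0) (\<delta> / 2))"
        by (rule has_field_derivative_at_within[OF DERIV_cmult_right])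
    next
      show "uniformly_convergent_on (ball (complex_of_real t0) (\<delta> / 2)) (\<lambda>n \<tau>. \<Sum>i<n. deriv (A i) \<tau> * z ^ i)"
      proof (rule Weierstrass_m_test')
        show "summable (\<lambda>n. 2 * C / \<delta> * (q * norm z) ^ n)"
          using qz[OF z] A by (intro summable_mult summable_geometric) (auto simp: abs_mult)
        show "norm (deriv (A n) \<tau> * z ^ n) \<le> 2 * C / \<delta> * (q * norm z) ^ n"
          if "\<tau> \<in> ball (complex_of_real t0) (\<delta> / 2)" for n \<tau>
          using mult_right_mono[OF dA[OF that, of n], of "norm z ^ n"]
          by (simp add: norm_mult norm_power power_mult_distrib mult.assoc)
      qed
      show "summable (\<lambda>n. A n (complex_of_real t0) * z ^ n)"
        by (rule summable_norm_cancel[OF summable_geometric_bound[of "\<lambda>n. A n (of_real t0)" C q z]])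
           (use A(3) A(6)[OF centre_in_ball[THEN iffD2, OF A(1)]] qz[OF z] in auto)
    qed (use A in auto)
    from has_vector_derivative_real_field[OF this, of UNIV]
    have "((\<lambda>s. \<Sum>n. A n (of_real s) * z ^ n) has_vector_derivative D z) (at t0)" by (simp add: D_def)
    then show ?thesis
    proof (rule has_vector_derivative_transform_within_open[where S="ball t0 \<delta>"])
      show "(\<Sum>n. A n (of_real s) * z ^ n) = K s z" if "s \<in> ball t0 \<delta>" for s
        using A(7) that by (simp add: K_def dist_real_def abs_minus_commute)
    qed (use A in auto)
  qed
  have Khol: "K t0 holomorphic_on ball 0 R"
    unfolding K_def R_def
  proof (rule power_series_holomorphic_geometric[of _ C])
    show "norm (a t0 n) \<le> C * q ^ n" for n using A(6)[of "of_real t0" n] A(7)[of t0 n] A(1) by simp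
  qed (use A in auto)
  have "W holomorphic_on K t0 ` ball 0 R" using W by (rule holomorphic_on_subset) simp
  from holomorphic_on_compose[OF Khol this]
  have WK: "(\<lambda>z. W (K t0 z)) holomorphic_on ball 0 R" by (simp add: o_def)
  have eq: "D z = - (z * W (K t0 z) * deriv (K t0) z)" if z: "norm z < R" for z
  proof -
    have "D z + z * W (K t0 z) * deriv (K t0) z = 0"
    proof (rule analytic_continuation[where S="ball 0 R" and U="ball 0 1" and \<xi>=0 and f="\<lambda>z. D z + z * W (K t0 z) * deriv (K t0) z"])
      have "D holomorphic_on ball 0 R"
        unfolding D_def[abs_def] R_def
        by (rule power_series_holomorphic_geometric[of _ "2 * C / \<delta>"]) (use A dA in auto)
      then show "(\<lambda>z. D z + z * W (K t0 z) * deriv (K t0) z) holomorphic_on ball 0 R"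
        using Khol WK by (intro holomorphic_intros) auto
      show "0 islimpt ball (0::complex) 1" by (intro interior_limit_point) auto
      show "D z + z * W (K t0 z) * deriv (K t0) z = 0" if "z \<in> ball 0 1" for z
      proof -
        have "norm z < 1" using that by simp
        then have "D z = - (z * W (K t0 z) * deriv (K t0) z)"
          using vector_derivative_unique_at[OF Dt pde] R by simp
        then show ?thesis by simp
      qed
    qed (use R z in auto)
    then show ?thesis by (simp add: add_eq_0_iff)
  qed
  show ?thesis
  proof (rule that[OF R Khol])
    show "((\<lambda>s. K s z) has_vector_derivative - (z * W (K t0 z) * deriv (K t0) z)) (at t0)" if "norm z < R" for z
      using Dt[OF that] eq[OF that] by simp
  qed
qed

text \<open>
  The flux when the density is \<open>Re w / pi\<close> and its Hilbert transform is \<open>- Im w / pi\<close>.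
\<close>

definition flux_density :: "real \<Rightarrow> complex \<Rightarrow> real" where
  "flux_density \<alpha> w = sin (2 * pi ^ 2 * \<alpha> * (Re w / pi)) * sinh (2 * pi ^ 2 * \<alpha> * (- Im w / pi))"

lemma flux_density_eq: "flux_density \<alpha> w = Im (cos (of_real (2 * pi * \<alpha>) * w))"
proof -
  have 1: "2 * pi ^ 2 * \<alpha> * (Re w / pi) = Re (of_real (2 * pi * \<alpha>) * w)"
    by (simp add: power2_eq_square)
  have 2: "2 * pi ^ 2 * \<alpha> * (- Im w / pi) = - Im (of_real (2 * pi * \<alpha>) * w)"
    by (simp add: power2_eq_square)
  show ?thesis unfolding flux_density_def 1 2 Im_cos sinh_def by simp
qed

text \<open>
  For \<open>z = cis (- x)\<close> the space derivative of \<open>Im (cos (2 pi \<alpha> K))\<close> and the time derivative of \<open>Re K / pi\<close>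
  are both multiples of \<open>Re (z sin (2 pi \<alpha> K) \<partial>\<^sub>z K)\<close>, since the velocity at \<open>K - 1 / 2\<close> is
  \<open>2 pi\<^sup>2 sin (2 pi \<alpha> K) / sin (pi \<alpha>)\<close>.
\<close>

lemma conservation_law_on_circle:
  fixes K :: "real \<Rightarrow> complex \<Rightarrow> complex"
  assumes R: "1 < R" and hol: "K t holomorphic_on ball 0 R" and \<alpha>: "0 < \<alpha>" "\<alpha> < 1"
    and pde: "\<And>z. norm z = 1 \<Longrightarrow> ((\<lambda>s. K s z) has_vector_derivative
       - (z * velocity \<alpha> (K t z - 1 / 2) * deriv (K t) z)) (at t)"
  shows "(\<lambda>s. Re (K s (cis (- x))) / pi) field_differentiable (at t)"
    and "(\<lambda>y. flux_density \<alpha> (K t (cis (- y)))) field_differentiable (at x)"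
    and "deriv (\<lambda>s. Re (K s (cis (- x))) / pi) t +
      1 / (\<alpha> * sin (pi * \<alpha>)) * deriv (\<lambda>y. flux_density \<alpha> (K t (cis (- y)))) x = 0"
proof -
  define z where "z = cis (- x)"
  define S where "S = sin (of_real (2 * pi * \<alpha>) * K t z)"
  define K' where "K' = deriv (K t) z"
  have s: "0 < sin (pi * \<alpha>)" using \<alpha> by (intro sin_gt_zero) auto
  have z: "norm z = 1" "z \<in> ball 0 R" using R by (auto simp: z_def)
  have vel: "velocity \<alpha> (K t z - 1 / 2) = of_real (2 * pi ^ 2 / sin (pi * \<alpha>)) * S"
    by (simp add: velocity_def S_def algebra_simps)
  have "((\<lambda>s. K s z) has_vector_derivative - (z * velocity \<alpha> (K t z - 1 / 2) * K')) (at t)"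
    using pde[OF z(1)] by (simp add: K'_def)
  then have "((\<lambda>s. Re (K s z) / pi) has_real_derivative Re (- (z * velocity \<alpha> (K t z - 1 / 2) * K')) / pi) (at t)"
    by (intro DERIV_cdivide) (simp only: has_real_derivative_iff_has_vector_derivative bounded_linear.has_vector_derivative[OF bounded_linear_Re])
  also have "Re (- (z * velocity \<alpha> (K t z - 1 / 2) * K')) / pi = - (2 * pi / sin (pi * \<alpha>)) * Re (z * S * K')"
  proof -
    have "- (z * velocity \<alpha> (K t z - 1 / 2) * K') = of_real (- (2 * pi ^ 2 / sin (pi * \<alpha>))) * (z * S * K')"
      by (simp add: vel)
    then have "Re (- (z * velocity \<alpha> (K t z - 1 / 2) * K')) = - (2 * pi ^ 2 / sin (pi * \<alpha>)) * Re (z * S * K')"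
      by (simp only: times_complex.sel Re_complex_of_real Im_complex_of_real mult_zero_left diff_zero)
    then show ?thesis by (simp add: power2_eq_square)
  qed
  finally have Dt: "((\<lambda>s. Re (K s z) / pi) has_real_derivative - (2 * pi / sin (pi * \<alpha>)) * Re (z * S * K')) (at t)" .
  have inner: "((\<lambda>y. cis (- y)) has_vector_derivative - \<i> * z) (at x)"
    unfolding z_def by (auto intro!: derivative_eq_intros simp: has_vector_derivative_def)
  have outer: "((\<lambda>w. cos (of_real (2 * pi * \<alpha>) * K t w)) has_field_derivative
      - S * (of_real (2 * pi * \<alpha>) * K')) (at z)"
    unfolding S_def K'_def using z
    by (auto intro!: derivative_eq_intros holomorphic_derivI[OF hol])
  have "((\<lambda>y. cos (of_real (2 * pi * \<alpha>) * K t (cis (- y)))) has_vector_derivative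
      (- \<i> * z) * (- S * (of_real (2 * pi * \<alpha>) * K'))) (at x)"
    using field_vector_diff_chain_at[OF inner outer[unfolded z_def]] by (simp only: o_def z_def)
  then have "((\<lambda>y. flux_density \<alpha> (K t (cis (- y)))) has_real_derivative
      Im ((- \<i> * z) * (- S * (of_real (2 * pi * \<alpha>) * K')))) (at x)"
    unfolding flux_density_eq by (simp only: has_real_derivative_iff_has_vector_derivative bounded_linear.has_vector_derivative[OF bounded_linear_Im])
  also have "Im ((- \<i> * z) * (- S * (of_real (2 * pi * \<alpha>) * K'))) = 2 * pi * \<alpha> * Re (z * S * K')"
    by (simp add: algebra_simps)
  finally have Dx: "((\<lambda>y. flux_density \<alpha> (K t (cis (- y)))) has_real_derivative 2 * pi * \<alpha> * Re (z * S * K')) (at x)" .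
  show "(\<lambda>s. Re (K s (cis (- x))) / pi) field_differentiable (at t)"
    using Dt unfolding z_def field_differentiable_def by blast
  show "(\<lambda>y. flux_density \<alpha> (K t (cis (- y)))) field_differentiable (at x)"
    using Dx unfolding field_differentiable_def by blast
  have "deriv (\<lambda>s. Re (K s (cis (- x))) / pi) t = - (2 * pi / sin (pi * \<alpha>)) * Re (z * S * K')"
    using DERIV_imp_deriv[OF Dt] by (simp add: z_def)
  moreover have "deriv (\<lambda>y. flux_density \<alpha> (K t (cis (- y)))) x = 2 * pi * \<alpha> * Re (z * S * K')"
    using DERIV_imp_deriv[OF Dx] .
  moreover have "- (2 * pi / sin (pi * \<alpha>)) * X + 1 / (\<alpha> * sin (pi * \<alpha>)) * (2 * pi * \<alpha> * X) = 0" for X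
    using \<alpha> s by (simp add: field_simps)
  ultimately show "deriv (\<lambda>s. Re (K s (cis (- x))) / pi) t +
      1 / (\<alpha> * sin (pi * \<alpha>)) * deriv (\<lambda>y. flux_density \<alpha> (K t (cis (- y)))) x = 0"
    by (simp only:)
qed

section \<open>Boundary values: density and Hilbert transform\<close>

text \<open>
  The Taylor coefficients of \<open>1 / 2 + moment_series f\<close>. The constant term \<open>1 / 2\<close> is chosen so that, for a
  density \<open>f\<close> of mass 1, the real part on the circle is \<open>pi\<close> times \<open>f\<close>.
\<close>

definition herglotz_coeff :: "(real \<Rightarrow> real) \<Rightarrow> nat \<Rightarrow> complex" where
  "herglotz_coeff f n = (if n = 0 then 1 / 2 else circle_moment f (int n))"

definition herglotz_series :: "(real \<Rightarrow> real) \<Rightarrow> complex \<Rightarrow> complex" where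
  "herglotz_series f z = (\<Sum>n. herglotz_coeff f n * z ^ n)"

text \<open>
  The sum of the Fourier series of a density \<open>f\<close> of mass 1: the point \<open>cis (- x)\<close> appears because the moments are taken
  against \<open>cis (n x)\<close>.
\<close>

definition boundary_density :: "(real \<Rightarrow> real) \<Rightarrow> real \<Rightarrow> real" where
  "boundary_density f x = Re (herglotz_series f (cis (- x))) / pi"

lemma circle_fun_boundary_density: "circle_fun (boundary_density f)"
proof -
  have "cis (- (x + 2 * pi)) = cis (- x)" for x
    by (simp add: complex_eq_iff cos_diff sin_diff)
  then show ?thesis unfolding circle_fun_def boundary_density_def by simp
qed

lemma herglotz_series_eq:
  assumes "integrable circle_measure f" "norm z < 1"
  shows "herglotz_series f z = 1 / 2 + moment_series f z"
proof -
  have "(\<lambda>n. z ^ Suc n * circle_moment f (int (Suc n))) sums moment_series f z"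
    by (rule moment_series_sums[OF assms])
  then have "(\<lambda>n. herglotz_coeff f (Suc n) * z ^ Suc n) sums moment_series f z"
    by (simp add: herglotz_coeff_def mult.commute)
  then have "(\<lambda>n. herglotz_coeff f n * z ^ n) sums (moment_series f z + herglotz_coeff f 0 * z ^ 0)"
    by (subst (asm) sums_Suc_iff) simp
  then show ?thesis unfolding herglotz_series_def by (simp add: sums_iff herglotz_coeff_def add.commute)
qed

lemma herglotz_series_sums_on_circle:
  assumes "summable (\<lambda>n. norm (herglotz_coeff f n))"
  shows "(\<lambda>n. herglotz_coeff f n * cis (- (real n * x))) sums herglotz_series f (cis (- x))"
proof -
  have eq: "herglotz_coeff f n * cis (- (real n * x)) = herglotz_coeff f n * cis (- x) ^ n" for n
    by (simp add: Complex.DeMoivre)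
  have "summable (\<lambda>n. herglotz_coeff f n * cis (- x) ^ n)"
    by (rule summable_norm_cancel) (use assms in \<open>simp add: norm_mult norm_power\<close>)
  then show ?thesis unfolding eq herglotz_series_def by (rule summable_sums)
qed

text \<open>
  Termwise integration; only the terms with index \<open>\<bar>n\<bar>\<close> contribute.
\<close>

lemma circle_moment_boundary_density:
  assumes sum: "summable (\<lambda>n. norm (herglotz_coeff f n))" and mass: "circle_moment f 0 = 1"
  shows "circle_moment (boundary_density f) n = circle_moment f n"
    and "integrable circle_measure (boundary_density f)"
proof -
  let ?a = "herglotz_coeff f"
  let ?u = "\<lambda>k x. Re (?a k * cis (- (real k * x))) / pi"
  have us: "(\<lambda>k. ?u k x) sums boundary_density f x" for x
    unfolding boundary_density_def
    by (intro sums_divide sums_Re herglotz_series_sums_on_circle sum)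
  have cont: "continuous_on UNIV (?u k)" for k by (intro continuous_intros) auto
  have um: "?u k \<in> borel_measurable circle_measure" for k by (rule continuous_measurable_circle[OF cont])
  have ub: "norm (?u k x) \<le> norm (?a k) / pi" for k x
    using abs_Re_le_cmod[of "?a k * cis (- (real k * x))"] by (simp add: norm_mult divide_right_mono)
  have bsum: "summable (\<lambda>k. norm (?a k) / pi)" using sum by (rule summable_divide)
  have uint: "integrable circle_measure (?u k)" for k
    by (rule finite_measure.integrable_const_bound[OF finite_circle_measure]) (use ub um in auto)
  have meas: "measure circle_measure {0..2 * pi} = 2 * pi" by (simp add: measure_restrict_space)
  have nint: "(LINT x|circle_measure. norm (?u k x)) \<le> 2 * norm (?a k)" for k
  proof -
    have "(LINT x|circle_measure. norm (?u k x)) \<le> (LINT x|circle_measure. norm (?a k) / pi)"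
      by (rule integral_mono[OF integrable_norm[OF uint] finite_measure.integrable_const[OF finite_circle_measure] ub])
    also have "\<dots> = 2 * norm (?a k)" by (simp add: meas)
    finally show ?thesis .
  qed
  have s1: "AE x in circle_measure. summable (\<lambda>k. norm (?u k x))"
    by (rule AE_I2, rule summable_comparison_test'[OF bsum]) (use ub in simp)
  have s2: "summable (\<lambda>k. LINT x|circle_measure. norm (?u k x))"
    by (rule summable_comparison_test'[OF summable_mult[OF sum, of 2]]) (use nint in simp)
  have eq: "(\<Sum>k. ?u k x) = boundary_density f x" for x
    by (rule sums_unique[OF us, symmetric])
  show "integrable circle_measure (boundary_density f)"
    using integrable_suminf[OF uint s1 s2] by (simp only: eq)
  let ?v = "\<lambda>k x. cis (of_int n * x) * complex_of_real (?u k x)"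
  have vint: "integrable circle_measure (?v k)" for k
  proof (rule integrable_cis_mult)
    have "integrable circle_measure (\<lambda>x. complex_of_real (h x))" if "integrable circle_measure h" for h :: "real \<Rightarrow> real"
      using that by simp
    from this[OF uint] show "integrable circle_measure (\<lambda>x. complex_of_real (?u k x))" .
  qed
  have vn: "norm (?v k x) = norm (?u k x)" for k x by (simp only: norm_mult norm_cis norm_of_real real_norm_def mult_1_left)
  have vs: "(\<lambda>k. ?v k x) sums (cis (of_int n * x) * complex_of_real (boundary_density f x))" for x
    by (intro sums_mult sums_of_real us)
  have veq: "(\<Sum>k. ?v k x) = cis (of_int n * x) * complex_of_real (boundary_density f x)" for x
    by (rule sums_unique[OF vs, symmetric])
  have "(\<lambda>k. LINT x|circle_measure. ?v k x) sums (LINT x|circle_measure. (\<Sum>k. ?v k x))"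
    using vint s1 s2 by (intro sums_integral) (simp_all only: vn)
  then have sums: "(\<lambda>k. LINT x|circle_measure. ?v k x) sums circle_moment (boundary_density f) n"
    by (simp only: veq circle_moment_alt)
  have coeff: "(LINT x|circle_measure. ?v k x) =
     (if n = int k then ?a k else 0) + (if n = - int k then cnj (?a k) else 0)" for k
  proof -
    have "?v k x = ?a k / (2 * pi) * cis (of_int (n - int k) * x) + cnj (?a k) / (2 * pi) * cis (of_int (n + int k) * x)" for x
    proof -
      have rc: "complex_of_real (Re w / pi) = (w + cnj w) / (2 * pi)" for w by (simp add: complex_eq_iff)
      have "cnj (?a k * cis (- (real k * x))) = cnj (?a k) * cis (real k * x)" by (simp add: cis_cnj)
      then have "complex_of_real (?u k x) = (?a k * cis (- (real k * x)) + cnj (?a k) * cis (real k * x)) / (2 * pi)"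
        by (simp only: rc)
      moreover have "cis (of_int (n - int k) * x) = cis (of_int n * x) * cis (- (real k * x))"
        "cis (of_int (n + int k) * x) = cis (of_int n * x) * cis (real k * x)"
        by (simp_all add: cis_mult algebra_simps)
      ultimately show ?thesis by (simp only:) (simp add: add_divide_distrib distrib_left mult_ac)
    qed
    moreover have "integrable circle_measure (\<lambda>x. cis (of_int m * x))" for m
      by (rule finite_measure.integrable_const_bound[OF finite_circle_measure, of _ 1])
         (auto intro: cis_measurable_circle)
    ultimately have "(LINT x|circle_measure. ?v k x) =
      ?a k / (2 * pi) * (LINT x|circle_measure. cis (of_int (n - int k) * x)) +
      cnj (?a k) / (2 * pi) * (LINT x|circle_measure. cis (of_int (n + int k) * x))"
      by (simp only: Bochner_Integration.integral_add integrable_mult_right integral_mult_right_zero)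
    then show ?thesis by (simp only: integral_cis_circle) (auto simp: eq_neg_iff_add_eq_0)
  qed
  have "(\<lambda>k. LINT x|circle_measure. ?v k x) sums (\<Sum>k\<in>{nat \<bar>n\<bar>}. LINT x|circle_measure. ?v k x)"
  proof (rule sums_finite)
    show "(LINT x|circle_measure. ?v k x) = 0" if "k \<notin> {nat \<bar>n\<bar>}" for k
      unfolding coeff using that by auto
  qed simp
  then have "circle_moment (boundary_density f) n = (LINT x|circle_measure. ?v (nat \<bar>n\<bar>) x)"
    using sums sums_unique2 by fastforce
  also have "\<dots> = circle_moment f n"
    unfolding coeff by (cases "n = 0"; cases "0 < n") (auto simp: herglotz_coeff_def mass circle_moment_cnj[of f n, symmetric] simp flip: circle_moment_cnj)
  finally show "circle_moment (boundary_density f) n = circle_moment f n" .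
qed

lemma AE_eq_boundary_density:
  assumes f: "integrable circle_measure f" "circle_fun f"
    and sum: "summable (\<lambda>n. norm (herglotz_coeff f n))" and mass: "circle_moment f 0 = 1"
  shows "AE x in lebesgue. boundary_density f x = f x"
proof -
  note F = circle_moment_boundary_density[OF sum mass]
  have "AE x in lebesgue. x \<in> {0..2 * pi} \<longrightarrow> boundary_density f x - f x = 0"
    by (rule AE_zero_if_moments_zero) (use F f in \<open>auto simp: circle_moment_diff\<close>)
  then have "AE x in lebesgue. boundary_density f x - f x = 0"
    using f(2) circle_fun_boundary_density[of f]
    by (intro AE_zero_if_AE_zero_on_period) (auto simp: circle_fun_def)
  then show ?thesis by simp
qed

text \<open>
  The terms of index \<open>n\<close> and \<open>- n\<close> are complex conjugate, and those of negative index add up to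
  \<open>i / (2 pi)\<close> times the Herglotz series without its constant term.
\<close>

lemma hilbert_transform_boundary_density:
  assumes sum: "summable (\<lambda>n. norm (herglotz_coeff f n))" and mass: "circle_moment f 0 = 1"
  shows "has_hilbert_transform (boundary_density f) (\<lambda>x. - Im (herglotz_series f (cis (- x))) / pi)"
  unfolding has_hilbert_transform_def
proof
  fix x
  let ?a = "herglotz_coeff f"
  define t where "t n = - \<i> * of_int (sgn n) * (circle_moment (boundary_density f) (- n) / of_real (2 * pi)) * cis (of_int n * x)" for n :: int
  define u where "u k = \<i> / (2 * pi) * (?a (Suc k) * cis (- (real (Suc k) * x)))" for k
  define U where "U = \<i> / (2 * pi) * (herglotz_series f (cis (- x)) - 1 / 2)"
  have "(\<lambda>n. ?a n * cis (- (real n * x))) sums herglotz_series f (cis (- x))"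
    by (rule herglotz_series_sums_on_circle[OF sum])
  then have "(\<lambda>n. ?a (Suc n) * cis (- (real (Suc n) * x))) sums (herglotz_series f (cis (- x)) - 1 / 2)"
    by (subst sums_Suc_iff) (simp add: herglotz_coeff_def)
  then have "u sums U" unfolding u_def U_def by (rule sums_mult)
  moreover have "summable (\<lambda>k. norm (u k))"
  proof -
    have "summable (\<lambda>k. norm (\<i> / (2 * pi)) * norm (?a (Suc k)))"
      using sum summable_Suc_iff[of "\<lambda>n. norm (herglotz_coeff f n)"] by (intro summable_mult) simp
    then show ?thesis by (simp only: u_def norm_mult norm_cis mult_1_right)
  qed
  ultimately have u: "(u has_sum U) UNIV" by (intro norm_summable_imp_has_sum)
  have tneg: "t (- int (Suc k)) = u k" for k
    by (simp add: t_def u_def circle_moment_boundary_density[OF sum mass] herglotz_coeff_def algebra_simps del: of_nat_Suc)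
  have tpos: "t (int (Suc k)) = cnj (u k)" for k
    by (simp add: t_def u_def circle_moment_boundary_density[OF sum mass] herglotz_coeff_def circle_moment_cnj cis_cnj algebra_simps del: of_nat_Suc)
  have 1: "(t has_sum U) (range (\<lambda>k. - int (Suc k)))"
    by (subst has_sum_reindex) (use u in \<open>auto simp: inj_on_def o_def tneg simp del: of_nat_Suc\<close>)
  have "((\<lambda>k. cnj (u k)) has_sum cnj U) UNIV"
    using u by (rule has_sum_bounded_linear[OF bounded_linear_cnj])
  then have 2: "(t has_sum cnj U) (range (\<lambda>k. int (Suc k)))"
    by (subst has_sum_reindex) (auto simp: inj_on_def o_def tpos simp del: of_nat_Suc)
  have "(t has_sum (U + cnj U)) (range (\<lambda>k. - int (Suc k)) \<union> range (\<lambda>k. int (Suc k)))"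
    by (rule has_sum_Un_disjoint[OF 1 2]) auto
  moreover have "t n = 0" if "n \<in> UNIV - (range (\<lambda>k. - int (Suc k)) \<union> range (\<lambda>k. int (Suc k)))" for n
  proof -
    have "n = 0"
    proof (rule ccontr)
      assume "n \<noteq> 0"
      then consider "0 < n" | "n < 0" by linarith
      then show False
      proof cases
        case 1
        then have "n = int (Suc (nat n - 1))" by simp
        then show False using that by blast
      next
        case 2
        then have "n = - int (Suc (nat (- n) - 1))" by simp
        then show False using that by blast
      qed
    qed
    then show ?thesis by (simp add: t_def)
  qed
  ultimately have "(t has_sum (U + cnj U)) UNIV"
    using has_sum_cong_neutral[of UNIV "range (\<lambda>k. - int (Suc k)) \<union> range (\<lambda>k. int (Suc k))" t t] by blast
  moreover have "U + cnj U = of_real (- Im (herglotz_series f (cis (- x))) / pi)"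
    by (simp add: U_def complex_eq_iff field_simps)
  ultimately show "((\<lambda>n. - \<i> * of_int (sgn n) * (circle_moment (boundary_density f) (- n) / of_real (2 * pi)) * cis (of_int n * x))
      has_sum of_real (- Im (herglotz_series f (cis (- x))) / pi)) UNIV"
    by (simp add: t_def[abs_def])
qed

section \<open>Regularity of weak solutions\<close>

lemma exclusion_profile_integrable:
  assumes "exclusion_profile \<alpha> f"
  shows "integrable circle_measure f" "circle_fun f" "circle_moment f 0 = 1"
proof -
  have d: "density_profile f" using assms by (simp add: exclusion_profile_def)
  have "AE x in lebesgue. 0 \<le> f x \<and> f x \<le> 1 / (2 * pi * \<alpha>)"
    using assms by (auto simp: exclusion_profile_def density_profile_def)
  then show "integrable circle_measure f"
    using d by (intro integrable_circle_if_bounded) (auto simp: density_profile_def)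
  show "circle_fun f" using d by (simp add: density_profile_def)
  show "circle_moment f 0 = 1" by (simp add: circle_moment_zero density_profile_mass[OF d])
qed

lemma norm_circle_moment_le_1:
  assumes "exclusion_profile \<alpha> f"
  shows "norm (circle_moment f n) \<le> 1"
proof -
  have d: "density_profile f" using assms by (simp add: exclusion_profile_def)
  have "(LINT x|circle_measure. \<bar>f x\<bar>) = (LINT x|circle_measure. f x)"
  proof (rule integral_cong_AE)
    have "AE x in lebesgue. 0 \<le> f x" using d by (simp add: density_profile_def)
    from AE_circleI[OF this] show "AE x in circle_measure. \<bar>f x\<bar> = f x" by eventually_elim auto
  qed (use exclusion_profile_integrable(1)[OF assms] in auto)
  then show ?thesis
    using norm_circle_moment_le[OF exclusion_profile_integrable(1)[OF assms], of n] density_profile_mass[OF d] by simp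
qed

lemma moment_power_series:
  assumes "integrable circle_measure f" "norm z < 1"
  shows "(\<lambda>n. (if n = 0 then 0 else circle_moment f (int n)) * z ^ n) sums moment_series f z"
proof -
  have "(\<lambda>n. (if Suc n = 0 then 0 else circle_moment f (int (Suc n))) * z ^ Suc n) sums moment_series f z"
    using moment_series_sums[OF assms] by (simp add: mult.commute)
  then show ?thesis by (subst (asm) sums_Suc_iff) simp
qed

lemma moment_series_holomorphic:
  assumes "integrable circle_measure f"
  shows "moment_series f holomorphic_on ball 0 1"
  by (rule power_series_holomorphic[where a="\<lambda>n. if n = 0 then 0 else circle_moment f (int n)"])
     (use moment_power_series[OF assms] in simp)

lemma norm_moment_series_le:
  assumes f: "exclusion_profile \<alpha> f" and z: "norm z \<le> r" "r < 1"
  shows "norm (moment_series f z) \<le> 1 / (1 - r)"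
proof -
  have z1: "norm z < 1" using z by simp
  have r0: "0 \<le> r" using z(1) norm_ge_zero order_trans by blast
  have geo: "(\<lambda>n. r ^ n) sums (1 / (1 - r))" using r0 z by (intro geometric_sums) auto
  have "norm (\<Sum>n. (if n = 0 then 0 else circle_moment f (int n)) * z ^ n) \<le> (\<Sum>n. r ^ n)"
  proof (rule norm_suminf_le)
    show "norm ((if n = 0 then 0 else circle_moment f (int n)) * z ^ n) \<le> r ^ n" for n
      using mult_mono[OF norm_circle_moment_le_1[OF f, of "int n"] power_mono[OF z(1), of n]] r0
      by (auto simp: norm_mult norm_power)
  qed (use geo in \<open>auto simp: sums_iff\<close>)
  then show ?thesis
    using moment_power_series[OF exclusion_profile_integrable(1)[OF f] z1] geo by (simp add: sums_iff)
qed

text \<open>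
  Cauchy's formula for the Taylor coefficients of the derivative.
\<close>

lemma circle_integral_deriv_moment_series:
  assumes f: "integrable circle_measure f" and n: "0 < n" and r: "0 < r" "r < 1"
  shows "contour_integral (circlepath 0 r) (\<lambda>z. deriv (moment_series f) z / z ^ n) =
    2 * pi * \<i> * of_nat n * circle_moment f (int n)"
proof -
  obtain k where k: "n = Suc k" using n by (cases n) auto
  let ?F = "Abs_fps (\<lambda>n. if n = 0 then 0 else circle_moment f (int n))"
  have "moment_series f has_fps_expansion ?F"
  proof (rule has_fps_expansionI)
    have "eventually (\<lambda>z::complex. z \<in> ball 0 1) (nhds 0)" by (intro eventually_nhds_in_open) auto
    then show "eventually (\<lambda>z. (\<lambda>n. fps_nth ?F n * z ^ n) sums moment_series f z) (nhds 0)"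
      by eventually_elim (use moment_power_series[OF f] in simp)
  qed
  then have "fps_nth ?F n = (deriv ^^ n) (moment_series f) 0 / fact n"
    by (rule fps_nth_fps_expansion)
  then have coeff: "(deriv ^^ k) (deriv (moment_series f)) 0 = fact n * circle_moment f (int n)"
    by (simp add: k funpow_Suc_right del: funpow.simps of_nat_Suc)
  have hol: "deriv (moment_series f) holomorphic_on ball 0 1"
    by (rule holomorphic_deriv[OF moment_series_holomorphic[OF f] open_ball])
  have "((\<lambda>u. deriv (moment_series f) u / (u - 0) ^ Suc k) has_contour_integral
      ((2 * pi * \<i>) / fact k * (deriv ^^ k) (deriv (moment_series f)) 0)) (circlepath 0 r)"
  proof (rule Cauchy_has_contour_integral_higher_derivative_circlepath)
    show "continuous_on (cball 0 r) (deriv (moment_series f))"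
      by (rule holomorphic_on_imp_continuous_on, rule holomorphic_on_subset[OF hol]) (use r in auto)
    show "deriv (moment_series f) holomorphic_on ball 0 r" by (rule holomorphic_on_subset[OF hol]) (use r in auto)
  qed (use r in auto)
  from contour_integral_unique[OF this]
  have "contour_integral (circlepath 0 r) (\<lambda>z. deriv (moment_series f) z / z ^ n) =
     2 * pi * \<i> / fact k * (fact n * circle_moment f (int n))"
    unfolding coeff by (simp only: k diff_zero)
  also have "\<dots> = 2 * pi * \<i> * of_nat n * circle_moment f (int n)"
    by (simp add: k fact_Suc del: of_nat_Suc)
  finally show ?thesis .
qed

lemma weak_solution_exclusion_profile:
  "weak_solution \<alpha> f0 f \<Longrightarrow> 0 \<le> t \<Longrightarrow> exclusion_profile \<alpha> (f t)"
  unfolding weak_solution_def by blast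

lemma weak_solution_initial:
  assumes "weak_solution \<alpha> f0 f" "norm z < 1"
  shows "moment_series (f 0) z = moment_series f0 z"
proof -
  obtain g where "disk_solution \<alpha> (moment_series f0) g" "\<forall>t\<ge>0. \<forall>z\<in>ball 0 1. g t z = moment_series (f t) z"
    using assms unfolding weak_solution_def by blast
  then show ?thesis using assms(2) unfolding disk_solution_def by simp
qed

lemma weak_solution_transport:
  assumes w: "weak_solution \<alpha> f0 f"
  shows "transport_solution (velocity \<alpha>) (\<lambda>s. moment_series (f s))"
proof
  obtain g where g: "disk_solution \<alpha> (moment_series f0) g" "\<And>t z. 0 \<le> t \<Longrightarrow> z \<in> ball 0 1 \<Longrightarrow> g t z = moment_series (f t) z"
    using w unfolding weak_solution_def by blast
  note ex = weak_solution_exclusion_profile[OF w]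
  show "velocity \<alpha> holomorphic_on UNIV" by (rule velocity_holomorphic)
  show "moment_series (f s) holomorphic_on ball 0 1" if "0 \<le> s" for s
    by (rule moment_series_holomorphic[OF exclusion_profile_integrable(1)[OF ex[OF that]]])
  show "\<exists>B. \<forall>s\<ge>0. \<forall>z\<in>cball 0 r. norm (moment_series (f s) z) \<le> B" if "r < 1" for r
    using norm_moment_series_le[OF ex _ that] by (intro exI[of _ "1 / (1 - r)"]) simp
  fix s :: real and z :: complex assume s: "0 \<le> s" and z: "z \<in> ball 0 1"
  have "deriv (g s) z = deriv (moment_series (f s)) z"
  proof (rule deriv_cong_ev)
    have "eventually (\<lambda>w. w \<in> ball 0 1) (nhds z)" using z by (intro eventually_nhds_in_open) auto
    then show "eventually (\<lambda>w. g s w = moment_series (f s) w) (nhds z)"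
      by eventually_elim (use g(2) s in simp)
  qed simp
  moreover have "((\<lambda>s. g s z) has_vector_derivative - (z * velocity \<alpha> (g s z) * deriv (g s) z)) (at s within {0..})"
    using g(1) s z unfolding disk_solution_def by blast
  ultimately have "((\<lambda>s. g s z) has_vector_derivative
     - (z * velocity \<alpha> (moment_series (f s) z) * deriv (moment_series (f s)) z)) (at s within {0..})"
    using g(2)[OF s z] by simp
  then show "((\<lambda>s. moment_series (f s) z) has_vector_derivative
     - (z * velocity \<alpha> (moment_series (f s) z) * deriv (moment_series (f s)) z)) (at s within {0..})"
    by (rule has_vector_derivative_transform[rotated 2]) (use s z g(2) in auto)
qed

lemma circle_moment_eq_moment_extension:
  assumes w: "weak_solution \<alpha> f0 f" and r: "0 < r" "r < 1" and t: "0 \<le> t" and n: "0 < n"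
  shows "transport_solution.moment_extension (velocity \<alpha>) (\<lambda>s. moment_series (f s)) r n (of_real t) = circle_moment (f t) (int n)"
proof -
  interpret transport_solution "velocity \<alpha>" "\<lambda>s. moment_series (f s)" by (rule weak_solution_transport[OF w])
  show ?thesis
    unfolding moment_extension_of_real[OF r t]
    using circle_integral_deriv_moment_series[OF exclusion_profile_integrable(1)[OF weak_solution_exclusion_profile[OF w t]] n r] n
    by simp
qed

text \<open>
  Analyticity at time \<open>t0\<close> needs a lower bound \<open>c\<close> of the real part of the initial velocity on some disk
  of radius \<open>\<rho>\<close> and a time with \<open>\<rho> exp (c t0) > 1\<close>: points near the boundary of that disk have then
  been carried beyond the unit circle.
\<close>

lemma analytic_coefficients_weak_solution:
  assumes w: "weak_solution \<alpha> f0 f"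
    and \<rho>: "0 < \<rho>" "\<rho> \<le> 1" and c: "0 < c" "\<And>z. norm z < \<rho> \<Longrightarrow> c \<le> Re (velocity \<alpha> (moment_series f0 z))"
    and t0: "0 < t0" "1 < \<rho> * exp (c * t0)"
  shows "analytic_coefficients_at t0 (\<lambda>t. herglotz_coeff (f t))"
proof -
  interpret transport_solution "velocity \<alpha>" "\<lambda>s. moment_series (f s)" by (rule weak_solution_transport[OF w])
  have c': "c \<le> Re (velocity \<alpha> (moment_series (f 0) z))" if "norm z < \<rho>" for z
    using c(2)[OF that] weak_solution_initial[OF w, of z] that \<rho> by simp
  obtain r \<delta> C q where r: "0 < r" "r < 1" and \<delta>: "0 < \<delta>" "\<delta> \<le> t0" and C: "0 < C" and q: "0 < q" "q < 1"
    and decay: "\<And>n \<tau>. 0 < n \<Longrightarrow> \<tau> \<in> ball (of_real t0) \<delta> \<Longrightarrow> norm (moment_extension r n \<tau>) \<le> C * q ^ n"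
    using moment_extension_geometric_decay[OF \<rho> c(1) c' t0] by metis
  define A where "A n \<tau> = (if n = 0 then 1 / 2 else moment_extension r n \<tau>)" for n \<tau>
  show ?thesis unfolding analytic_coefficients_at_def
  proof (rule exI[of _ A], rule exI[of _ \<delta>], rule exI[of _ "max C 1"], rule exI[of _ q],
      intro conjI allI impI ballI)
    show "A n holomorphic_on ball (of_real t0) \<delta>" for n
      unfolding A_def[abs_def]
      by (cases "n = 0") (auto intro: holomorphic_on_subset[OF moment_extension_holomorphic[OF r]])
    show "norm (A n \<tau>) \<le> max C 1 * q ^ n" if "\<tau> \<in> ball (of_real t0) \<delta>" for n \<tau>
    proof (cases "n = 0")
      case True
      have "1 / 2 \<le> max C 1" by simp
      then show ?thesis using True by (simp add: A_def norm_divide)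
    next
      case False
      then have "norm (A n \<tau>) \<le> C * q ^ n" using decay[of n \<tau>] that by (simp add: A_def)
      also have "\<dots> \<le> max C 1 * q ^ n" using q by (intro mult_right_mono) auto
      finally show ?thesis .
    qed
    show "A n (of_real t) = herglotz_coeff (f t) n" if "\<bar>t - t0\<bar> < \<delta>" for n t
      using that \<delta> circle_moment_eq_moment_extension[OF w r, of t n] by (simp add: A_def herglotz_coeff_def)
  qed (use \<delta> C q in auto)
qed

lemma herglotz_coeff_summable:
  assumes "analytic_coefficients_at t (\<lambda>t. herglotz_coeff (f t))"
  shows "summable (\<lambda>n. norm (herglotz_coeff (f t) n))"
proof -
  obtain C q where "0 < C" "0 < q" "q < 1" "\<And>n. norm (herglotz_coeff (f t) n) \<le> C * q ^ n"
    using analytic_coefficients_at_decay[OF assms] by metis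
  then show ?thesis using summable_geometric_bound[of "herglotz_coeff (f t)" C q 1] by simp
qed

lemma boundary_density_jointly_analytic:
  assumes "\<And>t. T < t \<Longrightarrow> analytic_coefficients_at t (\<lambda>t. herglotz_coeff (f t))"
  shows "jointly_analytic_on (\<lambda>t. boundary_density (f t)) ({T<..} \<times> UNIV)"
  unfolding jointly_analytic_on_def
proof safe
  fix t0 x0 :: real assume t0: "T < t0"
  from assms[OF t0] obtain A \<delta> C q where A: "0 < \<delta>" "0 < C" "0 < q" "q < 1"
    "\<And>n. A n holomorphic_on ball (of_real t0) \<delta>"
    "\<And>n \<tau>. \<tau>\<in>ball (of_real t0) \<delta> \<Longrightarrow> norm (A n \<tau>) \<le> C * q ^ n"
    "\<And>n t. \<bar>t - t0\<bar> < \<delta> \<Longrightarrow> A n (complex_of_real t) = herglotz_coeff (f t) n"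
    unfolding analytic_coefficients_at_def by blast
  have "\<exists>c r. 0 < r \<and> (\<forall>t x. \<bar>t - t0\<bar> < r \<and> \<bar>x - x0\<bar> < r \<longrightarrow>
    ((\<lambda>(m, k). c m k * (t - t0) ^ m * (x - x0) ^ k) has_sum (\<Sum>n. Re (A n (of_real t) / pi * cis (- (real n * x))))) UNIV)"
  proof (rule fourier_sum_real_analytic[where \<delta>=\<delta> and C="C / pi" and q=q])
    show "(\<lambda>\<tau>. A n \<tau> / pi) holomorphic_on ball (of_real t0) \<delta>" for n
      using A(5) by (intro holomorphic_intros) auto
    show "norm (A n \<tau> / pi) \<le> C / pi * q ^ n" if "\<tau> \<in> ball (of_real t0) \<delta>" for n \<tau>
      using divide_right_mono[OF A(6)[OF that, of n], of pi] by (simp add: norm_divide)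
  qed (use A in auto)
  then obtain c r where r: "0 < r" and c: "\<And>t x. \<bar>t - t0\<bar> < r \<Longrightarrow> \<bar>x - x0\<bar> < r \<Longrightarrow>
    ((\<lambda>(m, k). c m k * (t - t0) ^ m * (x - x0) ^ k) has_sum (\<Sum>n. Re (A n (of_real t) / pi * cis (- (real n * x))))) UNIV"
    by blast
  have eq: "(\<Sum>n. Re (A n (of_real t) / pi * cis (- (real n * x)))) = boundary_density (f t) x"
    if t: "T < t" "\<bar>t - t0\<bar> < \<delta>" for t x
  proof -
    have "(\<lambda>n. herglotz_coeff (f t) n * cis (- (real n * x))) sums herglotz_series (f t) (cis (- x))"
      by (rule herglotz_series_sums_on_circle[OF herglotz_coeff_summable[OF assms[OF t(1)]]])
    then have "(\<lambda>n. Re (herglotz_coeff (f t) n * cis (- (real n * x))) / pi) sums boundary_density (f t) x"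
      unfolding boundary_density_def by (intro sums_divide sums_Re)
    moreover have "Re (herglotz_coeff (f t) n * cis (- (real n * x))) / pi = Re (A n (of_real t) / pi * cis (- (real n * x)))" for n
    proof -
      have "A n (of_real t) / pi * cis (- (real n * x)) = (A n (of_real t) * cis (- (real n * x))) / of_real pi" by simp
      then show ?thesis using A(7)[OF t(2), of n] by (simp only: Re_divide_of_real)
    qed
    ultimately show ?thesis by (simp only: sums_iff)
  qed
  show "\<exists>c r. 0 < r \<and> (\<forall>t x. (t, x) \<in> {T<..} \<times> UNIV \<and> \<bar>t - t0\<bar> < r \<and> norm (x - x0) < r \<longrightarrow>
     ((\<lambda>(m, n). c m n * of_real (t - t0) ^ m * (x - x0) ^ n) has_sum boundary_density (f t) x) UNIV)"
  proof (intro exI[of _ c] exI[of _ "min r \<delta>"] conjI allI impI)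
    fix t x assume "(t, x) \<in> {T<..} \<times> UNIV \<and> \<bar>t - t0\<bar> < min r \<delta> \<and> norm (x - x0) < min r \<delta>"
    then show "((\<lambda>(m, n). c m n * of_real (t - t0) ^ m * (x - x0) ^ n) has_sum boundary_density (f t) x) UNIV"
      using c[of t x] eq[of t x] by simp
  qed (use r A in auto)
qed

lemma analytic_strong_solution:
  assumes \<alpha>: "0 < \<alpha>" "\<alpha> < 1" and w: "weak_solution \<alpha> f0 f" and T: "0 \<le> T"
    and coeff: "\<And>t. T < t \<Longrightarrow> analytic_coefficients_at t (\<lambda>t. herglotz_coeff (f t))"
  shows "analytic_strong_after \<alpha> T f"
  unfolding analytic_strong_after_def
proof (intro exI[of _ "\<lambda>t. boundary_density (f t)"] conjI allI impI)
  note ex = exclusion_profile_integrable[OF weak_solution_exclusion_profile[OF w]]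
  note sum = herglotz_coeff_summable[OF coeff]
  show "circle_fun (boundary_density (f t))" for t by (rule circle_fun_boundary_density)
  show "AE x in lebesgue. boundary_density (f t) x = f t x" if "T < t" for t
    using T that by (intro AE_eq_boundary_density ex sum) auto
  show "jointly_analytic_on (\<lambda>t. boundary_density (f t)) ({T<..} \<times> UNIV)"
    by (rule boundary_density_jointly_analytic[OF coeff])
  interpret transport_solution "velocity \<alpha>" "\<lambda>s. moment_series (f s)" by (rule weak_solution_transport[OF w])
  show "strong_solution_after \<alpha> T (\<lambda>t. boundary_density (f t))"
    unfolding strong_solution_after_def
  proof (intro exI[of _ "\<lambda>t x. - Im (herglotz_series (f t) (cis (- x))) / pi"] allI impI conjI)
    fix t assume t: "T < t"
    then have t0: "0 < t" using T by simp
    show "has_hilbert_transform (boundary_density (f t)) (\<lambda>x. - Im (herglotz_series (f t) (cis (- x))) / pi)"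
      using t0 by (intro hilbert_transform_boundary_density sum t ex) auto
    fix x
    have hs: "herglotz_series (f s) z = 1 / 2 + moment_series (f s) z" if "0 \<le> s" "norm z < 1" for s z
      by (rule herglotz_series_eq[OF ex(1)[OF that(1)] that(2)])
    have pde_disk: "((\<lambda>s. herglotz_series (f s) z) has_vector_derivative
      - (z * velocity \<alpha> (herglotz_series (f t) z - 1 / 2) * deriv (herglotz_series (f t)) z)) (at t)"
      if z: "norm z < 1" for z
    proof -
      have z': "z \<in> ball 0 1" using z by simp
      have "deriv (herglotz_series (f t)) z = deriv (\<lambda>z. 1 / 2 + moment_series (f t) z) z"
      proof (rule deriv_cong_ev)
        have "eventually (\<lambda>w. w \<in> ball 0 1) (nhds z)" using z' by (intro eventually_nhds_in_open) auto
        then show "eventually (\<lambda>w. herglotz_series (f t) w = 1 / 2 + moment_series (f t) w) (nhds z)"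
          by eventually_elim (use hs t0 in simp)
      qed simp
      also have "\<dots> = deriv (moment_series (f t)) z"
        using holomorphic_on_imp_differentiable_at[OF hol[OF less_imp_le[OF t0]] open_ball z']
        by (subst deriv_add) auto
      finally have d: "deriv (herglotz_series (f t)) z = deriv (moment_series (f t)) z" .
      have "at t within {0..} = at t" using t0 by (intro at_within_interior) simp
      then have "((\<lambda>s. moment_series (f s) z) has_vector_derivative
         - (z * velocity \<alpha> (moment_series (f t) z) * deriv (moment_series (f t)) z)) (at t)"
        using pde[OF less_imp_le[OF t0] z'] by simp
      from has_vector_derivative_add[OF has_vector_derivative_const[of "1 / 2"] this]
      have "((\<lambda>s. 1 / 2 + moment_series (f s) z) has_vector_derivative
         - (z * velocity \<alpha> (moment_series (f t) z) * deriv (moment_series (f t)) z)) (at t)" by simp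
      then have "((\<lambda>s. herglotz_series (f s) z) has_vector_derivative
         - (z * velocity \<alpha> (moment_series (f t) z) * deriv (moment_series (f t)) z)) (at t)"
        by (rule has_vector_derivative_transform_within_open[where S="{0<..}"]) (use t0 hs z in auto)
      then show ?thesis using d hs[OF less_imp_le[OF t0] z] by simp
    qed
    have W: "(\<lambda>w. velocity \<alpha> (w - 1 / 2)) holomorphic_on UNIV"
      unfolding velocity_def divide_inverse by (intro holomorphic_intros)
    obtain R where R: "1 < R" "herglotz_series (f t) holomorphic_on ball 0 R"
      "\<And>z. norm z < R \<Longrightarrow> ((\<lambda>s. herglotz_series (f s) z) has_vector_derivative
      - (z * velocity \<alpha> (herglotz_series (f t) z - 1 / 2) * deriv (herglotz_series (f t)) z)) (at t)"
    proof (rule equation_extends_across_circle[OF coeff[OF t] W])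
      show "((\<lambda>s. \<Sum>n. herglotz_coeff (f s) n * z ^ n) has_vector_derivative
        - (z * velocity \<alpha> ((\<Sum>n. herglotz_coeff (f t) n * z ^ n) - 1 / 2) * deriv (\<lambda>z. \<Sum>n. herglotz_coeff (f t) n * z ^ n) z)) (at t)"
        if "norm z < 1" for z
        using pde_disk[OF that] unfolding herglotz_series_def[abs_def] .
    qed (auto simp: herglotz_series_def[abs_def])
    note law = conservation_law_on_circle[where K="\<lambda>s. herglotz_series (f s)", OF R(1,2) \<alpha>]
    have pdeR: "((\<lambda>s. herglotz_series (f s) z) has_vector_derivative
      - (z * velocity \<alpha> (herglotz_series (f t) z - 1 / 2) * deriv (herglotz_series (f t)) z)) (at t)" if "norm z = 1" for z
      using R that by simp
    show "let flux = \<lambda>y. sin (2 * pi\<^sup>2 * \<alpha> * boundary_density (f t) y) * sinh (2 * pi\<^sup>2 * \<alpha> * (- Im (herglotz_series (f t) (cis (- y))) / pi))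
      in (\<lambda>s. boundary_density (f s) x) field_differentiable (at t) \<and> flux field_differentiable (at x) \<and>
         deriv (\<lambda>s. boundary_density (f s) x) t + 1 / (\<alpha> * sin (pi * \<alpha>)) * deriv flux x = 0"
      using law[OF pdeR, where x=x] unfolding Let_def boundary_density_def flux_density_def by blast
  qed
qed

section \<open>Relaxation to equilibrium\<close>

text \<open>
  On the fixed circle of radius \<open>1 / 4\<close> the moments satisfy \<open>\<bar>m\<^sub>n(t)\<bar> \<le> C (4 exp (- c t))\<^sup>n\<close>; the sum over
  \<open>n \<ge> 1\<close> decays like its first term.
\<close>

lemma sup_norm_decay:
  assumes w: "weak_solution \<alpha> f0 f" and c: "0 < c" "\<And>z. norm z < 1 / 2 \<Longrightarrow> c \<le> Re (velocity \<alpha> (moment_series f0 z))"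
  obtains D t1 where "0 < D" "\<And>t. t1 \<le> t \<Longrightarrow> sup_norm (\<lambda>x. f t x - 1 / (2 * pi)) \<le> ereal (D * exp (- (c * t)))"
proof -
  interpret transport_solution "velocity \<alpha>" "\<lambda>s. moment_series (f s)" by (rule weak_solution_transport[OF w])
  obtain B M where B: "0 < B" "\<And>z. norm z = 1 / 4 \<Longrightarrow> norm (deriv (moment_series (f 0)) z) \<le> B"
    "\<And>z. norm z = 1 / 4 \<Longrightarrow> norm (velocity \<alpha> (moment_series (f 0) z)) \<le> M"
    by (rule obtain_circle_bounds[of "1 / 4"], simp, simp) blast
  have c': "c \<le> Re (velocity \<alpha> (moment_series (f 0) z))" if "norm z = 1 / 4" for z
    using c(2)[of z] weak_solution_initial[OF w, of z] that by simp
  have mom: "norm (circle_moment (f t) (int n)) \<le> 1 / 4 * B * (4 * exp (- (c * t))) ^ n" if t: "0 \<le> t" and n: "0 < n" for t n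
  proof -
    have "norm (moment_extension (1 / 4) n (of_real t)) \<le> 1 / 4 * B * (exp (M * \<bar>Im (of_real t)\<bar> - c * Re (of_real t)) / (1 / 4)) ^ n"
      by (rule norm_moment_extension_le) (use n t B c' in auto)
    then show ?thesis using circle_moment_eq_moment_extension[OF w, of "1 / 4" t n] t n by (simp add: mult.commute)
  qed
  \<comment> \<open>after this time the ratio \<open>4 * exp (- (c * t))\<close> is at most \<open>1 / 4\<close>\<close>
  define t1 where "t1 = ln 16 / c"
  have t1: "0 < t1" using c by (simp add: t1_def)
  have small: "4 * exp (- (c * t)) \<le> 1 / 4" if "t1 \<le> t" for t
  proof -
    have "ln 16 \<le> c * t" using that c by (simp add: t1_def field_simps)
    then have "exp (ln 16) \<le> exp (c * t)" by (subst exp_le_cancel_iff)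
    then show ?thesis by (simp add: exp_minus field_simps)
  qed
  have "\<bar>boundary_density (f t) x - 1 / (2 * pi)\<bar> \<le> 2 * B * exp (- (c * t)) / pi"
    and "AE x in lebesgue. boundary_density (f t) x = f t x" if t: "t1 \<le> t" for t x
  proof -
    have t0: "0 \<le> t" using t t1 by simp
    let ?q = "4 * exp (- (c * t))"
    have q: "0 < ?q" "?q \<le> 1 / 4" using small[OF t] by auto
    have geo: "(\<lambda>n. 1 / 4 * B * ?q ^ Suc n) sums (1 / 4 * B * (?q * (1 / (1 - ?q))))"
      unfolding power_Suc using q by (intro sums_mult geometric_sums) auto
    have coeff: "norm (herglotz_coeff (f t) (Suc n)) \<le> 1 / 4 * B * ?q ^ Suc n" for n
      using mom[OF t0, of "Suc n"] by (simp add: herglotz_coeff_def del: of_nat_Suc power_Suc)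
    have "summable (\<lambda>n. norm (herglotz_coeff (f t) (Suc n)))"
      by (rule summable_comparison_test'[OF sums_summable[OF geo]]) (use coeff in simp)
    then have sum: "summable (\<lambda>n. norm (herglotz_coeff (f t) n))"
      using summable_Suc_iff[of "\<lambda>n. norm (herglotz_coeff (f t) n)"] by simp
    show "AE x in lebesgue. boundary_density (f t) x = f t x"
      using exclusion_profile_integrable[OF weak_solution_exclusion_profile[OF w t0]] by (intro AE_eq_boundary_density sum)
    have "(\<lambda>n. herglotz_coeff (f t) (Suc n) * cis (- (real (Suc n) * x))) sums (herglotz_series (f t) (cis (- x)) - 1 / 2)"
      using herglotz_series_sums_on_circle[OF sum, of x] by (subst sums_Suc_iff) (simp add: herglotz_coeff_def)
    then have "norm (herglotz_series (f t) (cis (- x)) - 1 / 2) = norm (\<Sum>n. herglotz_coeff (f t) (Suc n) * cis (- (real (Suc n) * x)))"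
      by (simp add: sums_iff)
    also have "\<dots> \<le> (\<Sum>n. 1 / 4 * B * ?q ^ Suc n)"
      by (rule norm_suminf_le[OF _ sums_summable[OF geo]]) (use coeff in \<open>simp add: norm_mult\<close>)
    also have "\<dots> = 1 / 4 * B * (?q * (1 / (1 - ?q)))" using geo by (simp add: sums_iff)
    also have "\<dots> \<le> 1 / 4 * B * (?q * 2)"
      using q B by (intro mult_left_mono) (auto simp: field_simps)
    also have "\<dots> = 2 * B * exp (- (c * t))" by simp
    finally have le: "norm (herglotz_series (f t) (cis (- x)) - 1 / 2) \<le> 2 * B * exp (- (c * t))" .
    have "boundary_density (f t) x - 1 / (2 * pi) = Re (herglotz_series (f t) (cis (- x)) - 1 / 2) / pi"
      by (simp add: boundary_density_def diff_divide_distrib)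
    then have "\<bar>boundary_density (f t) x - 1 / (2 * pi)\<bar> = \<bar>Re (herglotz_series (f t) (cis (- x)) - 1 / 2)\<bar> / pi"
      by simp
    also have "\<dots> \<le> 2 * B * exp (- (c * t)) / pi"
      by (rule divide_right_mono[OF order_trans[OF abs_Re_le_cmod le]]) simp
    finally show "\<bar>boundary_density (f t) x - 1 / (2 * pi)\<bar> \<le> 2 * B * exp (- (c * t)) / pi" .
  qed
  note bd = this
  show ?thesis
  proof (rule that[of "2 * B / pi" t1])
    fix t assume t: "t1 \<le> t"
    have "density_profile (f t)"
      using weak_solution_exclusion_profile[OF w, of t] t t1 by (simp add: exclusion_profile_def)
    then have m: "f t \<in> borel_measurable lebesgue" by (simp add: density_profile_def)
    show "sup_norm (\<lambda>x. f t x - 1 / (2 * pi)) \<le> ereal (2 * B / pi * exp (- (c * t)))"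
      unfolding sup_norm_def
    proof (rule esssup_I)
      show "(\<lambda>x. ereal \<bar>f t x - 1 / (2 * pi)\<bar>) \<in> borel_measurable lebesgue" using m by measurable
      show "AE x in lebesgue. ereal \<bar>f t x - 1 / (2 * pi)\<bar> \<le> ereal (2 * B / pi * exp (- (c * t)))"
        using bd(2)[OF t]
      proof eventually_elim
        case (elim x)
        then show ?case using bd(1)[OF t, of x] by simp
      qed
    qed
  qed (use B in auto)
qed

lemma Limsup_log_rate_neg:
  fixes N :: "real \<Rightarrow> ereal"
  assumes c: "0 < c" and D: "0 < D" and N: "\<And>t. t1 \<le> t \<Longrightarrow> N t \<le> ereal (D * exp (- (c * t)))"
  shows "Limsup at_top (\<lambda>t. ereal (1 / t) * ereal_log (N t)) < 0"
proof -
  have "Limsup at_top (\<lambda>t. ereal (1 / t) * ereal_log (N t)) \<le> ereal (- c / 2)"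
  proof (rule Limsup_bounded)
    have "eventually (\<lambda>t. max (max t1 1) (2 * ln D / c) \<le> t) at_top" by (rule eventually_ge_at_top)
    then show "eventually (\<lambda>t. ereal (1 / t) * ereal_log (N t) \<le> ereal (- c / 2)) at_top"
    proof eventually_elim
      case (elim t)
      then have t: "t1 \<le> t" "1 \<le> t" "2 * ln D / c \<le> t" by auto
      show ?case
      proof (cases "N t \<le> 0")
        case True
        then show ?thesis using t by (simp add: ereal_log_def)
      next
        case False
        then obtain y where y: "N t = ereal y" "0 < y" "y \<le> D * exp (- (c * t))"
          using N[OF t(1)] by (cases "N t") auto
        have "ln y \<le> ln (D * exp (- (c * t)))" using y D by (subst ln_le_cancel_iff) auto
        also have "\<dots> = ln D - c * t" using D by (simp add: ln_mult)
        also have "\<dots> \<le> - c / 2 * t" using t c by (simp add: field_simps)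
        finally have "1 / t * ln y \<le> - c / 2" using t by (simp add: field_simps)
        then show ?thesis using y by (simp add: ereal_log_def)
      qed
    qed
  qed
  also have "ereal (- c / 2) < 0" using c by simp
  finally show ?thesis .
qed

text \<open>
  If \<open>f0\<close> keeps the distance \<open>\<eta>\<close> from both bounds, the velocity is bounded below on the whole unit disk,
  and every positive time will do. In general it is bounded below on the disk of radius \<open>1 / 2\<close>, where
  the Poisson kernel is at least \<open>1 / 3\<close>, and times beyond \<open>ln 2 / c\<close> will do.
\<close>

theorem theorem4p2:
  fixes \<alpha> :: real and f0 :: "real \<Rightarrow> real" and f :: "real \<Rightarrow> real \<Rightarrow> real"
  assumes "0 < \<alpha>" and "\<alpha> < 1"
    and "exclusion_profile \<alpha> f0"
    and "weak_solution \<alpha> f0 f"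
  shows "((\<exists>\<eta>>0. AE x in lebesgue. \<eta> \<le> f0 x \<and> f0 x \<le> 1 / (2 * pi * \<alpha>) - \<eta>)
            \<longrightarrow> analytic_strong_after \<alpha> 0 f)
       \<and> (\<exists>tstar>0. analytic_strong_after \<alpha> tstar f)
       \<and> Limsup at_top (\<lambda>t. ereal (1 / t) * ereal_log (sup_norm (\<lambda>x. f t x - 1 / (2 * pi)))) < 0"
proof -
  note \<alpha> = assms(1,2) and w = assms(4)
  have d0: "density_profile f0" using assms(3) by (simp add: exclusion_profile_def)
  have part1: "analytic_strong_after \<alpha> 0 f"
    if \<eta>: "0 < \<eta>" "AE x in lebesgue. \<eta> \<le> f0 x \<and> f0 x \<le> 1 / (2 * pi * \<alpha>) - \<eta>" for \<eta>
  proof -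
    define \<delta> where "\<delta> = 2 * pi\<^sup>2 * \<alpha> * \<eta>"
    have \<delta>: "0 < \<delta>" using \<alpha> \<eta> by (simp add: \<delta>_def)
    have strip: "\<delta> \<le> pi * \<alpha> * Re (1 + 2 * moment_series f0 z)" "pi * \<alpha> * Re (1 + 2 * moment_series f0 z) \<le> pi - \<delta>"
      if z: "norm z < 1" for z
    proof -
      note b = Re_herglotz_bounds[OF d0 \<eta>(2) z]
      have \<kappa>: "0 \<le> (1 - norm z) / (1 + norm z)" using z by simp
      have "2 * pi * \<eta> \<le> Re (1 + 2 * moment_series f0 z)"
        using b(1) mult_nonneg_nonneg[OF \<kappa>, of "1 - 2 * pi * \<eta>"] b(3) by linarith
      then have "pi * \<alpha> * (2 * pi * \<eta>) \<le> pi * \<alpha> * Re (1 + 2 * moment_series f0 z)"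
        using \<alpha> by (intro mult_left_mono) auto
      then show "\<delta> \<le> pi * \<alpha> * Re (1 + 2 * moment_series f0 z)" by (simp add: \<delta>_def power2_eq_square mult_ac)
      have "Re (1 + 2 * moment_series f0 z) \<le> 2 * pi * (1 / (2 * pi * \<alpha>) - \<eta>)"
        using b(2) mult_nonneg_nonneg[OF \<kappa>, of "2 * pi * (1 / (2 * pi * \<alpha>) - \<eta>) - 1"] b(4) by linarith
      then have "pi * \<alpha> * Re (1 + 2 * moment_series f0 z) \<le> pi * \<alpha> * (2 * pi * (1 / (2 * pi * \<alpha>) - \<eta>))"
        using \<alpha> by (intro mult_left_mono) auto
      also have "\<dots> = pi - \<delta>" using \<alpha> by (simp add: \<delta>_def power2_eq_square field_simps)
      finally show "pi * \<alpha> * Re (1 + 2 * moment_series f0 z) \<le> pi - \<delta>" .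
    qed
    define c where "c = 2 * pi ^ 2 * sin \<delta> / sin (pi * \<alpha>)"
    have c: "0 < c" "\<And>z. norm z < 1 \<Longrightarrow> c \<le> Re (velocity \<alpha> (moment_series f0 z))"
      unfolding c_def using Re_velocity_lower_bound[OF \<alpha> \<delta> strip] norm_zero zero_less_one by (metis, metis)
    show ?thesis
    proof (rule analytic_strong_solution[OF \<alpha> w])
      show "analytic_coefficients_at t (\<lambda>t. herglotz_coeff (f t))" if "0 < t" for t
        using that c by (intro analytic_coefficients_weak_solution[OF w, of 1 c]) auto
    qed simp
  qed
  define \<delta> where "\<delta> = min (pi * \<alpha> / 3) (pi * (1 - \<alpha>) / 3)"
  have \<delta>: "0 < \<delta>" using \<alpha> by (simp add: \<delta>_def)
  have strip: "\<delta> \<le> pi * \<alpha> * Re (1 + 2 * moment_series f0 z)" "pi * \<alpha> * Re (1 + 2 * moment_series f0 z) \<le> pi - \<delta>"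
    if z: "norm z < 1 / 2" for z
  proof -
    have ae: "AE x in lebesgue. 0 \<le> f0 x \<and> f0 x \<le> 1 / (2 * pi * \<alpha>)"
      using assms(3) by (auto simp: exclusion_profile_def density_profile_def)
    have z1: "norm z < 1" using z by simp
    note b = Re_herglotz_bounds[OF d0 ae z1]
    define \<kappa> where "\<kappa> = (1 - norm z) / (1 + norm z)"
    have "0 < 1 + norm z" using norm_ge_zero[of z] by linarith
    then have \<kappa>: "1 / 3 \<le> \<kappa>" using z by (simp add: \<kappa>_def field_simps)
    have "\<kappa> \<le> Re (1 + 2 * moment_series f0 z)" using b(1) by (simp add: \<kappa>_def)
    then have "1 / 3 \<le> Re (1 + 2 * moment_series f0 z)" by (rule order_trans[OF \<kappa>])
    then have "pi * \<alpha> * (1 / 3) \<le> pi * \<alpha> * Re (1 + 2 * moment_series f0 z)"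
      using \<alpha> by (intro mult_left_mono) auto
    moreover have "\<delta> \<le> pi * \<alpha> * (1 / 3)" by (simp add: \<delta>_def)
    ultimately show "\<delta> \<le> pi * \<alpha> * Re (1 + 2 * moment_series f0 z)" by linarith
    have "Re (1 + 2 * moment_series f0 z) \<le> 2 * pi * (1 / (2 * pi * \<alpha>)) - \<kappa> * (2 * pi * (1 / (2 * pi * \<alpha>)) - 1)"
      using b(2) by (simp only: \<kappa>_def)
    also have "\<dots> \<le> 2 * pi * (1 / (2 * pi * \<alpha>)) - 1 / 3 * (2 * pi * (1 / (2 * pi * \<alpha>)) - 1)"
      using b(4) \<kappa> by (intro diff_left_mono mult_right_mono) auto
    finally have "pi * \<alpha> * Re (1 + 2 * moment_series f0 z) \<le> pi * \<alpha> * (2 * pi * (1 / (2 * pi * \<alpha>)) - 1 / 3 * (2 * pi * (1 / (2 * pi * \<alpha>)) - 1))"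
      using \<alpha> by (intro mult_left_mono) auto
    also have "\<dots> = pi - pi * (1 - \<alpha>) / 3" using \<alpha> by (simp add: field_simps)
    also have "\<dots> \<le> pi - \<delta>" by (simp add: \<delta>_def)
    finally show "pi * \<alpha> * Re (1 + 2 * moment_series f0 z) \<le> pi - \<delta>" .
  qed
  define c where "c = 2 * pi ^ 2 * sin \<delta> / sin (pi * \<alpha>)"
  have c: "0 < c" "\<And>z. norm z < 1 / 2 \<Longrightarrow> c \<le> Re (velocity \<alpha> (moment_series f0 z))"
    unfolding c_def using Re_velocity_lower_bound(1)[OF \<alpha> \<delta> strip] Re_velocity_lower_bound(2)[OF \<alpha> \<delta> strip[of 0]] by auto
  have part2a: "analytic_strong_after \<alpha> (ln 2 / c) f"
  proof (rule analytic_strong_solution[OF \<alpha> w])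
    show "0 \<le> ln 2 / c" using c by simp
    show "analytic_coefficients_at t (\<lambda>t. herglotz_coeff (f t))" if t: "ln 2 / c < t" for t
    proof (rule analytic_coefficients_weak_solution[OF w, of "1 / 2" c])
      have "0 < ln 2 / c" using c by simp
      then show "0 < t" using t by linarith
      have "ln 2 < c * t" using t c by (simp add: field_simps)
      then have "exp (ln 2) < exp (c * t)" by (subst exp_less_cancel_iff)
      then show "1 < 1 / 2 * exp (c * t)" by simp
    qed (use c in auto)
  qed
  obtain D t1 where D: "0 < D" "\<And>t. t1 \<le> t \<Longrightarrow> sup_norm (\<lambda>x. f t x - 1 / (2 * pi)) \<le> ereal (D * exp (- (c * t)))"
    using sup_norm_decay[OF w c] by metis
  have "Limsup at_top (\<lambda>t. ereal (1 / t) * ereal_log (sup_norm (\<lambda>x. f t x - 1 / (2 * pi)))) < 0"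
    by (rule Limsup_log_rate_neg[OF c(1) D])
  moreover have "0 < ln 2 / c" using c by simp
  ultimately show ?thesis using part1 part2a by blast
qed

end
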